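(* Let $m\ge 1$ be a fixed integer and let $\lambda=(\lambda_0,\lambda_1,\dots,\lambda_{2m})$ be a fixed vector of positive real weights which is symmetric, i.e. $\lambda_k=\lambda_{2m-k}$ for $0\le k\le 2m$. For $-\pi\le\beta_1<\beta_2\le\pi$ and $Q>0$ let \[ \Phi_{\beta_1,\beta_2}(Q):=\#\left\{\theta\in[\beta_1,\beta_2]\colon e^{i\theta}\text{ is an algebraic number of degree } 2m \text{ and } h_{\lambda}\left(e^{i\theta}\right)\leq Q\right\}. \] Then \[ \Phi_{\beta_1,\beta_2}(Q)=\frac{\mathrm{Vol}(\mathbb{B}^{m+1})}{2^{m/2+1}\,\pi\,\zeta(m+1)}\,\lambda_0\lambda_1\cdots\lambda_m\,Q^{m+1}\int_{\beta_1}^{\beta_2}p_{\lambda}(t)\,dt+O\left(Q^m\log Q\right),\qquad Q\to\infty, \] where \[ p_{\lambda}(t):=\left[\frac{\partial^2}{\partial x\,\partial y}\log\left(\frac{\lambda_m^{2}}{2}+\sum_{k=1}^{m}\lambda_{m-k}^{2}\cos(kx)\cos(ky)\right)\Big|_{x=y=t}\right]^{1/2}. \] The implicit constant in the $O$-term depends only on $\lambda$ and $m$ (in particular not on $\beta_1,\beta_2$), and for $m\ge 3$ the factor $\log Q$ in the error term can be omitted.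
   Context: For a polynomial $P(t)=a_{n}t^{n}+\dots+a_1t+a_0$ with $n=2m$, its elliptic height with respect to $\lambda$ is \[ h_{\lambda}(P):=\left(\sum_{k=0}^{n}\frac{a_k^2}{\lambda_k^2}\right)^{1/2}. \] A polynomial with integer coefficients is called prime if it is irreducible over $\mathbb{Q}$, primitive (its coefficients are co-prime), and has positive leading coefficient. The minimal polynomial of an algebraic number $\alpha$ is the unique prime polynomial $P\in\mathbb{Z}[t]$ with $P(\alpha)=0$; the degree of $\alpha$ is $\deg P$, and for $\alpha$ of degree $2m$ the elliptic height of $\alpha$ is $h_{\lambda}(\alpha):=h_{\lambda}(P)$. $\zeta$ is the Riemann zeta function, and $\mathbb{B}^{m+1}$ is the unit ball in $\mathbb{R}^{m+1}$ with volume $\mathrm{Vol}(\mathbb{B}^{m+1})$. *)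

theory Defs
  imports "HOL-Analysis.Analysis" "HOL-Computational_Algebra.Computational_Algebra"
begin

definition prime_int_poly :: "int poly \<Rightarrow> bool" where
  "prime_int_poly P \<longleftrightarrow>
     irreducible (map_poly of_int P :: rat poly) \<and> Polynomial.content P = 1 \<and> lead_coeff P > 0"

text \<open>
  The two functions below are meaningful only for arguments satisfying \<open>algebraic\<close>.
\<close>

definition min_int_poly :: "complex \<Rightarrow> int poly" where
  "min_int_poly \<alpha> = (THE P. prime_int_poly P \<and> poly (map_poly of_int P) \<alpha> = 0)"

definition algebraic_degree :: "complex \<Rightarrow> nat" where
  "algebraic_degree \<alpha> = degree (min_int_poly \<alpha>)"

text \<open>
  Only the entries \<open>lam 0, \<dots>, lam (2 * m)\<close> of the weight sequence matter. The height of a polynomial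
  is intended for polynomials of degree (at most) \<open>2 * m\<close>, that of a number for numbers of
  degree \<open>2 * m\<close>.
\<close>

definition elliptic_height_poly :: "nat \<Rightarrow> (nat \<Rightarrow> real) \<Rightarrow> real poly \<Rightarrow> real" where
  "elliptic_height_poly m lam P = sqrt (\<Sum>k\<le>2 * m. (coeff P k)\<^sup>2 / (lam k)\<^sup>2)"

definition elliptic_height :: "nat \<Rightarrow> (nat \<Rightarrow> real) \<Rightarrow> complex \<Rightarrow> real" where
  "elliptic_height m lam \<alpha> = elliptic_height_poly m lam (map_poly of_int (min_int_poly \<alpha>))"

definition angle_count :: "nat \<Rightarrow> (nat \<Rightarrow> real) \<Rightarrow> real \<Rightarrow> real \<Rightarrow> real \<Rightarrow> nat" where
  "angle_count m lam \<beta>\<^sub>1 \<beta>\<^sub>2 Q =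
     card {\<theta> \<in> {\<beta>\<^sub>1..\<beta>\<^sub>2}. algebraic (cis \<theta>) \<and> algebraic_degree (cis \<theta>) = 2 * m \<and>
                        elliptic_height m lam (cis \<theta>) \<le> Q}"

definition covariance :: "nat \<Rightarrow> (nat \<Rightarrow> real) \<Rightarrow> real \<Rightarrow> real \<Rightarrow> real" where
  "covariance m lam x y =
     (lam m)\<^sup>2 / 2 + (\<Sum>k=1..m. (lam (m - k))\<^sup>2 * cos (real k * x) * cos (real k * y))"

definition angle_density :: "nat \<Rightarrow> (nat \<Rightarrow> real) \<Rightarrow> real \<Rightarrow> real" where
  "angle_density m lam t =
     sqrt (deriv (\<lambda>x. deriv (\<lambda>y. ln (covariance m lam x y)) t) t)"

text \<open>The Dirichlet series of the Riemann zeta function; it represents zeta for \<open>s > 1\<close>.\<close>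

definition riemann_zeta :: "real \<Rightarrow> real" where
  "riemann_zeta s = (\<Sum>n. 1 / real (Suc n) powr s)"

definition main_term :: "nat \<Rightarrow> (nat \<Rightarrow> real) \<Rightarrow> real \<Rightarrow> real \<Rightarrow> real \<Rightarrow> real" where
  "main_term m lam \<beta>\<^sub>1 \<beta>\<^sub>2 Q =
     unit_ball_vol (real (m + 1)) / (2 powr (real m / 2 + 1) * pi * riemann_zeta (real (m + 1)))
       * (\<Prod>k\<le>m. lam k) * Q ^ (m + 1) * integral {\<beta>\<^sub>1..\<beta>\<^sub>2} (angle_density m lam)"

end

theory Submission
  imports Defs
begin

text \<open>
  The minimal polynomial of \<open>e\<^sup>i\<^sup>\<theta> \<noteq> \<plusminus>1\<close> is self-reciprocal of even degree \<open>2m\<close>, so its roots on the unit circle are the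
  zeros of \<open>b\<^sub>0 + 2 \<Sum> b\<^sub>k cos(k\<theta>)\<close>, where \<open>b\<^sub>k\<close> is the coefficient of index \<open>m - k\<close>. For fixed \<open>b' = (b\<^sub>1, \<dots>, b\<^sub>m)\<close> the
  zeros, summed over the admissible integers \<open>b\<^sub>0\<close>, are the points where \<open>h(\<theta>) = - 2 \<Sum> b\<^sub>k cos(k\<theta>)\<close> takes an integer value
  of bounded size; as \<open>h\<close> has boundedly many monotone pieces, their number is the integral of \<open>\<bar>h'\<bar>\<close> over the
  corresponding set, up to \<open>O(1)\<close>. Summing over \<open>b'\<close> under the integral, one is left, for each \<open>\<theta>\<close>, with the sum of the
  absolute value of a linear form over the integer points of an ellipsoid in \<open>\<real>\<^sup>m\<close>, which is the corresponding integral
  up to \<open>O(Q\<^sup>m)\<close>; rotations evaluate that integral and produce the density. Moebius inversion passes to primitive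
  polynomials. A primitive self-reciprocal polynomial with a root \<open>e\<^sup>i\<^sup>\<theta> \<noteq> \<plusminus>1\<close> that is not prime is a product of two
  self-reciprocal polynomials of even degree, and these are few because the height of a product is comparable to the
  product of the heights.
\<close>

section \<open>The Moebius function\<close>

text \<open>The error must be uniform in \<beta>1 and \<beta>2, so it must not depend on the shape
  of the region of polynomials swept out by the arc. Slicing along the middle coefficient secures
  this: the error of one slice depends only on m, and there are O(Q^m) slices. Once sum and integral
  are exchanged, the ellipsoid and the linear form at \<theta> have coefficients bounded in
  \<theta>, so one constant serves every angle. The integral of |w.c| over |c|^2 + (u.c)^2 \<le> 1
  is a constant times sqrt (W (1 + U) - V^2) / (1 + U), where U = u.u, V = u.w, W = w.w. For the
  cosine vector u and the vector w of its derivative this is, up to scale, the square root of (K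
  K_xy - K_x K_y) / K^2 on the diagonal, with K the covariance; hence the logarithm in the density.
  The power 2^(m/2) arises because each non-middle coefficient enters the height twice, the further
  factor 2 from the pair P, -P. A logarithm survives in two cases only: for m = 1 from the harmonic
  sum in the Moebius inversion, for m = 2 from products of two quadratic factors.\<close>

definition moebius :: "nat \<Rightarrow> real" where
  "moebius n = (if squarefree n then (- 1) ^ card (prime_factors n) else 0)"

lemma abs_moebius_le: "\<bar>moebius n\<bar> \<le> 1"
  by (simp add: moebius_def power_abs)

lemma moebius_prime_mult:
  assumes "prime p" "\<not> p dvd d" "squarefree d"
  shows "squarefree (p * d)" "moebius (p * d) = - moebius d"
proof -
  have cop: "coprime p d" using assms prime_imp_coprime by blast
  show sq: "squarefree (p * d)"
    using cop assms squarefree_prime by (intro squarefree_mult_coprime) auto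
  have d0: "d \<noteq> 0" using assms by (metis not_squarefree_0)
  have "prime_factors (p * d) = insert p (prime_factors d)"
    using assms d0 by (subst prime_factors_product) (auto simp: prime_prime_factors)
  moreover have "p \<notin> prime_factors d" using assms by auto
  ultimately show "moebius (p * d) = - moebius d"
    using sq assms by (simp add: moebius_def)
qed

text \<open>Fix a prime p dividing n. The map d \<mapsto> p d pairs the squarefree divisors prime to
  p with those divisible by p, and it changes the sign of the Moebius function.\<close>

lemma sum_moebius_divisors:
  assumes "n > 0"
  shows "(\<Sum>d | d dvd n. moebius d) = (if n = 1 then 1 else 0)"
proof (cases "n = 1")
  case True
  then show ?thesis by (simp add: moebius_def)
next
  case False
  then obtain p where p: "prime p" "p dvd n" using prime_factor_nat by blast
  define A where "A = {d. d dvd n \<and> squarefree d \<and> \<not> p dvd d}"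
  define B where "B = {d. d dvd n \<and> squarefree d \<and> p dvd d}"
  have fin: "finite {d. d dvd n}" using assms by simp
  have "(\<Sum>d | d dvd n. moebius d) = (\<Sum>d\<in>A \<union> B. moebius d)"
    using fin by (intro sum.mono_neutral_right) (auto simp: A_def B_def moebius_def)
  also have "\<dots> = (\<Sum>d\<in>A. moebius d) + (\<Sum>d\<in>B. moebius d)"
    by (rule sum.union_disjoint) (auto simp: A_def B_def intro: finite_subset[OF _ fin])
  also have "(\<Sum>d\<in>B. moebius d) = (\<Sum>d\<in>A. - moebius d)"
  proof (rule sum.reindex_bij_witness[of _ "\<lambda>d. p * d" "\<lambda>d. d div p"])
    fix d assume d: "d \<in> B"
    then obtain e where e: "d = p * e" by (auto simp: B_def)
    have p0: "p > 0" using p(1) by (simp add: prime_gt_0_nat)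
    show "p * (d div p) = d" using e p0 by simp
    have "\<not> p dvd e"
    proof
      assume "p dvd e"
      then have "p\<^sup>2 dvd d" unfolding e power2_eq_square by (intro mult_dvd_mono) auto
      then have "p dvd 1" using d squarefreeD[of d p] by (simp add: B_def)
      then show False using p(1) not_prime_unit by blast
    qed
    moreover have "squarefree e" using d e squarefree_mono[of e d] by (auto simp: B_def)
    moreover have "e dvd n" using d e by (auto simp: B_def intro: dvd_trans)
    ultimately show "d div p \<in> A" using p0 by (simp add: A_def e)
    then show "- moebius (d div p) = moebius d"
      using moebius_prime_mult(2)[OF p(1), of "d div p"] e p0 by (simp add: A_def)
  next
    fix d assume d: "d \<in> A"
    show "p * d div p = d" using p(1) by (simp add: prime_gt_0_nat)
    have "coprime p d" using d p(1) prime_imp_coprime by (auto simp: A_def)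
    then have "p * d dvd n" using d p by (intro divides_mult) (auto simp: A_def)
    then show "p * d \<in> B" using d moebius_prime_mult(1)[OF p(1), of d] by (auto simp: A_def B_def)
  qed
  finally show ?thesis using False by (simp add: sum_negf)
qed

text \<open>Telescoping 1/n^2 \<le> 1/(n-1) - 1/n. The sum runs over an arbitrary finite set because
  \<open>has_sum\<close> is later bounded through its finite partial sums.\<close>

lemma sum_inverse_power_tail_le:
  fixes F :: "nat set"
  assumes "finite F" "F \<subseteq> {D<..}" "D \<ge> 1" "s \<ge> 2"
  shows "(\<Sum>n\<in>F. 1 / real n ^ s) \<le> 1 / real D"
proof -
  have "(\<Sum>n\<in>F. 1 / real n ^ s) \<le> (\<Sum>n\<in>{D<..D + k}. 1 / real n ^ s)"
    if "F \<subseteq> {D<..D + k}" for k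
    using that by (intro sum_mono2) auto
  moreover obtain k where "F \<subseteq> {D<..D + k}"
  proof
    show "F \<subseteq> {D<..D + Max (insert 0 F)}"
    proof
      fix x assume x: "x \<in> F"
      then have "x \<le> Max (insert 0 F)" using assms(1) by (intro Max_ge) auto
      then show "x \<in> {D<..D + Max (insert 0 F)}" using x assms(2) by auto
    qed
  qed
  moreover have "(\<Sum>n\<in>{D<..D + k}. 1 / real n ^ s) \<le> 1 / real D - 1 / real (D + k)"
  proof (induction k)
    case 0
    then show ?case by simp
  next
    case (Suc k)
    let ?x = "real (D + k)"
    have x: "?x \<ge> 1" using assms by linarith
    have "1 / (?x + 1) ^ s \<le> 1 / (?x + 1)\<^sup>2"
      using x assms(4) by (intro divide_left_mono power_increasing) auto
    also have "\<dots> \<le> 1 / ?x - 1 / (?x + 1)"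
    proof -
      have "1 / ?x - 1 / (?x + 1) = 1 / (?x * (?x + 1))"
        using x by (simp add: field_simps)
      then show ?thesis
        using x by (simp only:) (intro divide_left_mono, auto simp: power2_eq_square)
    qed
    finally have "1 / (?x + 1) ^ s \<le> 1 / ?x - 1 / (?x + 1)" .
    moreover have "{D<..D + Suc k} = insert (D + Suc k) {D<..D + k}" by auto
    ultimately show ?case using Suc by (simp add: add_ac)
  qed
  moreover have "1 / real D - 1 / real (D + k) \<le> 1 / real D" for k by simp
  ultimately show ?thesis by (meson order_trans)
qed

text \<open>The Dirichlet series becomes an unconditional sum over the positive integers, which can
  be multiplied by another one and regrouped.\<close>

lemma has_sum_riemann_zeta:
  assumes "s \<ge> 2"
  shows "((\<lambda>n. 1 / real n ^ s) has_sum riemann_zeta (real s)) {1..}"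
proof -
  have eq: "1 / real (Suc n) powr real s = 1 / real (Suc n) ^ s" for n
    by (simp add: powr_realpow)
  have "summable (\<lambda>n. 1 / real (Suc n) ^ s)"
    using inverse_power_summable[OF assms, where 'a = real]
    by (subst (asm) summable_Suc_iff[symmetric]) (simp add: field_simps)
  then have "(\<lambda>n. 1 / real (Suc n) ^ s) sums riemann_zeta (real s)"
    unfolding riemann_zeta_def eq by (rule summable_sums)
  moreover have "summable (\<lambda>n. norm (1 / real (Suc n) ^ s))"
    using \<open>summable (\<lambda>n. 1 / real (Suc n) ^ s)\<close> by simp
  ultimately have "((\<lambda>n. 1 / real (Suc n) ^ s) has_sum riemann_zeta (real s)) UNIV"
    by (intro norm_summable_imp_has_sum)
  also have "?this \<longleftrightarrow> ?thesis"
    by (rule has_sum_reindex_bij_witness[of _ "\<lambda>n. n - 1" Suc]) auto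
  finally show ?thesis .
qed

text \<open>Both series converge absolutely, so their product is a double sum over (d, n). Grouped
  by k = d n, only k = 1 survives, by \<open>sum_moebius_divisors\<close>. The product being 1, zeta
  cannot vanish.\<close>

lemma moebius_zeta:
  assumes "s \<ge> 2"
  shows "((\<lambda>n. moebius n / real n ^ s) has_sum 1 / riemann_zeta (real s)) {1..}" "riemann_zeta (real s) \<noteq> 0"
proof -
  let ?A = "{1..} :: nat set"
  let ?f = "\<lambda>n. moebius n / real n ^ s" and ?g = "\<lambda>n. 1 / real n ^ s"
  let ?z = "riemann_zeta (real s)"
  have g: "(?g has_sum ?z) ?A" by (rule has_sum_riemann_zeta[OF assms])
  have gabs: "(\<lambda>n. norm (?g n)) summable_on ?A" using g by (simp add: summable_on_def) blast
  have fabs: "(\<lambda>n. norm (?f n)) summable_on ?A"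
  proof (rule Infinite_Sum.abs_summable_on_comparison_test[OF gabs])
    fix n :: nat
    show "norm (?f n) \<le> norm (?g n)"
      using abs_moebius_le[of n] by (simp add: divide_right_mono)
  qed
  obtain a where a: "(?f has_sum a) ?A"
    using Infinite_Sum.abs_summable_summable[OF fabs] unfolding summable_on_def by blast
  have "((\<lambda>(d, n). ?f d * ?g n) has_sum (a * ?z)) (Sigma ?A (\<lambda>_. ?A))"
  proof (rule has_sum_SigmaI[where g = "\<lambda>d. ?f d * ?z"])
    show "((\<lambda>n. case (d, n) of (d, n) \<Rightarrow> ?f d * ?g n) has_sum ?f d * ?z) ?A" for d
      unfolding prod.case by (rule has_sum_cmult_right[OF g])
    show "((\<lambda>d. ?f d * ?z) has_sum a * ?z) ?A" by (rule has_sum_cmult_left[OF a])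
    have "(\<lambda>x. norm (case x of (d, n) \<Rightarrow> ?f d * ?g n)) summable_on (Sigma ?A (\<lambda>_. ?A))"
    proof (subst Infinite_Sum.abs_summable_on_Sigma_iff, intro conjI ballI)
      show "(\<lambda>y. norm (case (d, y) of (d, n) \<Rightarrow> ?f d * ?g n)) summable_on ?A" for d
        unfolding prod.case norm_mult by (rule summable_on_cmult_right[OF gabs])
      have "(\<Sum>\<^sub>\<infinity>y\<in>?A. norm (case (d, y) of (d, n) \<Rightarrow> ?f d * ?g n)) = norm (?f d) * (\<Sum>\<^sub>\<infinity>y\<in>?A. norm (?g y))" for d
        unfolding prod.case norm_mult by (rule infsum_cmult_right) (use gabs in auto)
      then show "(\<lambda>d. norm (\<Sum>\<^sub>\<infinity>y\<in>?A. norm (case (d, y) of (d, n) \<Rightarrow> ?f d * ?g n))) summable_on ?A"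
        using summable_on_cmult_left[OF fabs, of "norm (\<Sum>\<^sub>\<infinity>y\<in>?A. norm (?g y))"]
        by (simp only: norm_mult real_norm_def abs_mult abs_idempotent)
    qed
    then show "(\<lambda>(d, n). ?f d * ?g n) summable_on (Sigma ?A (\<lambda>_. ?A))"
      by (rule abs_summable_summable)
  qed
  \<comment> \<open>Passage from pairs (d, n) to pairs (k, d) with k = d n and d dividing k.\<close>
  also have "((\<lambda>(d, n). ?f d * ?g n) has_sum (a * ?z)) (Sigma ?A (\<lambda>_. ?A)) \<longleftrightarrow>
     ((\<lambda>(k, d). moebius d / real k ^ s) has_sum (a * ?z)) (Sigma ?A (\<lambda>k. {d. d dvd k}))"
  proof (rule has_sum_reindex_bij_witness[of _ "\<lambda>(k, d). (d, k div d)" "\<lambda>(d, n). (d * n, d)"])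
    fix x assume "x \<in> Sigma ?A (\<lambda>k. {d. d dvd k})"
    then obtain k d where x: "x = (k, d)" "k \<ge> 1" "d dvd k" by auto
    then have "d > 0" "k div d > 0" by (auto intro: Nat.gr0I)
    then show "(case x of (k, d) \<Rightarrow> (d, k div d)) \<in> Sigma ?A (\<lambda>_. ?A)" by (simp add: x(1))
  qed (auto simp: power_mult_distrib)
  finally have "((\<lambda>k. \<Sum>d | d dvd k. moebius d / real k ^ s) has_sum (a * ?z)) ?A"
  proof (rule has_sum_SigmaD)
    fix k assume "k \<in> ?A"
    then show "((\<lambda>d. case (k, d) of (k, d) \<Rightarrow> moebius d / real k ^ s) has_sum (\<Sum>d | d dvd k. moebius d / real k ^ s)) {d. d dvd k}"
      unfolding prod.case by (intro has_sum_finite) auto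
  qed
  also have "?this \<longleftrightarrow> ((\<lambda>k. if k = 1 then 1 else 0) has_sum (a * ?z)) ?A"
  proof (rule has_sum_cong)
    fix k assume "k \<in> ?A"
    then show "(\<Sum>d | d dvd k. moebius d / real k ^ s) = (if k = 1 then 1 else 0)"
      using sum_moebius_divisors[of k] by (simp flip: sum_divide_distrib)
  qed
  finally have "((\<lambda>k. if k = 1 then 1 else 0) has_sum (a * ?z)) ?A" .
  moreover have "((\<lambda>k. if k = 1 then 1 else 0 :: real) has_sum 1) ?A"
    using has_sum_finite_neutralI[of "{1}" ?A "\<lambda>k. if k = 1 then 1 else 0 :: real" 1] by auto
  ultimately have az: "a * ?z = 1" by (rule has_sum_unique)
  then show "?z \<noteq> 0" by auto
  then have "a = 1 / ?z" using az by (simp add: field_simps)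
  then show "(?f has_sum 1 / ?z) ?A" using a by simp
qed

lemma sum_moebius_approx:
  assumes "s \<ge> 2" "D \<ge> 1"
  shows "\<bar>(\<Sum>n=1..D. moebius n / real n ^ s) - 1 / riemann_zeta (real s)\<bar> \<le> 1 / real D"
proof -
  let ?f = "\<lambda>n. moebius n / real n ^ s"
  have f: "(?f has_sum 1 / riemann_zeta (real s)) {1..}" by (rule moebius_zeta[OF assms(1)])
  have "(?f has_sum (1 / riemann_zeta (real s) - (\<Sum>n=1..D. ?f n))) ({1..} - {1..D})"
    by (rule has_sum_Diff[OF f has_sum_finite]) auto
  also have "{1..} - {1..D} = {D<..}" using assms(2) by auto
  finally have tail: "(?f has_sum (1 / riemann_zeta (real s) - (\<Sum>n=1..D. ?f n))) {D<..}" .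
  have bound: "\<bar>\<Sum>n\<in>F. ?f n\<bar> \<le> 1 / real D" if "finite F" "F \<subseteq> {D<..}" for F
  proof -
    have "\<bar>\<Sum>n\<in>F. ?f n\<bar> \<le> (\<Sum>n\<in>F. \<bar>?f n\<bar>)" by (rule sum_abs)
    also have "\<dots> \<le> (\<Sum>n\<in>F. 1 / real n ^ s)"
      using abs_moebius_le by (intro sum_mono) (simp add: divide_right_mono)
    also have "\<dots> \<le> 1 / real D" using that assms by (intro sum_inverse_power_tail_le)
    finally show ?thesis .
  qed
  have "1 / riemann_zeta (real s) - (\<Sum>n=1..D. ?f n) \<le> 1 / real D"
    by (rule has_sum_le_finite_sums[OF tail]) (use bound abs_le_D1 in blast)
  moreover have "- (1 / riemann_zeta (real s) - (\<Sum>n=1..D. ?f n)) \<le> 1 / real D"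
  proof (rule has_sum_le_finite_sums)
    show "((\<lambda>n. - ?f n) has_sum - (1 / riemann_zeta (real s) - (\<Sum>n=1..D. ?f n))) {D<..}"
      using tail by (simp only: has_sum_uminus minus_minus)
    show "(\<Sum>n\<in>F. - ?f n) \<le> 1 / real D" if "finite F" "F \<subseteq> {D<..}" for F
      using bound[OF that] by (simp add: sum_negf)
  qed
  ultimately show ?thesis by linarith
qed

lemma harmonic_sum_le:
  assumes "n \<ge> 1"
  shows "(\<Sum>k=1..n. 1 / real k) \<le> 1 + ln (real n)"
  using assms
proof (induction n rule: nat_induct_at_least)
  case base
  then show ?case by simp
next
  case (Suc n)
  have "1 / real (Suc n) \<le> ln (real (Suc n)) - ln (real n)"
  proof -
    have "ln (real n / real (Suc n)) \<le> real n / real (Suc n) - 1"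
      using Suc by (intro ln_le_minus_one) auto
    also have "\<dots> = - (1 / real (Suc n))" by (simp add: field_simps)
    finally show ?thesis using Suc by (simp add: ln_div)
  qed
  then show ?case using Suc by simp
qed

lemma sum_inverse_power_le:
  assumes "s \<ge> 2"
  shows "(\<Sum>k=1..n. 1 / real k ^ s) \<le> 2"
proof (cases "n \<ge> 1")
  case True
  then have "(\<Sum>k=1..n. 1 / real k ^ s) = 1 + (\<Sum>k\<in>{1<..n}. 1 / real k ^ s)"
    by (subst sum.head) auto
  also have "(\<Sum>k\<in>{1<..n}. 1 / real k ^ s) \<le> 1 / real 1"
    using assms by (intro sum_inverse_power_tail_le) auto
  finally show ?thesis by simp
qed simp

text \<open>If \<open>F(Q) = \<Sum>\<^sub>d G(Q / d)\<close>, then the sum on the left-hand side is \<open>G(Q)\<close>.\<close>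

lemma moebius_inversion_asymptotics:
  assumes m: "m \<ge> 1" and D: "D \<ge> 1" and Q: "Q \<ge> 0"
    and F: "\<And>d. 1 \<le> d \<Longrightarrow> d \<le> D \<Longrightarrow> \<bar>F (Q / real d) - V * (Q / real d) ^ (m + 1)\<bar> \<le> C * (Q / real d) ^ m"
  shows "\<bar>(\<Sum>d=1..D. moebius d * F (Q / real d)) - V * Q ^ (m + 1) / riemann_zeta (real (m + 1))\<bar>
    \<le> C * Q ^ m * (\<Sum>d=1..D. 1 / real d ^ m) + \<bar>V\<bar> * Q ^ (m + 1) / real D"
proof -
  have "\<bar>(\<Sum>d=1..D. moebius d * F (Q / real d)) - (\<Sum>d=1..D. moebius d * (V * (Q / real d) ^ (m + 1)))\<bar>
     \<le> (\<Sum>d=1..D. C * (Q / real d) ^ m)"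
    unfolding sum_subtractf[symmetric]
  proof (rule order.trans[OF sum_abs sum_mono])
    fix d assume d: "d \<in> {1..D}"
    have "\<bar>moebius d * F (Q / real d) - moebius d * (V * (Q / real d) ^ (m + 1))\<bar> =
       \<bar>moebius d\<bar> * \<bar>F (Q / real d) - V * (Q / real d) ^ (m + 1)\<bar>"
      by (simp only: abs_mult right_diff_distrib[symmetric])
    also have "\<dots> \<le> 1 * (C * (Q / real d) ^ m)"
      using abs_moebius_le F[of d] d by (intro mult_mono) auto
    finally show "\<bar>moebius d * F (Q / real d) - moebius d * (V * (Q / real d) ^ (m + 1))\<bar> \<le> C * (Q / real d) ^ m"
      by simp
  qed
  also have "(\<Sum>d=1..D. C * (Q / real d) ^ m) = C * Q ^ m * (\<Sum>d=1..D. 1 / real d ^ m)"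
    by (simp add: sum_distrib_left power_divide)
  finally have 1: "\<bar>(\<Sum>d=1..D. moebius d * F (Q / real d)) - (\<Sum>d=1..D. moebius d * (V * (Q / real d) ^ (m + 1)))\<bar>
     \<le> C * Q ^ m * (\<Sum>d=1..D. 1 / real d ^ m)" .
  have "(\<Sum>d=1..D. moebius d * (V * (Q / real d) ^ (m + 1))) = V * Q ^ (m + 1) * (\<Sum>d=1..D. moebius d / real d ^ (m + 1))"
    unfolding sum_distrib_left by (intro sum.cong) (auto simp: power_divide)
  then have "\<bar>(\<Sum>d=1..D. moebius d * (V * (Q / real d) ^ (m + 1))) - V * Q ^ (m + 1) / riemann_zeta (real (m + 1))\<bar> =
     \<bar>V\<bar> * Q ^ (m + 1) * \<bar>(\<Sum>d=1..D. moebius d / real d ^ (m + 1)) - 1 / riemann_zeta (real (m + 1))\<bar>"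
  proof -
    define S where "S = (\<Sum>d=1..D. moebius d / real d ^ (m + 1))"
    have "V * Q ^ (m + 1) * S - V * Q ^ (m + 1) / riemann_zeta (real (m + 1)) =
        V * Q ^ (m + 1) * (S - 1 / riemann_zeta (real (m + 1)))"
      by (simp add: right_diff_distrib)
    then show ?thesis
      using Q \<open>_ = V * Q ^ (m + 1) * (\<Sum>d=1..D. moebius d / real d ^ (m + 1))\<close>
      unfolding S_def[symmetric] by (simp only: abs_mult) simp
  qed
  also have "\<dots> \<le> \<bar>V\<bar> * Q ^ (m + 1) * (1 / real D)"
    using sum_moebius_approx[of "m + 1" D] m D Q by (intro mult_left_mono) auto
  finally show ?thesis using 1 by simp
qed

section \<open>Integer values of a piecewise monotone function\<close>

lemma card_Ints_atLeastAtMost: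
  fixes p q :: real
  assumes "p \<le> q"
  shows "finite ({p..q} \<inter> \<int>)" "\<bar>real (card ({p..q} \<inter> \<int>)) - (q - p)\<bar> \<le> 1"
proof -
  have eq: "{p..q} \<inter> \<int> = (of_int ` {\<lceil>p\<rceil>..\<lfloor>q\<rfloor>} :: real set)"
    by (auto simp: Ints_def le_floor_iff ceiling_le_iff image_iff)
  show "finite ({p..q} \<inter> \<int>)" unfolding eq by simp
  have "card ({p..q} \<inter> \<int>) = nat (\<lfloor>q\<rfloor> - \<lceil>p\<rceil> + 1)"
    unfolding eq by (subst card_image) (auto simp: inj_on_def)
  moreover have "\<lfloor>q\<rfloor> - \<lceil>p\<rceil> + 1 \<ge> 0" using assms by linarith
  ultimately have "real (card ({p..q} \<inter> \<int>)) = of_int \<lfloor>q\<rfloor> - of_int \<lceil>p\<rceil> + 1" by simp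
  then show "\<bar>real (card ({p..q} \<inter> \<int>)) - (q - p)\<bar> \<le> 1" by linarith
qed

lemma nonvanishing_sign_on_interval:
  fixes g :: "real \<Rightarrow> real"
  assumes "continuous_on {a<..<b} g" "\<And>x. x \<in> {a<..<b} \<Longrightarrow> g x \<noteq> 0"
  shows "(\<forall>x\<in>{a<..<b}. g x > 0) \<or> (\<forall>x\<in>{a<..<b}. g x < 0)"
proof (rule ccontr)
  assume "\<not> ?thesis"
  then obtain x y where xy: "x \<in> {a<..<b}" "g x < 0" "y \<in> {a<..<b}" "g y > 0"
    using assms(2) by (metis linorder_less_linear)
  have "connected (g ` {a<..<b})"
    by (intro connected_continuous_image assms connected_Ioo)
  then have "0 \<in> g ` {a<..<b}"
    using xy unfolding connected_iff_interval by (meson image_eqI less_imp_le)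
  then show False using assms(2) by auto
qed

text \<open>\<open>h\<close> maps the counted points bijectively onto the integers in [h a, h b],
  while the integral of \<open>h'\<close> is h b - h a, so the true discrepancy is at most 1. The
  bound 2 is the common one for all kinds of pieces. Strictness is assumed in the interior only,
  since the endpoints will be zeros of \<open>h'\<close> or crossings of h^2 = R.\<close>

lemma count_integer_values_increasing:
  fixes h h' :: "real \<Rightarrow> real"
  assumes ab: "a < b"
    and h: "\<And>x. x \<in> {a..b} \<Longrightarrow> (h has_real_derivative h' x) (at x)"
    and pos: "\<And>x. x \<in> {a<..<b} \<Longrightarrow> h' x > 0"
    and R: "\<And>x. x \<in> {a<..<b} \<Longrightarrow> (h x)\<^sup>2 < R"
  shows "\<exists>v. ((\<lambda>x. if (h x)\<^sup>2 \<le> R then \<bar>h' x\<bar> else 0) has_integral v) {a..b} \<and>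
    finite {x \<in> {a..b}. h x \<in> \<int> \<and> (h x)\<^sup>2 \<le> R} \<and>
    \<bar>real (card {x \<in> {a..b}. h x \<in> \<int> \<and> (h x)\<^sup>2 \<le> R}) - v\<bar> \<le> 2"
proof -
  have cont: "continuous_on {a..b} h"
    using h by (meson DERIV_continuous continuous_at_imp_continuous_on)
  have le: "(h x)\<^sup>2 \<le> R" if "x \<in> {a..b}" for x
  proof (rule continuous_le_on_closure[where S = "{a<..<b}" and f = "\<lambda>x. (h x)\<^sup>2"])
    show "continuous_on (closure {a<..<b}) (\<lambda>x. (h x)\<^sup>2)"
      using ab cont by (auto intro!: continuous_intros)
    show "x \<in> closure {a<..<b}" using that ab by simp
  qed (use R less_imp_le in blast)
  have mono: "h x < h y" if "a \<le> x" "x < y" "y \<le> b" for x y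
  proof (rule DERIV_pos_imp_increasing_open[OF \<open>x < y\<close>])
    show "continuous_on {x..y} h" using cont by (rule continuous_on_subset) (use that in auto)
    show "\<exists>l. (h has_real_derivative l) (at z) \<and> 0 < l" if "x < z" "z < y" for z
      using h[of z] pos[of z] that \<open>a \<le> x\<close> \<open>y \<le> b\<close> by auto
  qed
  have "(h' has_integral (h b - h a)) {a..b}"
    using ab h by (intro fundamental_theorem_of_calculus)
      (auto simp: has_real_derivative_iff_has_vector_derivative[symmetric] intro: has_field_derivative_at_within)
  then have int: "((\<lambda>x. if (h x)\<^sup>2 \<le> R then \<bar>h' x\<bar> else 0) has_integral (h b - h a)) {a..b}"
  proof (rule has_integral_spike_finite[rotated 2, where S = "{a, b}"])
    fix x assume "x \<in> {a..b} - {a, b}"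
    then have "x \<in> {a<..<b}" by auto
    then show "(if (h x)\<^sup>2 \<le> R then \<bar>h' x\<bar> else 0) = h' x" using pos[of x] R[of x] by simp
  qed auto
  have eq: "{x \<in> {a..b}. h x \<in> \<int> \<and> (h x)\<^sup>2 \<le> R} = {x \<in> {a..b}. h x \<in> \<int>}" using le by auto
  have "bij_betw h {x \<in> {a..b}. h x \<in> \<int>} ({h a..h b} \<inter> \<int>)"
  proof (rule bij_betwI')
    fix x y assume "x \<in> {x \<in> {a..b}. h x \<in> \<int>}" "y \<in> {x \<in> {a..b}. h x \<in> \<int>}"
    then show "(h x = h y) = (x = y)" using mono[of x y] mono[of y x] by force
  next
    fix x assume "x \<in> {x \<in> {a..b}. h x \<in> \<int>}"
    then show "h x \<in> {h a..h b} \<inter> \<int>" using mono[of a x] mono[of x b] by force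
  next
    fix y assume "y \<in> {h a..h b} \<inter> \<int>"
    then show "\<exists>x\<in>{x \<in> {a..b}. h x \<in> \<int>}. y = h x"
      using IVT'[of h a y b] ab cont by force
  qed
  then have "card {x \<in> {a..b}. h x \<in> \<int>} = card ({h a..h b} \<inter> \<int>)" "finite {x \<in> {a..b}. h x \<in> \<int>}"
    using card_Ints_atLeastAtMost(1)[of "h a" "h b"] mono[of a b] ab
    by (auto simp: bij_betw_same_card bij_betw_finite)
  with card_Ints_atLeastAtMost(2)[of "h a" "h b"] mono[of a b] ab int show ?thesis
    unfolding eq by (intro exI[of _ "h b - h a"]) auto
qed

text \<open>In the interior both h^2 - R and \<open>h'\<close> keep their sign. If h^2 > R, only the
  two endpoints can be counted and the integral is 0; if \<open>h\<close> decreases, -h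
  increases.\<close>

lemma count_integer_values_piece:
  fixes h h' :: "real \<Rightarrow> real"
  assumes ab: "a \<le> b"
    and h: "\<And>x. x \<in> {a..b} \<Longrightarrow> (h has_real_derivative h' x) (at x)"
    and h': "continuous_on {a..b} h'"
    and nz: "\<And>x. x \<in> {a<..<b} \<Longrightarrow> h' x \<noteq> 0 \<and> (h x)\<^sup>2 \<noteq> R"
  shows "\<exists>v. ((\<lambda>x. if (h x)\<^sup>2 \<le> R then \<bar>h' x\<bar> else 0) has_integral v) {a..b} \<and>
    finite {x \<in> {a..b}. h x \<in> \<int> \<and> (h x)\<^sup>2 \<le> R} \<and>
    \<bar>real (card {x \<in> {a..b}. h x \<in> \<int> \<and> (h x)\<^sup>2 \<le> R}) - v\<bar> \<le> 2"
proof (cases "a < b")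
  case False
  then have "a = b" using ab by simp
  have "{x \<in> {b..b}. h x \<in> \<int> \<and> (h x)\<^sup>2 \<le> R} \<subseteq> {b}" by auto
  moreover from this have "card {x \<in> {b..b}. h x \<in> \<int> \<and> (h x)\<^sup>2 \<le> R} \<le> 1"
    using card_mono[of "{b}"] by force
  ultimately show ?thesis unfolding \<open>a = b\<close>
    by (intro exI[of _ 0]) (auto intro: finite_subset)
next
  case True
  have cont: "continuous_on {a..b} h"
    using h by (meson DERIV_continuous continuous_at_imp_continuous_on)
  have "continuous_on {a<..<b} (\<lambda>x. R - (h x)\<^sup>2)"
    using cont by (auto intro!: continuous_intros intro: continuous_on_subset)
  from nonvanishing_sign_on_interval[OF this] nz
  consider (lt) "\<forall>x\<in>{a<..<b}. (h x)\<^sup>2 < R" | (gt) "\<forall>x\<in>{a<..<b}. (h x)\<^sup>2 > R"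
    by force
  then show ?thesis
  proof cases
    case gt
    have sub: "{x \<in> {a..b}. h x \<in> \<int> \<and> (h x)\<^sup>2 \<le> R} \<subseteq> {a, b}"
    proof
      fix x assume "x \<in> {x \<in> {a..b}. h x \<in> \<int> \<and> (h x)\<^sup>2 \<le> R}"
      then have "x \<in> {a..b}" "x \<notin> {a<..<b}" using gt by (auto simp flip: not_less)
      then show "x \<in> {a, b}" by auto
    qed
    then have "card {x \<in> {a..b}. h x \<in> \<int> \<and> (h x)\<^sup>2 \<le> R} \<le> card {a, b}"
      by (intro card_mono) auto
    also have "\<dots> \<le> 2" by (simp add: card_insert_if)
    finally have "card {x \<in> {a..b}. h x \<in> \<int> \<and> (h x)\<^sup>2 \<le> R} \<le> 2" .
    moreover have "((\<lambda>x. if (h x)\<^sup>2 \<le> R then \<bar>h' x\<bar> else 0) has_integral 0) {a..b}"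
    proof (rule has_integral_spike_finite[where S = "{a, b}" and f = "\<lambda>_. 0"])
      fix x assume "x \<in> {a..b} - {a, b}"
      then have "x \<in> {a<..<b}" by auto
      then show "(if (h x)\<^sup>2 \<le> R then \<bar>h' x\<bar> else 0) = 0" using gt by force
    qed auto
    ultimately show ?thesis using sub by (intro exI[of _ 0]) (auto intro: finite_subset)
  next
    case lt
    have "continuous_on {a<..<b} h'" using h' by (rule continuous_on_subset) auto
    from nonvanishing_sign_on_interval[OF this] nz
    consider (pos) "\<forall>x\<in>{a<..<b}. h' x > 0" | (neg) "\<forall>x\<in>{a<..<b}. h' x < 0" by blast
    then show ?thesis
    proof cases
      case pos
      show ?thesis
        by (rule count_integer_values_increasing[OF True h]) (use pos lt in auto)
    next
      case neg
      have "\<exists>v. ((\<lambda>x. if (- h x)\<^sup>2 \<le> R then \<bar>- h' x\<bar> else 0) has_integral v) {a..b} \<and>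
          finite {x \<in> {a..b}. - h x \<in> \<int> \<and> (- h x)\<^sup>2 \<le> R} \<and>
          \<bar>real (card {x \<in> {a..b}. - h x \<in> \<int> \<and> (- h x)\<^sup>2 \<le> R}) - v\<bar> \<le> 2"
        by (rule count_integer_values_increasing[OF True])
          (use neg lt in \<open>auto intro!: derivative_eq_intros h\<close>)
      then show ?thesis by (simp only: minus_in_Ints_iff power2_minus abs_minus_cancel)
    qed
  qed
qed

text \<open>Cut the interval at the points of \<open>Z\<close>. Each cut adds one piece, with error
  2, and one endpoint that is counted twice, with error 1; n cuts thus give 3 n + 2.\<close>

lemma count_integer_values:
  fixes h h' :: "real \<Rightarrow> real"
  assumes "a \<le> b"
    and "\<And>x. x \<in> {a..b} \<Longrightarrow> (h has_real_derivative h' x) (at x)"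
    and "continuous_on {a..b} h'"
    and "finite Z" "card Z \<le> n" "\<And>x. x \<in> {a<..<b} \<Longrightarrow> h' x = 0 \<or> (h x)\<^sup>2 = R \<Longrightarrow> x \<in> Z"
  shows "\<exists>v. ((\<lambda>x. if (h x)\<^sup>2 \<le> R then \<bar>h' x\<bar> else 0) has_integral v) {a..b} \<and>
    finite {x \<in> {a..b}. h x \<in> \<int> \<and> (h x)\<^sup>2 \<le> R} \<and>
    \<bar>real (card {x \<in> {a..b}. h x \<in> \<int> \<and> (h x)\<^sup>2 \<le> R}) - v\<bar> \<le> 3 * real n + 2"
  using assms
proof (induction n arbitrary: a b Z rule: less_induct)
  case (less n)
  let ?\<phi> = "\<lambda>x. if (h x)\<^sup>2 \<le> R then \<bar>h' x\<bar> else 0"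
  let ?A = "\<lambda>a b. {x \<in> {a..b}. h x \<in> \<int> \<and> (h x)\<^sup>2 \<le> R}"
  show ?case
  proof (cases "Z \<inter> {a<..<b} = {}")
    case True
    then have "\<exists>v. (?\<phi> has_integral v) {a..b} \<and> finite (?A a b) \<and> \<bar>real (card (?A a b)) - v\<bar> \<le> 2"
      using less.prems by (intro count_integer_values_piece) blast+
    then show ?thesis by (meson order_trans le_add_same_cancel2 of_nat_0_le_iff mult_nonneg_nonneg zero_le_numeral)
  next
    case False
    then obtain z where z: "z \<in> Z" "a < z" "z < b" by auto
    define Z1 where "Z1 = Z \<inter> {a<..<z}"
    define Z2 where "Z2 = Z \<inter> {z<..<b}"
    have fin: "finite Z1" "finite Z2" using less.prems by (auto simp: Z1_def Z2_def)
    have "card Z1 + card Z2 = card (Z1 \<union> Z2)"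
      using fin by (subst card_Un_disjoint) (auto simp: Z1_def Z2_def)
    also have "\<dots> < card Z"
      using less.prems(4) z by (intro psubset_card_mono) (auto simp: Z1_def Z2_def)
    finally have sum: "card Z1 + card Z2 + 1 \<le> n" using less.prems(5) by simp
    have "\<exists>v. (?\<phi> has_integral v) {a..z} \<and> finite (?A a z) \<and> \<bar>real (card (?A a z)) - v\<bar> \<le> 3 * real (card Z1) + 2"
    proof (rule less.IH[of "card Z1" a z Z1])
      show "continuous_on {a..z} h'" using less.prems(3) by (rule continuous_on_subset) (use z in auto)
    qed (use sum z less.prems fin in \<open>auto simp: Z1_def\<close>)
    then obtain v1 where v1: "(?\<phi> has_integral v1) {a..z}" "finite (?A a z)" "\<bar>real (card (?A a z)) - v1\<bar> \<le> 3 * real (card Z1) + 2"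
      by blast
    have "\<exists>v. (?\<phi> has_integral v) {z..b} \<and> finite (?A z b) \<and> \<bar>real (card (?A z b)) - v\<bar> \<le> 3 * real (card Z2) + 2"
    proof (rule less.IH[of "card Z2" z b Z2])
      show "continuous_on {z..b} h'" using less.prems(3) by (rule continuous_on_subset) (use z in auto)
    qed (use sum z less.prems fin in \<open>auto simp: Z2_def\<close>)
    then obtain v2 where v2: "(?\<phi> has_integral v2) {z..b}" "finite (?A z b)" "\<bar>real (card (?A z b)) - v2\<bar> \<le> 3 * real (card Z2) + 2"
      by blast
    have int: "(?\<phi> has_integral (v1 + v2)) {a..b}"
      using v1(1) v2(1) z by (intro has_integral_combine[of a z b]) auto
    have Un: "?A a b = ?A a z \<union> ?A z b" using z by auto
    have "card (?A a z) + card (?A z b) = card (?A a b) + card (?A a z \<inter> ?A z b)"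
      unfolding Un by (rule card_Un_Int[OF v1(2) v2(2)])
    moreover have "card (?A a z \<inter> ?A z b) \<le> card {z}" by (intro card_mono) auto
    ultimately have "\<bar>real (card (?A a b)) - (real (card (?A a z)) + real (card (?A z b)))\<bar> \<le> 1" by simp
    then have "\<bar>real (card (?A a b)) - (v1 + v2)\<bar> \<le> 3 * real (card Z1) + 2 + (3 * real (card Z2) + 2) + 1"
      using v1(3) v2(3) by linarith
    also have "\<dots> = 3 * real (card Z1 + card Z2 + 1) + 2" by simp
    also have "\<dots> \<le> 3 * real n + 2" using sum by (simp only: of_nat_le_iff add_le_cancel_right mult_le_cancel_left_pos zero_less_numeral)
    finally show ?thesis using int v1(2) v2(2) Un by (intro exI[of _ "v1 + v2"]) simp
  qed
qed

section \<open>Zeros of polynomials on the unit circle and of trigonometric polynomials\<close>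

lemma inj_on_cis: "inj_on cis {-pi<..pi}"
  by (rule inj_onI) (metis Arg_cis greaterThanAtMost_iff)

text \<open>The angles -pi and pi give the same point of the circle, so the root -1 may be counted
  twice; hence n + 1.\<close>

lemma card_unit_circle_roots_le:
  fixes p :: "complex poly"
  assumes "p \<noteq> 0" "degree p \<le> n"
  shows "finite {\<theta> \<in> {-pi..pi}. poly p (cis \<theta>) = 0}" "card {\<theta> \<in> {-pi..pi}. poly p (cis \<theta>) = 0} \<le> n + 1"
proof -
  let ?Z = "{\<theta> \<in> {-pi<..pi}. poly p (cis \<theta>) = 0}"
  have sub: "{\<theta> \<in> {-pi..pi}. poly p (cis \<theta>) = 0} \<subseteq> insert (-pi) ?Z" by auto
  have inj: "inj_on cis ?Z" using inj_on_cis by (rule inj_on_subset) auto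
  have img: "cis ` ?Z \<subseteq> {z. poly p z = 0}" by auto
  have fin: "finite ?Z"
    using finite_subset[OF img poly_roots_finite[OF assms(1)]] inj by (rule finite_imageD)
  then show "finite {\<theta> \<in> {-pi..pi}. poly p (cis \<theta>) = 0}" using sub finite_subset by blast
  have "card ?Z = card (cis ` ?Z)" using inj by (simp add: card_image)
  also have "\<dots> \<le> card {z. poly p z = 0}" by (rule card_mono[OF poly_roots_finite[OF assms(1)] img])
  also have "\<dots> \<le> n" using card_poly_roots_bound[OF assms(1)] assms(2) by simp
  finally have "card ?Z \<le> n" .
  moreover have "card {\<theta> \<in> {-pi..pi}. poly p (cis \<theta>) = 0} \<le> card (insert (-pi) ?Z)"
    using fin sub by (intro card_mono) auto
  moreover have "card (insert (-pi) ?Z) \<le> card ?Z + 1" by (simp add: card_insert_le_m1 card_insert_if)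
  ultimately show "card {\<theta> \<in> {-pi..pi}. poly p (cis \<theta>) = 0} \<le> n + 1" by linarith
qed

lemma sum_atMost_double:
  fixes f :: "nat \<Rightarrow> 'a :: comm_monoid_add"
  shows "(\<Sum>k\<le>2 * m. f k) = f m + (\<Sum>k=1..m. f (m + k) + f (m - k))"
proof -
  have "{..2 * m} = insert m ({..<m} \<union> {m<..2 * m})" by auto
  then have "(\<Sum>k\<le>2 * m. f k) = f m + (\<Sum>k\<in>{..<m} \<union> {m<..2 * m}. f k)" by simp
  also have "(\<Sum>k\<in>{..<m} \<union> {m<..2 * m}. f k) = (\<Sum>k<m. f k) + (\<Sum>k\<in>{m<..2 * m}. f k)"
    by (rule sum.union_disjoint) auto
  also have "(\<Sum>k<m. f k) = (\<Sum>k=1..m. f (m - k))"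
    by (rule sum.reindex_bij_witness[of _ "\<lambda>k. m - k" "\<lambda>k. m - k"]) auto
  also have "(\<Sum>k\<in>{m<..2 * m}. f k) = (\<Sum>k=1..m. f (m + k))"
    by (rule sum.reindex_bij_witness[of _ "\<lambda>k. m + k" "\<lambda>k. k - m"]) auto
  finally show ?thesis by (simp add: sum.distrib add.commute)
qed

lemma cis_sum_shift:
  "(\<Sum>k\<le>2 * m. c k * cis \<theta> ^ k) =
     cis \<theta> ^ m * (c m + (\<Sum>k=1..m. c (m + k) * cis (real k * \<theta>) + c (m - k) * cis (- (real k * \<theta>))))"
proof -
  have "cis \<theta> ^ (m - k) = cis \<theta> ^ m * cis (- (real k * \<theta>))" if "k \<in> {1..m}" for k
    using that by (simp add: Complex.DeMoivre cis_mult of_nat_diff left_diff_distrib)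
  moreover have "cis \<theta> ^ (m + k) = cis \<theta> ^ m * cis (real k * \<theta>)" for k
    by (simp add: Complex.DeMoivre cis_mult distrib_right)
  ultimately show ?thesis
    unfolding sum_atMost_double distrib_left sum_distrib_left
    by (intro arg_cong2[of _ _ _ _ "(+)"] sum.cong) (simp_all add: mult_ac)
qed

text \<open>Multiplication by the nonvanishing factor \<open>cis \<theta> ^ m\<close> gives an
  ordinary polynomial of degree at most 2m in \<open>cis \<theta>\<close>.\<close>

lemma card_trigonometric_roots_le:
  assumes "k0 \<le> 2 * m" "c k0 \<noteq> 0"
  defines "Z \<equiv> {\<theta> \<in> {-pi..pi}. c m + (\<Sum>k=1..m. c (m + k) * cis (real k * \<theta>) + c (m - k) * cis (- (real k * \<theta>))) = 0}"
  shows "finite Z \<and> card Z \<le> 2 * m + 1"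
proof -
  define p where "p = (\<Sum>k\<le>2 * m. monom (c k) k)"
  have "coeff p k0 = (\<Sum>k\<le>2 * m. if k = k0 then c k else 0)"
    by (simp add: p_def coeff_sum)
  then have "coeff p k0 = c k0" using assms(1) by simp
  then have p0: "p \<noteq> 0" using assms(2) by auto
  have deg: "degree p \<le> 2 * m" unfolding p_def
    by (rule degree_sum_le) (auto intro: order.trans[OF degree_monom_le])
  have "Z = {\<theta> \<in> {-pi..pi}. poly p (cis \<theta>) = 0}"
    by (simp add: Z_def p_def poly_sum poly_monom cis_sum_shift)
  then show ?thesis using card_unit_circle_roots_le[OF p0 deg] by simp
qed

definition trig_poly :: "nat \<Rightarrow> (nat \<Rightarrow> real) \<Rightarrow> real \<Rightarrow> real" where
  "trig_poly m b \<theta> = b 0 + 2 * (\<Sum>k=1..m. b k * cos (real k * \<theta>))"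

lemma trig_poly_cis:
  "of_real (trig_poly m b \<theta>) =
     (of_real (b 0) + (\<Sum>k=1..m. of_real (b k) * cis (real k * \<theta>) + of_real (b k) * cis (- (real k * \<theta>))) :: complex)"
  by (simp add: trig_poly_def complex_eq_iff sum_distrib_left sum.distrib sum_negf)

lemma card_trig_poly_roots_le:
  assumes "k0 \<le> m" "b k0 \<noteq> 0"
  shows "finite {\<theta> \<in> {-pi..pi}. trig_poly m b \<theta> = 0} \<and> card {\<theta> \<in> {-pi..pi}. trig_poly m b \<theta> = 0} \<le> 2 * m + 1"
proof -
  define c :: "nat \<Rightarrow> complex" where "c = (\<lambda>k. of_real (b (if k \<le> m then m - k else k - m)))"
  have "(c m + (\<Sum>k=1..m. c (m + k) * cis (real k * \<theta>) + c (m - k) * cis (- (real k * \<theta>)))) =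
      of_real (trig_poly m b \<theta>)" for \<theta>
    unfolding trig_poly_cis by (intro arg_cong2[of _ _ _ _ "(+)"] sum.cong) (auto simp: c_def)
  then have "{\<theta> \<in> {-pi..pi}. trig_poly m b \<theta> = 0} =
      {\<theta> \<in> {-pi..pi}. c m + (\<Sum>k=1..m. c (m + k) * cis (real k * \<theta>) + c (m - k) * cis (- (real k * \<theta>))) = 0}"
    by (simp only: of_real_eq_0_iff)
  moreover have "m + k0 \<le> 2 * m" "c (m + k0) \<noteq> 0" using assms by (auto simp: c_def)
  ultimately show ?thesis using card_trigonometric_roots_le[of "m + k0" m c] by simp
qed

text \<open>An antisymmetric coefficient sequence with middle entry 0 produces 2i times the sine
  sum.\<close>

lemma card_sine_poly_roots_le:
  assumes "k0 \<in> {1..m}" "b k0 \<noteq> 0"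
  defines "Z \<equiv> {\<theta> \<in> {-pi..pi}. (\<Sum>k=1..m. b k * sin (real k * \<theta>)) = 0}"
  shows "finite Z \<and> card Z \<le> 2 * m + 1"
proof -
  define c :: "nat \<Rightarrow> complex" where
    "c = (\<lambda>k. if k < m then - of_real (b (m - k)) else if k = m then 0 else of_real (b (k - m)))"
  have "(c m + (\<Sum>k=1..m. c (m + k) * cis (real k * \<theta>) + c (m - k) * cis (- (real k * \<theta>)))) =
      2 * \<i> * of_real (\<Sum>k=1..m. b k * sin (real k * \<theta>))" for \<theta>
    by (auto simp: c_def complex_eq_iff sum_distrib_left intro!: sum.cong)
  then have "Z = {\<theta> \<in> {-pi..pi}. c m + (\<Sum>k=1..m. c (m + k) * cis (real k * \<theta>) + c (m - k) * cis (- (real k * \<theta>))) = 0}"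
    unfolding Z_def by (simp only: mult_eq_0_iff of_real_eq_0_iff) simp
  moreover have "m + k0 \<le> 2 * m" "c (m + k0) \<noteq> 0" using assms by (auto simp: c_def)
  ultimately show ?thesis using card_trigonometric_roots_le[of "m + k0" m c] by simp
qed

section \<open>Integrals over ellipsoids in finite product measures\<close>

text \<open>Fubini isolates coordinate i, where an affine substitution has Jacobian |a|; the
  translation \<open>g\<close> may depend on the other coordinates. With g = 0 this is a scaling,
  with a = 1 a shear, and all linear substitutions below are composed of these two.\<close>

lemma nn_integral_PiM_coordinate_subst:
  fixes f :: "('i \<Rightarrow> real) \<Rightarrow> ennreal"
  assumes I: "finite I" "i \<in> I"
    and f [measurable]: "f \<in> borel_measurable (Pi\<^sub>M I (\<lambda>_. lborel))"
    and g [measurable]: "g \<in> borel_measurable (Pi\<^sub>M I (\<lambda>_. lborel))"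
    and gi: "\<And>c y. g (c(i := y)) = g c" and a: "a \<noteq> 0"
  shows "(\<integral>\<^sup>+ c. f c \<partial>Pi\<^sub>M I (\<lambda>_. lborel)) =
         ennreal \<bar>a\<bar> * (\<integral>\<^sup>+ c. f (c(i := a * c i + g c)) \<partial>Pi\<^sub>M I (\<lambda>_. lborel))"
proof -
  interpret product_sigma_finite "\<lambda>_. lborel :: real measure" by standard
  define J where "J = I - {i}"
  have J: "finite J" "i \<notin> J" and IJ: "I = insert i J" using I by (auto simp: J_def)
  have m1 [measurable]: "(\<lambda>c. c(i := a * c i + g c)) \<in> measurable (Pi\<^sub>M I (\<lambda>_. lborel)) (Pi\<^sub>M I (\<lambda>_. lborel))"
    by (rule measurable_fun_upd[where J = I]) (use I in auto)
  have f2 [measurable]: "(\<lambda>c. f (c(i := a * c i + g c))) \<in> borel_measurable (Pi\<^sub>M I (\<lambda>_. lborel))"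
    by measurable
  have m2: "(\<lambda>y. f (x(i := y))) \<in> borel_measurable borel" if "x \<in> space (Pi\<^sub>M J (\<lambda>_. lborel))" for x
    using measurable_comp[OF measurable_component_update[OF that \<open>i \<notin> J\<close>] f[unfolded IJ]]
    by (simp add: comp_def)
  have "(\<integral>\<^sup>+ c. f c \<partial>Pi\<^sub>M I (\<lambda>_. lborel)) = (\<integral>\<^sup>+ x. (\<integral>\<^sup>+ y. f (x(i := y)) \<partial>lborel) \<partial>Pi\<^sub>M J (\<lambda>_. lborel))"
    unfolding IJ by (rule product_nn_integral_insert[OF J f[unfolded IJ]])
  also have "\<dots> = (\<integral>\<^sup>+ x. ennreal \<bar>a\<bar> * (\<integral>\<^sup>+ y. f (x(i := g x + a * y)) \<partial>lborel) \<partial>Pi\<^sub>M J (\<lambda>_. lborel))"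
    by (intro nn_integral_cong nn_integral_real_affine m2 a)
  also have "\<dots> = (\<integral>\<^sup>+ x. ennreal \<bar>a\<bar> * (\<integral>\<^sup>+ y. f ((x(i := y))(i := a * (x(i := y)) i + g (x(i := y)))) \<partial>lborel) \<partial>Pi\<^sub>M J (\<lambda>_. lborel))"
    by (simp add: gi add.commute)
  also have "\<dots> = ennreal \<bar>a\<bar> * (\<integral>\<^sup>+ x. (\<integral>\<^sup>+ y. f ((x(i := y))(i := a * (x(i := y)) i + g (x(i := y)))) \<partial>lborel) \<partial>Pi\<^sub>M J (\<lambda>_. lborel))"
  proof (rule nn_integral_cmult)
    define F where "F = (\<lambda>c. f (c(i := a * c i + g c)))"
    have [measurable]: "F \<in> borel_measurable (Pi\<^sub>M (insert i J) (\<lambda>_. lborel))"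
      using f2 by (simp add: F_def IJ)
    have "(\<lambda>x. \<integral>\<^sup>+ y. F (x(i := y)) \<partial>lborel) \<in> borel_measurable (Pi\<^sub>M J (\<lambda>_. lborel))"
      by measurable
    then show "(\<lambda>x. \<integral>\<^sup>+ y. f ((x(i := y))(i := a * (x(i := y)) i + g (x(i := y)))) \<partial>lborel) \<in> borel_measurable (Pi\<^sub>M J (\<lambda>_. lborel))"
      by (simp add: F_def)
  qed
  also have "\<dots> = ennreal \<bar>a\<bar> * (\<integral>\<^sup>+ c. f (c(i := a * c i + g c)) \<partial>Pi\<^sub>M I (\<lambda>_. lborel))"
    unfolding IJ by (subst product_nn_integral_insert[OF J f2[unfolded IJ]]) (rule refl)
  finally show ?thesis .
qed

text \<open>The coordinates are scaled one at a time, by induction on the set of those already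
  scaled.\<close>

lemma nn_integral_PiM_diagonal_subst:
  fixes f :: "('i \<Rightarrow> real) \<Rightarrow> ennreal"
  assumes I: "finite I" and f: "f \<in> borel_measurable (Pi\<^sub>M I (\<lambda>_. lborel))"
    and r: "\<And>i. i \<in> I \<Longrightarrow> r i > 0"
  shows "(\<integral>\<^sup>+ c. f c \<partial>Pi\<^sub>M I (\<lambda>_. lborel)) =
         ennreal (\<Prod>i\<in>I. r i) * (\<integral>\<^sup>+ c. f (\<lambda>i\<in>I. r i * c i) \<partial>Pi\<^sub>M I (\<lambda>_. lborel))"
proof -
  have "(\<integral>\<^sup>+ c. f c \<partial>Pi\<^sub>M I (\<lambda>_. lborel)) =
         ennreal (\<Prod>i\<in>J. r i) * (\<integral>\<^sup>+ c. f (\<lambda>i. if i \<in> J then r i * c i else c i) \<partial>Pi\<^sub>M I (\<lambda>_. lborel))"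
    if "finite J" "J \<subseteq> I" for J
    using that
  proof (induction J rule: finite_induct)
    case empty
    show ?case by simp
  next
    case (insert j J)
    let ?g = "\<lambda>c. \<lambda>i. if i \<in> J then r i * c i else c i"
    have "(\<lambda>c. \<lambda>i\<in>I. ?g c i) \<in> measurable (Pi\<^sub>M I (\<lambda>_. lborel)) (Pi\<^sub>M I (\<lambda>_. lborel :: real measure))"
    proof (rule measurable_restrict)
      fix i assume "i \<in> I"
      then show "(\<lambda>c. ?g c i) \<in> measurable (Pi\<^sub>M I (\<lambda>_. lborel)) (lborel :: real measure)"
        by (cases "i \<in> J") auto
    qed
    from measurable_compose[OF this f]
    have "(\<lambda>c. f (\<lambda>i\<in>I. ?g c i)) \<in> borel_measurable (Pi\<^sub>M I (\<lambda>_. lborel))" .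
    \<comment> \<open>Points of the product space are extensional, so restricting to
      \<open>I\<close> changes nothing there; this transfers measurability to the unrestricted
      map.\<close>
    moreover have restr: "(\<lambda>i\<in>I. ?g c i) = ?g c" if "c \<in> space (Pi\<^sub>M I (\<lambda>_. lborel :: real measure))" for c
      using that insert.prems by (auto simp: space_PiM PiE_def extensional_def fun_eq_iff)
    have "(\<lambda>c. f (\<lambda>i\<in>I. ?g c i)) \<in> borel_measurable (Pi\<^sub>M I (\<lambda>_. lborel)) \<longleftrightarrow>
        (\<lambda>c. f (?g c)) \<in> borel_measurable (Pi\<^sub>M I (\<lambda>_. lborel))"
      by (rule measurable_cong) (simp only: restr)
    ultimately have fg: "(\<lambda>c. f (?g c)) \<in> borel_measurable (Pi\<^sub>M I (\<lambda>_. lborel))"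
      by blast
    have j: "j \<in> I" "r j > 0" using insert r by auto
    have "(\<integral>\<^sup>+ c. f c \<partial>Pi\<^sub>M I (\<lambda>_. lborel)) = ennreal (\<Prod>i\<in>J. r i) * (\<integral>\<^sup>+ c. f (?g c) \<partial>Pi\<^sub>M I (\<lambda>_. lborel))"
      using insert by auto
    also have "(\<integral>\<^sup>+ c. f (?g c) \<partial>Pi\<^sub>M I (\<lambda>_. lborel)) = ennreal \<bar>r j\<bar> * (\<integral>\<^sup>+ c. f (?g (c(j := r j * c j + 0))) \<partial>Pi\<^sub>M I (\<lambda>_. lborel))"
      by (rule nn_integral_PiM_coordinate_subst[OF I j(1) fg]) (use j in auto)
    also have "(\<lambda>c. ?g (c(j := r j * c j + 0))) = (\<lambda>c i. if i \<in> insert j J then r i * c i else c i)"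
      using insert.hyps by (auto simp: fun_eq_iff)
    also have "ennreal (\<Prod>i\<in>J. r i) * (ennreal \<bar>r j\<bar> * X) = ennreal (\<Prod>i\<in>insert j J. r i) * X" for X
    proof -
      have "(\<Prod>i\<in>J. r i) \<ge> 0" using r insert.prems by (intro prod_nonneg) (auto intro: less_imp_le)
      then have "ennreal (r j * prod r J) = ennreal (r j) * ennreal (prod r J)"
        using j by (intro ennreal_mult) auto
      then show ?thesis using insert.hyps j by (simp add: mult_ac)
    qed
    finally show ?case .
  qed
  from this[OF I order.refl] have "(\<integral>\<^sup>+ c. f c \<partial>Pi\<^sub>M I (\<lambda>_. lborel)) =
         ennreal (\<Prod>i\<in>I. r i) * (\<integral>\<^sup>+ c. f (\<lambda>i. if i \<in> I then r i * c i else c i) \<partial>Pi\<^sub>M I (\<lambda>_. lborel))" .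
  also have "(\<integral>\<^sup>+ c. f (\<lambda>i. if i \<in> I then r i * c i else c i) \<partial>Pi\<^sub>M I (\<lambda>_. lborel)) =
      (\<integral>\<^sup>+ c. f (\<lambda>i\<in>I. r i * c i) \<partial>Pi\<^sub>M I (\<lambda>_. lborel))"
    by (intro nn_integral_cong arg_cong[of _ _ f]) (auto simp: space_PiM PiE_def extensional_def fun_eq_iff)
  finally show ?thesis .
qed

lemma nn_integral_PiM_rotation:
  fixes f :: "('i \<Rightarrow> real) \<Rightarrow> ennreal"
  assumes I: "finite I" "i \<in> I" "j \<in> I" "i \<noteq> j"
    and f: "f \<in> borel_measurable (Pi\<^sub>M I (\<lambda>_. lborel))"
    and CS: "C\<^sup>2 + S\<^sup>2 = 1" "S \<noteq> 0"
  shows "(\<integral>\<^sup>+ c. f c \<partial>Pi\<^sub>M I (\<lambda>_. lborel)) =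
         (\<integral>\<^sup>+ c. f (c(i := C * c i - S * c j, j := S * c i + C * c j)) \<partial>Pi\<^sub>M I (\<lambda>_. lborel))"
proof -
  \<comment> \<open>A rotation is a product of three shears.\<close>
  define t where "t = (1 - C) / S"
  have t: "t * S = 1 - C" "t * (1 + C) = S"
    using CS by (auto simp: t_def field_simps power2_eq_square)
  define s1 where "s1 = (\<lambda>c :: 'i \<Rightarrow> real. c(i := 1 * c i + (- t * c j)))"
  define s2 where "s2 = (\<lambda>c :: 'i \<Rightarrow> real. c(j := 1 * c j + S * c i))"
  have meas1 [measurable]: "s1 \<in> measurable (Pi\<^sub>M I (\<lambda>_. lborel)) (Pi\<^sub>M I (\<lambda>_. lborel))"
    unfolding s1_def by (rule measurable_fun_upd[where J = I]) (use I in auto)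
  have meas2 [measurable]: "s2 \<in> measurable (Pi\<^sub>M I (\<lambda>_. lborel)) (Pi\<^sub>M I (\<lambda>_. lborel))"
    unfolding s2_def by (rule measurable_fun_upd[where J = I]) (use I in auto)
  have 1: "(\<integral>\<^sup>+ c. h c \<partial>Pi\<^sub>M I (\<lambda>_. lborel)) = (\<integral>\<^sup>+ c. h (s1 c) \<partial>Pi\<^sub>M I (\<lambda>_. lborel))"
    if "h \<in> borel_measurable (Pi\<^sub>M I (\<lambda>_. lborel))" for h
    using nn_integral_PiM_coordinate_subst[OF I(1,2) that, of "\<lambda>c. - t * c j" 1] I by (simp add: s1_def)
  have 2: "(\<integral>\<^sup>+ c. h c \<partial>Pi\<^sub>M I (\<lambda>_. lborel)) = (\<integral>\<^sup>+ c. h (s2 c) \<partial>Pi\<^sub>M I (\<lambda>_. lborel))"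
    if "h \<in> borel_measurable (Pi\<^sub>M I (\<lambda>_. lborel))" for h
    using nn_integral_PiM_coordinate_subst[OF I(1,3) that, of "\<lambda>c. S * c i" 1] I by (simp add: s2_def)
  note f[measurable]
  have "(\<integral>\<^sup>+ c. f c \<partial>Pi\<^sub>M I (\<lambda>_. lborel)) = (\<integral>\<^sup>+ c. f (s1 c) \<partial>Pi\<^sub>M I (\<lambda>_. lborel))"
    by (rule 1) measurable
  also have "\<dots> = (\<integral>\<^sup>+ c. f (s1 (s2 c)) \<partial>Pi\<^sub>M I (\<lambda>_. lborel))"
    by (rule 2) measurable
  also have "\<dots> = (\<integral>\<^sup>+ c. f (s1 (s2 (s1 c))) \<partial>Pi\<^sub>M I (\<lambda>_. lborel))"
    by (rule 1) measurable
  also have "(\<lambda>c. s1 (s2 (s1 c))) = (\<lambda>c. c(i := C * c i - S * c j, j := S * c i + C * c j))"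
  proof
    fix c
    have a: "S * (c i - t * c j) + c j = S * c i + C * c j"
    proof -
      have "S * (c i - t * c j) + c j = S * c i + (1 - t * S) * c j"
        by (simp add: algebra_simps)
      then show ?thesis unfolding t by simp
    qed
    have b: "c i - t * c j - t * (S * c i + C * c j) = C * c i - S * c j"
    proof -
      have "c i - t * c j - t * (S * c i + C * c j) = c i - (t * S) * c i - (t * (1 + C)) * c j"
        by (simp add: algebra_simps)
      then show ?thesis unfolding t by (simp add: algebra_simps)
    qed
    show "s1 (s2 (s1 c)) = c(i := C * c i - S * c j, j := S * c i + C * c j)"
      using I a b by (auto simp: s1_def s2_def fun_eq_iff add.commute)
  qed
  finally show ?thesis .
qed

section \<open>Rotation invariance and the integral of a linear form over an ellipsoid\<close>

lemma sum_remove_two: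
  fixes F :: "'i \<Rightarrow> 'a :: comm_monoid_add"
  assumes "finite I" "i \<in> I" "j \<in> I" "i \<noteq> j"
  shows "sum F I = F i + (F j + sum F (I - {i, j}))"
proof -
  have "sum F I = F i + sum F (I - {i})" using assms by (simp add: sum.remove)
  also have "sum F (I - {i}) = F j + sum F (I - {i} - {j})" using assms by (intro sum.remove) auto
  also have "I - {i} - {j} = I - {i, j}" by auto
  finally show ?thesis .
qed

text \<open>The integrand sees \<open>c\<close> only through its squared length and two linear
  forms. Rotating \<open>c\<close> therefore amounts to rotating \<open>u\<close> and
  \<open>w\<close>, and the integral depends only on the inner products among \<open>u\<close> and
  \<open>w\<close>.\<close>

definition form_integral ::
    "'i set \<Rightarrow> (real \<Rightarrow> real \<Rightarrow> real \<Rightarrow> ennreal) \<Rightarrow> ('i \<Rightarrow> real) \<Rightarrow> ('i \<Rightarrow> real) \<Rightarrow> ennreal" where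
  "form_integral I \<Phi> u w =
     (\<integral>\<^sup>+ c. \<Phi> (\<Sum>k\<in>I. (c k)\<^sup>2) (\<Sum>k\<in>I. u k * c k) (\<Sum>k\<in>I. w k * c k) \<partial>Pi\<^sub>M I (\<lambda>_. lborel))"

text \<open>The rotation of \<open>c\<close> preserves the squared length, and its transpose acts on
  the coefficient vectors of the linear forms.\<close>

lemma form_integral_rotation:
  assumes I: "finite I" "i \<in> I" "j \<in> I" "i \<noteq> j"
    and \<Phi> [measurable]: "(\<lambda>(x, y, z). \<Phi> x y z) \<in> borel_measurable (borel \<Otimes>\<^sub>M borel \<Otimes>\<^sub>M borel)"
    and CS: "C\<^sup>2 + S\<^sup>2 = 1" "S \<noteq> 0"
  shows "form_integral I \<Phi> u w =
    form_integral I \<Phi> (u(i := C * u i + S * u j, j := C * u j - S * u i)) (w(i := C * w i + S * w j, j := C * w j - S * w i))"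
proof -
  define rot where "rot = (\<lambda>c :: 'a \<Rightarrow> real. c(i := C * c i - S * c j, j := S * c i + C * c j))"
  define rot' where "rot' = (\<lambda>u :: 'a \<Rightarrow> real. u(i := C * u i + S * u j, j := C * u j - S * u i))"
  have lin: "(\<Sum>k\<in>I. u k * rot c k) = (\<Sum>k\<in>I. rot' u k * c k)" for u c
  proof -
    have "(\<Sum>k\<in>I-{i,j}. u k * rot c k) = (\<Sum>k\<in>I-{i,j}. rot' u k * c k)"
      by (intro sum.cong) (auto simp: rot_def rot'_def)
    then show ?thesis
      using I by (simp add: sum_remove_two[OF I]) (simp add: rot_def rot'_def algebra_simps)
  qed
  have sq: "(\<Sum>k\<in>I. (rot c k)\<^sup>2) = (\<Sum>k\<in>I. (c k)\<^sup>2)" for c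
  proof -
    have "(\<Sum>k\<in>I-{i,j}. (rot c k)\<^sup>2) = (\<Sum>k\<in>I-{i,j}. (c k)\<^sup>2)"
      by (intro sum.cong) (auto simp: rot_def)
    moreover have "(C * c i - S * c j)\<^sup>2 + (S * c i + C * c j)\<^sup>2 = (C\<^sup>2 + S\<^sup>2) * ((c i)\<^sup>2 + (c j)\<^sup>2)"
      by (simp add: power2_eq_square algebra_simps)
    ultimately show ?thesis
      using I CS by (simp add: sum_remove_two[OF I]) (simp add: rot_def algebra_simps)
  qed
  have "form_integral I \<Phi> u w = (\<integral>\<^sup>+ c. \<Phi> (\<Sum>k\<in>I. (rot c k)\<^sup>2) (\<Sum>k\<in>I. u k * rot c k) (\<Sum>k\<in>I. w k * rot c k) \<partial>Pi\<^sub>M I (\<lambda>_. lborel))"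
    unfolding form_integral_def rot_def
  proof (rule nn_integral_PiM_rotation[OF I _ CS])
    have "(\<lambda>c. (\<Sum>k\<in>I. (c k)\<^sup>2, \<Sum>k\<in>I. u k * c k, \<Sum>k\<in>I. w k * c k))
        \<in> measurable (Pi\<^sub>M I (\<lambda>_. lborel)) (borel \<Otimes>\<^sub>M borel \<Otimes>\<^sub>M borel)"
      by measurable
    from measurable_compose[OF this \<Phi>]
    show "(\<lambda>c. \<Phi> (\<Sum>k\<in>I. (c k)\<^sup>2) (\<Sum>k\<in>I. u k * c k) (\<Sum>k\<in>I. w k * c k)) \<in> borel_measurable (Pi\<^sub>M I (\<lambda>_. lborel))"
      by simp
  qed
  then show ?thesis
    by (simp only: lin sq form_integral_def rot'_def)
qed

text \<open>Plane rotations move \<open>u\<close> onto axis i, one nonzero coordinate at a time. The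
  same rotations act on \<open>w\<close>, so all inner products are kept; these invariants are all
  that is later used of the new vectors.\<close>

lemma form_integral_align:
  assumes I: "finite I" "i \<in> I"
    and \<Phi>: "(\<lambda>(x, y, z). \<Phi> x y z) \<in> borel_measurable (borel \<Otimes>\<^sub>M borel \<Otimes>\<^sub>M borel)"
  shows "\<exists>u' w'. (\<forall>k\<in>I - {i}. u' k = 0) \<and> form_integral I \<Phi> u w = form_integral I \<Phi> u' w' \<and>
     (\<Sum>k\<in>I. (u' k)\<^sup>2) = (\<Sum>k\<in>I. (u k)\<^sup>2) \<and> (\<Sum>k\<in>I. u' k * w' k) = (\<Sum>k\<in>I. u k * w k) \<and>
     (\<Sum>k\<in>I. (w' k)\<^sup>2) = (\<Sum>k\<in>I. (w k)\<^sup>2)"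
proof (induction "card {k \<in> I - {i}. u k \<noteq> 0}" arbitrary: u w)
  case 0
  then have "\<forall>k\<in>I - {i}. u k = 0" using I by auto
  then show ?case by blast
next
  case (Suc n)
  then have "{k \<in> I - {i}. u k \<noteq> 0} \<noteq> {}" by (metis card.empty nat.distinct(1))
  then obtain j where j: "j \<in> I" "j \<noteq> i" "u j \<noteq> 0" by auto
  define r where "r = sqrt ((u i)\<^sup>2 + (u j)\<^sup>2)"
  have r2: "r\<^sup>2 = (u i)\<^sup>2 + (u j)\<^sup>2" by (simp add: r_def)
  have r: "r > 0" using j by (simp add: r_def add_nonneg_pos)
  \<comment> \<open>Cosine and sine of the angle that turns (u i, u j) into (r, 0).\<close>
  define C S where "C = u i / r" and "S = u j / r"
  have CS: "C\<^sup>2 + S\<^sup>2 = 1" "S \<noteq> 0"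
    using r j by (auto simp: C_def S_def power_divide r2 add_divide_distrib[symmetric])
  define rot' where "rot' = (\<lambda>u :: 'a \<Rightarrow> real. u(i := C * u i + S * u j, j := C * u j - S * u i))"
  have gram: "(\<Sum>k\<in>I. rot' v k * rot' v' k) = (\<Sum>k\<in>I. v k * v' k)" for v v'
  proof -
    have "(\<Sum>k\<in>I-{i,j}. rot' v k * rot' v' k) = (\<Sum>k\<in>I-{i,j}. v k * v' k)"
      by (intro sum.cong) (auto simp: rot'_def)
    moreover have "(C * v i + S * v j) * (C * v' i + S * v' j) + (C * v j - S * v i) * (C * v' j - S * v' i)
        = (C\<^sup>2 + S\<^sup>2) * (v i * v' i + v j * v' j)"
      by (simp add: power2_eq_square algebra_simps)
    ultimately show ?thesis
      using I j CS by (simp add: sum_remove_two[OF I(1,2) j(1) j(2)[symmetric]]) (simp add: rot'_def algebra_simps)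
  qed
  have "rot' u j = 0" using j r by (simp add: rot'_def C_def S_def)
  then have "{k \<in> I - {i}. rot' u k \<noteq> 0} = {k \<in> I - {i}. u k \<noteq> 0} - {j}"
    by (auto simp: rot'_def)
  then have "n = card {k \<in> I - {i}. rot' u k \<noteq> 0}" using Suc(2) j I by simp
  from Suc(1)[OF this, of "rot' w"] obtain u' w' where *: "\<forall>k\<in>I - {i}. u' k = 0"
     "form_integral I \<Phi> (rot' u) (rot' w) = form_integral I \<Phi> u' w'"
     "(\<Sum>k\<in>I. (u' k)\<^sup>2) = (\<Sum>k\<in>I. (rot' u k)\<^sup>2)" "(\<Sum>k\<in>I. u' k * w' k) = (\<Sum>k\<in>I. rot' u k * rot' w k)"
     "(\<Sum>k\<in>I. (w' k)\<^sup>2) = (\<Sum>k\<in>I. (rot' w k)\<^sup>2)"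
    by blast
  have "form_integral I \<Phi> u w = form_integral I \<Phi> (rot' u) (rot' w)"
    unfolding rot'_def by (rule form_integral_rotation[OF I j(1) j(2)[symmetric] \<Phi> CS])
  with * show ?case
    by (intro exI[of _ u'] exI[of _ w']) (simp add: gram power2_eq_square)
qed

text \<open>By \<open>Gamma (x + 1) = x * Gamma x\<close>. This two-step recursion is how slices of
  dimension m - 1 lead to the volume of the ball of dimension m + 1 in the main term.\<close>

lemma unit_ball_vol_Suc_Suc: "unit_ball_vol (real (n + 2)) = 2 * pi / real (n + 2) * unit_ball_vol (real n)"
proof -
  have "Gamma (real (n + 2) / 2 + 1) = real (n + 2) / 2 * Gamma (real n / 2 + 1)"
  proof -
    have "real n / 2 + 1 \<notin> \<int>\<^sub>\<le>\<^sub>0" by (auto elim!: nonpos_Ints_cases)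
    from Gamma_plus1[OF this] show ?thesis by (simp add: add_divide_distrib add_ac)
  qed
  moreover have "pi powr (real (n + 2) / 2) = pi * pi powr (real n / 2)"
    by (simp add: add_divide_distrib powr_add)
  ultimately show ?thesis
    by (simp only: unit_ball_vol_def) simp
qed

text \<open>On [0, 1] an antiderivative is -(1 - y^2)^((n+2)/2) / (n + 2). The square root is not
  differentiable at y = 1, so the fundamental theorem is applied with derivatives in the interior
  only. The negative half contributes the same amount.\<close>

lemma nn_integral_abs_sqrt_power:
  "(\<integral>\<^sup>+ y. ennreal (indicator {-1..1} y * \<bar>y\<bar> * sqrt (1 - y\<^sup>2) ^ n) \<partial>lborel) = ennreal (2 / real (n + 2))"
proof -
  define F where "F = (\<lambda>y. - (sqrt (1 - y\<^sup>2) ^ (n + 2)) / real (n + 2))"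
  have "((\<lambda>y. y * sqrt (1 - y\<^sup>2) ^ n) has_integral (F 1 - F 0)) {0..1}"
  proof (rule fundamental_theorem_of_calculus_interior)
    show "continuous_on {0..1} F" unfolding F_def by (intro continuous_intros) auto
    fix y :: real assume y: "y \<in> {0<..<1}"
    then have "y\<^sup>2 < 1" by (simp add: power2_less_1_iff abs_if)
    then have p: "1 - y\<^sup>2 > 0" by simp
    have "((\<lambda>y. sqrt (1 - y\<^sup>2)) has_real_derivative (- y / sqrt (1 - y\<^sup>2))) (at y)"
      using p by (auto intro!: derivative_eq_intros simp: field_simps)
    from DERIV_minus[OF DERIV_cdivide[OF DERIV_power[OF this, of "n + 2"], of "real (n + 2)"]]
    have "(F has_real_derivative - (real (n + 2) * (- y / sqrt (1 - y\<^sup>2) * sqrt (1 - y\<^sup>2) ^ (n + 1)) / real (n + 2))) (at y)"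
      by (simp add: F_def)
    also have "- (real (n + 2) * (- y / sqrt (1 - y\<^sup>2) * sqrt (1 - y\<^sup>2) ^ (n + 1)) / real (n + 2)) = y * sqrt (1 - y\<^sup>2) ^ n"
      using p by simp
    finally show "(F has_vector_derivative y * sqrt (1 - y\<^sup>2) ^ n) (at y)"
      by (simp add: has_real_derivative_iff_has_vector_derivative)
  qed auto
  moreover have "F 1 - F 0 = 1 / real (n + 2)" by (simp add: F_def)
  ultimately have hi: "((\<lambda>y. y * sqrt (1 - y\<^sup>2) ^ n) has_integral (1 / real (n + 2))) {0..1}" by simp
  have sq: "y\<^sup>2 \<le> 1" if "\<bar>y\<bar> \<le> 1" for y :: real
    using that by (simp add: abs_square_le_1)
  have A: "(\<integral>\<^sup>+ y. ennreal (indicator {0..1} y * (y * sqrt (1 - y\<^sup>2) ^ n)) \<partial>lborel) = ennreal (1 / real (n + 2))"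
  proof -
    have hi': "((\<lambda>y. indicator {0..1} y * (y * sqrt (1 - y\<^sup>2) ^ n)) has_integral (1 / real (n + 2))) {0..1}"
      using hi by (rule has_integral_eq[rotated]) auto
    have nonneg: "0 \<le> indicator {0..1} x * (x * sqrt (1 - x\<^sup>2) ^ n)" for x :: real
      using sq by (auto simp: indicator_def intro!: mult_nonneg_nonneg)
    have dbl: "indicat_real {0..1} x * (indicat_real {0..1} x * z) = indicat_real {0..1} x * z" for x z
      by (auto simp: indicator_def)
    show ?thesis
      using nn_integral_has_integral_lebesgue[OF nonneg hi'] unfolding dbl .
  qed
  have B: "(\<integral>\<^sup>+ y. ennreal (indicator {-1..0} y * (- y * sqrt (1 - y\<^sup>2) ^ n)) \<partial>lborel) = ennreal (1 / real (n + 2))"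
  proof -
    have "(\<integral>\<^sup>+ y. ennreal (indicator {-1..0} y * (- y * sqrt (1 - y\<^sup>2) ^ n)) \<partial>lborel) =
        (\<integral>\<^sup>+ y. ennreal (indicator {0..1} y * (y * sqrt (1 - y\<^sup>2) ^ n)) \<partial>lborel)"
      by (subst nn_integral_real_affine[of _ "-1" 0])
         (auto simp: indicator_def intro!: nn_integral_cong)
    from trans[OF this A] show ?thesis .
  qed
  have "(\<integral>\<^sup>+ y. ennreal (indicator {-1..1} y * \<bar>y\<bar> * sqrt (1 - y\<^sup>2) ^ n) \<partial>lborel) =
     (\<integral>\<^sup>+ y. ennreal (indicator {0..1} y * (y * sqrt (1 - y\<^sup>2) ^ n)) + ennreal (indicator {-1..0} y * (- y * sqrt (1 - y\<^sup>2) ^ n)) \<partial>lborel)"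
    by (intro nn_integral_cong) (auto simp: indicator_def)
  also have "\<dots> = ennreal (1 / real (n + 2)) + ennreal (1 / real (n + 2))"
    by (rule trans[OF nn_integral_add arg_cong2[OF A B, of "(+)"]]) auto
  also have "\<dots> = ennreal (2 / real (n + 2))"
    by (subst ennreal_plus[symmetric]) auto
  finally show ?thesis .
qed

text \<open>The slice at c i = y is a ball of radius sqrt (1 - y^2) in one dimension less, on which
  |c i| is constant; what is left is an integral in one variable.\<close>

lemma nn_integral_abs_coordinate_ball:
  assumes "finite I" "i \<in> I"
  shows "(\<integral>\<^sup>+ c. indicator {..1} (\<Sum>k\<in>I. (c k)\<^sup>2) * ennreal \<bar>c i\<bar> \<partial>Pi\<^sub>M I (\<lambda>_. lborel)) =
    ennreal (unit_ball_vol (real (card I + 1)) / pi)"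
proof -
  interpret product_sigma_finite "\<lambda>_. lborel :: real measure" by standard
  define J where "J = I - {i}"
  have J: "finite J" "i \<notin> J" and IJ: "I = insert i J" using assms by (auto simp: J_def)
  have "(\<integral>\<^sup>+ c. indicator {..1} (\<Sum>k\<in>I. (c k)\<^sup>2) * ennreal \<bar>c i\<bar> \<partial>Pi\<^sub>M I (\<lambda>_. lborel)) =
    (\<integral>\<^sup>+ y. \<integral>\<^sup>+ c. indicator {..1} (\<Sum>k\<in>I. ((c(i := y)) k)\<^sup>2) * ennreal \<bar>(c(i := y)) i\<bar> \<partial>Pi\<^sub>M J (\<lambda>_. lborel) \<partial>lborel)"
    unfolding IJ by (rule product_nn_integral_insert_rev[OF J]) measurable
  also have "\<dots> = (\<integral>\<^sup>+ y. ennreal (unit_ball_vol (real (card J))) * ennreal (indicator {-1..1} y * \<bar>y\<bar> * sqrt (1 - y\<^sup>2) ^ card J) \<partial>lborel)"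
  proof (rule nn_integral_cong_AE)
    \<comment> \<open>At y = 1 and y = -1 the slice has radius 0, whereas the volume formula for
      balls requires a positive radius.\<close>
    have "AE y in lborel. y \<notin> {-1, 1::real}"
      by (intro AE_not_in countable_imp_null_set_lborel) auto
    then show "AE y in lborel. (\<integral>\<^sup>+ c. indicator {..1} (\<Sum>k\<in>I. ((c(i := y)) k)\<^sup>2) * ennreal \<bar>(c(i := y)) i\<bar> \<partial>Pi\<^sub>M J (\<lambda>_. lborel))
        = ennreal (unit_ball_vol (real (card J))) * ennreal (indicator {-1..1} y * \<bar>y\<bar> * sqrt (1 - y\<^sup>2) ^ card J)"
    proof eventually_elim
      fix y :: real assume y: "y \<notin> {-1, 1}"
      have sum: "(\<Sum>k\<in>I. ((c(i := y)) k)\<^sup>2) = y\<^sup>2 + (\<Sum>k\<in>J. (c k)\<^sup>2)" for c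
        using J unfolding IJ by (auto intro!: sum.cong)
      show "(\<integral>\<^sup>+ c. indicator {..1} (\<Sum>k\<in>I. ((c(i := y)) k)\<^sup>2) * ennreal \<bar>(c(i := y)) i\<bar> \<partial>Pi\<^sub>M J (\<lambda>_. lborel))
        = ennreal (unit_ball_vol (real (card J))) * ennreal (indicator {-1..1} y * \<bar>y\<bar> * sqrt (1 - y\<^sup>2) ^ card J)"
      proof (cases "\<bar>y\<bar> < 1")
        case False
        then have "\<bar>y\<bar> > 1" using y by auto
        then have "y\<^sup>2 > 1" by (simp add: abs_square_le_1 flip: not_le)
        then have "y\<^sup>2 + (\<Sum>k\<in>J. (c k)\<^sup>2) > 1" for c
          by (rule less_le_trans) (simp add: sum_nonneg)
        then have "\<And>c. indicator {..1} (\<Sum>k\<in>I. ((c(i := y)) k)\<^sup>2) = (0 :: ennreal)"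
          unfolding sum by (simp add: not_le)
        then show ?thesis using \<open>\<bar>y\<bar> > 1\<close> by (auto simp: indicator_def)
      next
        case True
        then have y2: "y\<^sup>2 < 1" by (simp add: abs_square_less_1)
        define r where "r = sqrt (1 - y\<^sup>2)"
        have r: "r > 0" "r\<^sup>2 = 1 - y\<^sup>2" using y2 by (auto simp: r_def)
        have iff: "y\<^sup>2 + s \<le> 1 \<longleftrightarrow> sqrt s \<le> r" if "s \<ge> 0" for s
          using r that by (subst real_sqrt_le_iff') auto
        have "(\<integral>\<^sup>+ c. indicator {..1} (\<Sum>k\<in>I. ((c(i := y)) k)\<^sup>2) * ennreal \<bar>(c(i := y)) i\<bar> \<partial>Pi\<^sub>M J (\<lambda>_. lborel)) =
          (\<integral>\<^sup>+ c. ennreal \<bar>y\<bar> * indicator ({f. sqrt (\<Sum>i\<in>J. (f i)\<^sup>2) \<le> r} \<inter> space (Pi\<^sub>M J (\<lambda>_. lborel))) c \<partial>Pi\<^sub>M J (\<lambda>_. lborel))"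
          unfolding sum by (intro nn_integral_cong) (auto simp: indicator_def iff sum_nonneg)
        also have "\<dots> = ennreal \<bar>y\<bar> * emeasure (Pi\<^sub>M J (\<lambda>_. lborel)) ({f. sqrt (\<Sum>i\<in>J. (f i)\<^sup>2) \<le> r} \<inter> space (Pi\<^sub>M J (\<lambda>_. lborel)))"
          by (rule nn_integral_cmult_indicator) measurable
        also have "\<dots> = ennreal \<bar>y\<bar> * ennreal (unit_ball_vol (real (card J)) * r ^ card J)"
          by (subst emeasure_cball_aux[OF J(1) r(1)]) (rule refl)
        finally show ?thesis
          using True r by (simp add: indicator_def r_def[symmetric] ennreal_mult'[symmetric] mult_ac abs_if split: if_splits)
      qed
    qed
  qed
  also have "\<dots> = ennreal (unit_ball_vol (real (card J))) * (\<integral>\<^sup>+ y. ennreal (indicator {-1..1} y * \<bar>y\<bar> * sqrt (1 - y\<^sup>2) ^ card J) \<partial>lborel)"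
    by (rule nn_integral_cmult) measurable
  also have "\<dots> = ennreal (unit_ball_vol (real (card J)) * (2 / real (card J + 2)))"
    unfolding nn_integral_abs_sqrt_power by (rule ennreal_mult[symmetric]) auto
  also have "unit_ball_vol (real (card J)) * (2 / real (card J + 2)) = unit_ball_vol (real (card I + 1)) / pi"
  proof -
    have "card I + 1 = card J + 2" using J IJ by simp
    then show ?thesis unfolding \<open>card I + 1 = card J + 2\<close> unit_ball_vol_Suc_Suc by simp
  qed
  finally show ?thesis .
qed

text \<open>After aligning \<open>u\<close> with axis i the quadratic form is diagonal, and
  shrinking coordinate i by sqrt (1 + U) turns the ellipsoid into the unit ball. A second alignment,
  now of the transformed \<open>w\<close>, reduces the linear form to its length times one
  coordinate.\<close>

lemma nn_integral_abs_form_ellipsoid: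
  fixes u w :: "'i \<Rightarrow> real"
  assumes I: "finite I" "I \<noteq> {}"
  defines "U \<equiv> \<Sum>k\<in>I. (u k)\<^sup>2" and "V \<equiv> \<Sum>k\<in>I. u k * w k" and "W \<equiv> \<Sum>k\<in>I. (w k)\<^sup>2"
  shows "(\<integral>\<^sup>+ c. indicator {..1} ((\<Sum>k\<in>I. (c k)\<^sup>2) + (\<Sum>k\<in>I. u k * c k)\<^sup>2) * ennreal \<bar>\<Sum>k\<in>I. w k * c k\<bar>
      \<partial>Pi\<^sub>M I (\<lambda>_. lborel)) =
    ennreal (unit_ball_vol (real (card I + 1)) / pi * (sqrt (W * (1 + U) - V\<^sup>2) / (1 + U)))"
proof -
  obtain i where i: "i \<in> I" using I by auto
  define \<Phi> :: "real \<Rightarrow> real \<Rightarrow> real \<Rightarrow> ennreal" where "\<Phi> = (\<lambda>x y z. indicator {..1} (x + y\<^sup>2) * ennreal \<bar>z\<bar>)"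
  have \<Phi>: "(\<lambda>(x, y, z). \<Phi> x y z) \<in> borel_measurable (borel \<Otimes>\<^sub>M borel \<Otimes>\<^sub>M borel)"
    unfolding \<Phi>_def by measurable
  obtain u1 w1 where 1: "\<forall>k\<in>I - {i}. u1 k = 0" "form_integral I \<Phi> u w = form_integral I \<Phi> u1 w1"
     "(\<Sum>k\<in>I. (u1 k)\<^sup>2) = U" "(\<Sum>k\<in>I. u1 k * w1 k) = V" "(\<Sum>k\<in>I. (w1 k)\<^sup>2) = W"
    using form_integral_align[OF I(1) i \<Phi>, of u w] unfolding U_def V_def W_def by metis
  have dec: "sum F I = F i + sum F (I - {i})" for F :: "'i \<Rightarrow> real"
    using I i by (simp add: sum.remove)
  have only_i: "(\<Sum>k\<in>I. v k * c k) = v i * c i" if "\<forall>k\<in>I - {i}. v k = 0" for v c :: "'i \<Rightarrow> real"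
    using that by (simp add: dec)
  have only_i2: "(\<Sum>k\<in>I. (v k)\<^sup>2) = (v i)\<^sup>2" if "\<forall>k\<in>I - {i}. v k = 0" for v :: "'i \<Rightarrow> real"
    using that by (simp add: dec)
  have U: "U = (u1 i)\<^sup>2" and V: "V = u1 i * w1 i"
    using 1 only_i only_i2 by metis+
  define s where "s = sqrt (1 + U)"
  have "U \<ge> 0" unfolding U_def by (simp add: sum_nonneg)
  then have s: "s > 0" "s\<^sup>2 = 1 + U" by (auto simp: s_def add_pos_nonneg)
  define w2 where "w2 = w1(i := w1 i / s)"
  have "form_integral I \<Phi> u1 w1 = ennreal \<bar>1 / s\<bar> *
     (\<integral>\<^sup>+ c. \<Phi> (\<Sum>k\<in>I. ((c(i := 1 / s * c i + 0)) k)\<^sup>2) (\<Sum>k\<in>I. u1 k * (c(i := 1 / s * c i + 0)) k)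
         (\<Sum>k\<in>I. w1 k * (c(i := 1 / s * c i + 0)) k) \<partial>Pi\<^sub>M I (\<lambda>_. lborel))"
    unfolding form_integral_def
    by (rule nn_integral_PiM_coordinate_subst[OF I(1) i]) (use s \<Phi> in \<open>auto simp: \<Phi>_def\<close>)
  also have "(\<lambda>c. \<Phi> (\<Sum>k\<in>I. ((c(i := 1 / s * c i + 0)) k)\<^sup>2) (\<Sum>k\<in>I. u1 k * (c(i := 1 / s * c i + 0)) k)
         (\<Sum>k\<in>I. w1 k * (c(i := 1 / s * c i + 0)) k)) =
      (\<lambda>c. \<Phi> (\<Sum>k\<in>I. (c k)\<^sup>2) (\<Sum>k\<in>I. 0 * c k) (\<Sum>k\<in>I. w2 k * c k))"
  proof
    fix c :: "'i \<Rightarrow> real"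
    have "(\<Sum>k\<in>I. w1 k * (c(i := 1 / s * c i + 0)) k) = (\<Sum>k\<in>I. w2 k * c k)"
      by (intro sum.cong) (auto simp: w2_def)
    moreover have "(\<Sum>k\<in>I. ((c(i := 1 / s * c i + 0)) k)\<^sup>2) + (\<Sum>k\<in>I. u1 k * (c(i := 1 / s * c i + 0)) k)\<^sup>2 = (\<Sum>k\<in>I. (c k)\<^sup>2)"
    proof -
      have "(\<Sum>k\<in>I - {i}. ((c(i := 1 / s * c i + 0)) k)\<^sup>2) = (\<Sum>k\<in>I - {i}. (c k)\<^sup>2)"
        by (intro sum.cong) auto
      moreover have "(c i / s)\<^sup>2 + (u1 i * (c i / s))\<^sup>2 = (c i)\<^sup>2 / s\<^sup>2 * (1 + U)"
        by (simp add: U power_divide power_mult_distrib ring_distribs add_divide_distrib)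
      moreover have "1 + U \<noteq> 0" using \<open>U \<ge> 0\<close> by linarith
      ultimately show ?thesis using s by (simp add: only_i[OF 1(1)] dec)
    qed
    ultimately show "\<Phi> (\<Sum>k\<in>I. ((c(i := 1 / s * c i + 0)) k)\<^sup>2) (\<Sum>k\<in>I. u1 k * (c(i := 1 / s * c i + 0)) k)
         (\<Sum>k\<in>I. w1 k * (c(i := 1 / s * c i + 0)) k) = \<Phi> (\<Sum>k\<in>I. (c k)\<^sup>2) (\<Sum>k\<in>I. 0 * c k) (\<Sum>k\<in>I. w2 k * c k)"
      by (simp add: \<Phi>_def)
  qed
  also have "(\<integral>\<^sup>+ c. \<Phi> (\<Sum>k\<in>I. (c k)\<^sup>2) (\<Sum>k\<in>I. 0 * c k) (\<Sum>k\<in>I. w2 k * c k) \<partial>Pi\<^sub>M I (\<lambda>_. lborel)) =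
     form_integral I (\<lambda>x y z. indicator {..1} x * ennreal \<bar>y\<bar>) w2 (\<lambda>_. 0)"
    by (simp add: form_integral_def \<Phi>_def)
  \<comment> \<open>On the ball the form given by \<open>w2\<close> may be rotated freely; aligned
    with axis i it is |w2| times the i-th coordinate.\<close>
  also have "\<dots> = ennreal (sqrt (\<Sum>k\<in>I. (w2 k)\<^sup>2)) * ennreal (unit_ball_vol (real (card I + 1)) / pi)"
  proof -
    have "(\<lambda>(x :: real, y :: real, z). indicator {..1} x * ennreal \<bar>y\<bar>) \<in> borel_measurable (borel \<Otimes>\<^sub>M borel \<Otimes>\<^sub>M (borel :: real measure))"
      by measurable
    from form_integral_align[OF I(1) i this, of w2 "\<lambda>_. 0"]
    obtain u3 w3 where 3: "\<forall>k\<in>I - {i}. u3 k = 0"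
      "form_integral I (\<lambda>x y z. indicator {..1} x * ennreal \<bar>y\<bar>) w2 (\<lambda>_. 0) = form_integral I (\<lambda>x y z. indicator {..1} x * ennreal \<bar>y\<bar>) u3 w3"
      "(\<Sum>k\<in>I. (u3 k)\<^sup>2) = (\<Sum>k\<in>I. (w2 k)\<^sup>2)"
      by blast
    have "(\<Sum>k\<in>I. (w2 k)\<^sup>2) = (u3 i)\<^sup>2" using 3 only_i2 by metis
    then have u3: "sqrt (\<Sum>k\<in>I. (w2 k)\<^sup>2) = \<bar>u3 i\<bar>" by simp
    have "form_integral I (\<lambda>x y z. indicator {..1} x * ennreal \<bar>y\<bar>) u3 w3 =
       (\<integral>\<^sup>+ c. ennreal \<bar>u3 i\<bar> * (indicator {..1} (\<Sum>k\<in>I. (c k)\<^sup>2) * ennreal \<bar>c i\<bar>) \<partial>Pi\<^sub>M I (\<lambda>_. lborel))"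
      unfolding form_integral_def only_i[OF 3(1)] by (simp add: abs_mult ennreal_mult mult_ac)
    also have "\<dots> = ennreal \<bar>u3 i\<bar> * ennreal (unit_ball_vol (real (card I + 1)) / pi)"
      unfolding nn_integral_abs_coordinate_ball[OF I(1) i, symmetric]
      using i by (intro nn_integral_cmult) measurable
    finally show ?thesis unfolding u3 3(2) .
  qed
  also have "ennreal \<bar>1 / s\<bar> * (ennreal (sqrt (\<Sum>k\<in>I. (w2 k)\<^sup>2)) * ennreal (unit_ball_vol (real (card I + 1)) / pi)) =
    ennreal (unit_ball_vol (real (card I + 1)) / pi * (sqrt (\<Sum>k\<in>I. (w2 k)\<^sup>2) / s))"
    using s by (simp add: ennreal_mult'[symmetric] sum_nonneg mult_ac)
  \<comment> \<open>Only coordinate i of \<open>w1\<close> was rescaled, so |w2|^2 (1 + U) = W (1 +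
    U) - V^2, because V = u1 i * w1 i and U = (u1 i)^2 after the alignment.\<close>
  also have "sqrt (\<Sum>k\<in>I. (w2 k)\<^sup>2) / s = sqrt (W * (1 + U) - V\<^sup>2) / (1 + U)"
  proof -
    have "(\<Sum>k\<in>I - {i}. (w2 k)\<^sup>2) = (\<Sum>k\<in>I - {i}. (w1 k)\<^sup>2)"
      by (intro sum.cong) (auto simp: w2_def)
    moreover have "(\<Sum>k\<in>I - {i}. (w1 k)\<^sup>2) = W - (w1 i)\<^sup>2"
      using 1(5) by (simp add: dec)
    ultimately have "(\<Sum>k\<in>I. (w2 k)\<^sup>2) = (w1 i)\<^sup>2 / s\<^sup>2 + W - (w1 i)\<^sup>2"
      by (simp add: dec w2_def power_divide)
    then have "(\<Sum>k\<in>I. (w2 k)\<^sup>2) * s\<^sup>2 = (w1 i)\<^sup>2 / s\<^sup>2 * s\<^sup>2 + (W - (w1 i)\<^sup>2) * s\<^sup>2"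
      by (simp only: ring_distribs add_diff_eq)
    also have "(w1 i)\<^sup>2 / s\<^sup>2 * s\<^sup>2 = (w1 i)\<^sup>2" using s(1) by simp
    also have "(w1 i)\<^sup>2 + (W - (w1 i)\<^sup>2) * s\<^sup>2 = W * (1 + U) - V\<^sup>2"
      unfolding s V power_mult_distrib U by (simp add: algebra_simps)
    finally have eq: "(\<Sum>k\<in>I. (w2 k)\<^sup>2) * s\<^sup>2 = W * (1 + U) - V\<^sup>2" .
    then have "sqrt (W * (1 + U) - V\<^sup>2) = sqrt (\<Sum>k\<in>I. (w2 k)\<^sup>2) * s"
      using s(1) by (simp flip: eq add: real_sqrt_mult)
    then show ?thesis using s by (simp flip: s(2) add: power2_eq_square)
  qed
  finally show ?thesis using 1(2) unfolding form_integral_def \<Phi>_def by simp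
qed

section \<open>Lattice sums over ellipsoids\<close>

text \<open>The lattice corner of the unit cube containing \<open>c\<close>; the restriction makes
  it an element of the extensional product.\<close>

definition floor_vec :: "'i set \<Rightarrow> ('i \<Rightarrow> real) \<Rightarrow> 'i \<Rightarrow> real" where
  "floor_vec I c = (\<lambda>i\<in>I. of_int \<lfloor>c i\<rfloor>)"

text \<open>The half-open unit cube with corner b has measure 1, and \<open>floor_vec\<close> is
  constantly b on it. A lattice sum is thus the integral of a step function, which can be compared
  with a continuous integrand pointwise.\<close>

lemma sum_lattice_eq_nn_integral:
  fixes g :: "('i \<Rightarrow> real) \<Rightarrow> ennreal"
  assumes I: "finite I" and S: "finite S" "S \<subseteq> (\<Pi>\<^sub>E i\<in>I. \<int>)"
    and g: "\<And>b. b \<in> (\<Pi>\<^sub>E i\<in>I. \<int>) \<Longrightarrow> b \<notin> S \<Longrightarrow> g b = 0"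
  shows "(\<Sum>b\<in>S. g b) = (\<integral>\<^sup>+ c. g (floor_vec I c) \<partial>Pi\<^sub>M I (\<lambda>_. lborel))"
proof -
  interpret product_sigma_finite "\<lambda>_. lborel :: real measure" by standard
  let ?C = "\<lambda>b. \<Pi>\<^sub>E i\<in>I. {b i..<b i + (1::real)}"
  have mem: "c \<in> ?C b \<longleftrightarrow> floor_vec I c = b" if "b \<in> S" "c \<in> space (Pi\<^sub>M I (\<lambda>_. lborel))" for b c
  proof -
    have b: "b \<in> (\<Pi>\<^sub>E i\<in>I. \<int>)" and c: "c \<in> extensional I"
      using that S by (auto simp: space_PiM PiE_def)
    have "c i \<in> {b i..<b i + 1} \<longleftrightarrow> of_int \<lfloor>c i\<rfloor> = b i" if "i \<in> I" for i
    proof -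
      have "b i \<in> \<int>" using b that by auto
      then obtain z where z: "b i = of_int z" by (auto elim: Ints_cases)
      show ?thesis unfolding z by (auto simp: floor_eq_iff intro!: floor_unique)
    qed
    then have "c \<in> ?C b \<longleftrightarrow> (\<forall>i\<in>I. of_int \<lfloor>c i\<rfloor> = b i)"
      using c by (auto simp: PiE_def Pi_def)
    also have "\<dots> \<longleftrightarrow> floor_vec I c = b"
      using b by (auto simp: floor_vec_def fun_eq_iff PiE_def extensional_def restrict_def)
    finally show ?thesis .
  qed
  have "(\<integral>\<^sup>+ c. g (floor_vec I c) \<partial>Pi\<^sub>M I (\<lambda>_. lborel)) =
    (\<integral>\<^sup>+ c. (\<Sum>b\<in>S. g b * indicator (?C b) c) \<partial>Pi\<^sub>M I (\<lambda>_. lborel))"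
  proof (rule nn_integral_cong)
    fix c assume c: "c \<in> space (Pi\<^sub>M I (\<lambda>_. lborel :: real measure))"
    have "(\<Sum>b\<in>S. g b * indicator (?C b) c) = (\<Sum>b\<in>S. if b = floor_vec I c then g b else 0)"
      using mem[OF _ c] by (intro sum.cong) (auto simp: indicator_def)
    also have "\<dots> = (if floor_vec I c \<in> S then g (floor_vec I c) else 0)"
      using S by simp
    also have "\<dots> = g (floor_vec I c)"
      using g[of "floor_vec I c"] by (auto simp: floor_vec_def)
    finally show "g (floor_vec I c) = (\<Sum>b\<in>S. g b * indicator (?C b) c)" by simp
  qed
  also have "\<dots> = (\<Sum>b\<in>S. g b * emeasure (Pi\<^sub>M I (\<lambda>_. lborel)) (?C b))"
    using I by (subst nn_integral_sum) (auto intro!: sum.cong nn_integral_cmult_indicator sets_PiM_I_finite)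
  also have "\<dots> = (\<Sum>b\<in>S. g b)"
    using I by (subst emeasure_PiM) auto
  finally show ?thesis ..
qed

text \<open>\<open>r\<close> is the vector of semi-axes. The second square stands for the eliminated
  middle coefficient, which at a root is a linear form in the remaining ones.\<close>

definition ellipsoid_norm :: "'i set \<Rightarrow> ('i \<Rightarrow> real) \<Rightarrow> ('i \<Rightarrow> real) \<Rightarrow> ('i \<Rightarrow> real) \<Rightarrow> real" where
  "ellipsoid_norm I r u c = sqrt ((\<Sum>k\<in>I. (c k / r k)\<^sup>2) + (\<Sum>k\<in>I. u k * (c k / r k))\<^sup>2)"

definition linear_form :: "'i set \<Rightarrow> ('i \<Rightarrow> real) \<Rightarrow> ('i \<Rightarrow> real) \<Rightarrow> ('i \<Rightarrow> real) \<Rightarrow> real" where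
  "linear_form I r w c = (\<Sum>k\<in>I. w k * (c k / r k))"

lemma linear_form_add: "linear_form I r w (\<lambda>k. c k + d k) = linear_form I r w c + linear_form I r w d"
  by (simp add: linear_form_def add_divide_distrib distrib_left sum.distrib)

text \<open>It is the planar Euclidean norm of the pair formed by a weighted Euclidean norm and a
  linear form, so the triangle inequality is applied twice.\<close>

lemma ellipsoid_norm_triangle:
  "ellipsoid_norm I r u (\<lambda>k. c k + d k) \<le> ellipsoid_norm I r u c + ellipsoid_norm I r u d"
proof -
  let ?L = "\<lambda>c. L2_set (\<lambda>k. c k / r k) I"
  have eq: "ellipsoid_norm I r u c = sqrt ((?L c)\<^sup>2 + (linear_form I r u c)\<^sup>2)" for c
    by (simp add: ellipsoid_norm_def linear_form_def L2_set_def sum_nonneg)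
  have "?L (\<lambda>k. c k + d k) \<le> ?L c + ?L d"
    unfolding add_divide_distrib by (rule L2_set_triangle_ineq)
  then have "(?L (\<lambda>k. c k + d k))\<^sup>2 \<le> (?L c + ?L d)\<^sup>2" by (intro power_mono) (auto simp: L2_set_nonneg)
  then have "sqrt ((?L (\<lambda>k. c k + d k))\<^sup>2 + (linear_form I r u (\<lambda>k. c k + d k))\<^sup>2) \<le>
     sqrt ((?L c + ?L d)\<^sup>2 + (linear_form I r u c + linear_form I r u d)\<^sup>2)"
    unfolding linear_form_add by (intro real_sqrt_le_mono) auto
  also have "\<dots> \<le> sqrt ((?L c)\<^sup>2 + (linear_form I r u c)\<^sup>2) + sqrt ((?L d)\<^sup>2 + (linear_form I r u d)\<^sup>2)"
    by (rule real_sqrt_sum_squares_triangle_ineq)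
  finally show ?thesis unfolding eq .
qed

lemma linear_form_cong: "(\<And>k. k \<in> I \<Longrightarrow> c k = d k) \<Longrightarrow> linear_form I r w c = linear_form I r w d"
  by (simp add: linear_form_def)

lemma ellipsoid_norm_cong: "(\<And>k. k \<in> I \<Longrightarrow> c k = d k) \<Longrightarrow> ellipsoid_norm I r w c = ellipsoid_norm I r w d"
  by (simp add: ellipsoid_norm_def)

lemma linear_form_scale: "linear_form I r w (\<lambda>k. s * c k) = s * linear_form I r w c"
  by (simp add: linear_form_def sum_distrib_left mult_ac)

lemma ellipsoid_norm_scale: "ellipsoid_norm I r u (\<lambda>k. s * c k) = \<bar>s\<bar> * ellipsoid_norm I r u c"
proof -
  have 1: "(\<Sum>k\<in>I. (s * c k / r k)\<^sup>2) = s\<^sup>2 * (\<Sum>k\<in>I. (c k / r k)\<^sup>2)"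
    by (simp add: power_mult_distrib sum_distrib_left power_divide)
  have 2: "(\<Sum>k\<in>I. u k * (s * c k / r k)) = s * (\<Sum>k\<in>I. u k * (c k / r k))"
    by (simp add: sum_distrib_left mult_ac)
  show ?thesis
    unfolding ellipsoid_norm_def 1 2 by (simp add: power_mult_distrib real_sqrt_mult flip: distrib_left)
qed

lemma linear_form_measurable [measurable]:
  "linear_form I r w \<in> borel_measurable (Pi\<^sub>M I (\<lambda>_. lborel))"
  unfolding linear_form_def by measurable

lemma ellipsoid_norm_measurable [measurable]:
  "ellipsoid_norm I r w \<in> borel_measurable (Pi\<^sub>M I (\<lambda>_. lborel))"
  unfolding ellipsoid_norm_def by measurable

lemma linear_form_le:
  assumes "finite I" "\<And>k. k \<in> I \<Longrightarrow> r k > 0" "\<And>k. k \<in> I \<Longrightarrow> \<bar>w k\<bar> \<le> M" "\<And>k. k \<in> I \<Longrightarrow> \<bar>c k\<bar> \<le> B k"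
  shows "\<bar>linear_form I r w c\<bar> \<le> M * (\<Sum>k\<in>I. B k / r k)"
proof -
  have "\<bar>linear_form I r w c\<bar> \<le> (\<Sum>k\<in>I. \<bar>w k * (c k / r k)\<bar>)"
    unfolding linear_form_def by (rule sum_abs)
  also have "\<dots> \<le> (\<Sum>k\<in>I. M * (B k / r k))"
  proof (rule sum_mono)
    fix k assume k: "k \<in> I"
    have "\<bar>w k\<bar> * (\<bar>c k\<bar> / r k) \<le> M * (B k / r k)"
      using assms(2-4)[OF k] by (intro mult_mono divide_right_mono) auto
    then show "\<bar>w k * (c k / r k)\<bar> \<le> M * (B k / r k)" using assms(2)[OF k] by (simp add: abs_mult)
  qed
  finally show ?thesis by (simp add: sum_distrib_left)
qed

text \<open>Intended for the displacement of a point from its lattice corner. A crude bound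
  suffices, provided it depends on \<open>u\<close> only through \<open>M\<close>.\<close>

lemma ellipsoid_norm_le:
  assumes "finite I" "\<And>k. k \<in> I \<Longrightarrow> r k > 0" "\<And>k. k \<in> I \<Longrightarrow> \<bar>u k\<bar> \<le> M" "\<And>k. k \<in> I \<Longrightarrow> \<bar>c k\<bar> \<le> 1"
  shows "ellipsoid_norm I r u c \<le> (1 + M) * (\<Sum>k\<in>I. 1 / r k)"
proof -
  let ?L = "L2_set (\<lambda>k. c k / r k) I"
  have "ellipsoid_norm I r u c = sqrt (?L\<^sup>2 + (linear_form I r u c)\<^sup>2)"
    by (simp add: ellipsoid_norm_def linear_form_def L2_set_def sum_nonneg)
  also have "\<dots> \<le> \<bar>?L\<bar> + \<bar>linear_form I r u c\<bar>" by (rule sqrt_sum_squares_le_sum_abs)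
  also have "\<bar>?L\<bar> \<le> (\<Sum>k\<in>I. \<bar>c k / r k\<bar>)"
    by (subst abs_of_nonneg) (rule L2_set_nonneg L2_set_le_sum_abs)+
  also have "\<dots> \<le> (\<Sum>k\<in>I. 1 / r k)"
    using assms by (intro sum_mono) (auto simp: divide_right_mono less_imp_le)
  also have "\<bar>linear_form I r u c\<bar> \<le> M * (\<Sum>k\<in>I. 1 / r k)"
    by (rule linear_form_le) (use assms in auto)
  finally show ?thesis by (simp add: distrib_right)
qed

lemma ellipsoid_norm_coordinate_le:
  assumes "finite I" "k \<in> I" "r k > 0"
  shows "\<bar>c k\<bar> \<le> r k * ellipsoid_norm I r u c"
proof -
  have "(c k / r k)\<^sup>2 \<le> (\<Sum>k\<in>I. (c k / r k)\<^sup>2)"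
    using assms by (intro member_le_sum) auto
  also have "\<dots> \<le> (ellipsoid_norm I r u c)\<^sup>2"
    by (simp add: ellipsoid_norm_def sum_nonneg)
  finally have "\<bar>c k / r k\<bar> \<le> \<bar>ellipsoid_norm I r u c\<bar>" by (simp only: abs_le_square_iff)
  moreover have "ellipsoid_norm I r u c \<ge> 0" by (simp add: ellipsoid_norm_def sum_nonneg)
  ultimately show ?thesis using assms by (simp add: field_simps)
qed

lemma power_diff_le:
  fixes x y :: real
  assumes "0 \<le> y" "y \<le> x"
  shows "x ^ Suc n - y ^ Suc n \<le> real (Suc n) * x ^ n * (x - y)"
proof -
  have "x ^ Suc n - y ^ Suc n = (x - y) * (\<Sum>p<Suc n. x ^ p * y ^ (n - p))"
    by (rule diff_power_eq_sum)
  also have "\<dots> \<le> (x - y) * (\<Sum>p<Suc n. x ^ n)"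
  proof (intro mult_left_mono sum_mono)
    fix p assume "p \<in> {..<Suc n}"
    then have "x ^ n = x ^ p * x ^ (n - p)" by (simp flip: power_add)
    then show "x ^ p * y ^ (n - p) \<le> x ^ n"
      using assms by (simp add: mult_left_mono power_mono)
  qed (use assms in auto)
  finally show ?thesis by (simp add: mult_ac)
qed

text \<open>The value of the integral of |linear form| over the unit ball of
  \<open>ellipsoid_norm\<close>, with \<open>u\<close> in the norm and \<open>w\<close> in the form;
  see the lemma of the same name.\<close>

definition ellipsoid_abs_moment :: "'i set \<Rightarrow> ('i \<Rightarrow> real) \<Rightarrow> ('i \<Rightarrow> real) \<Rightarrow> ('i \<Rightarrow> real) \<Rightarrow> real" where
  "ellipsoid_abs_moment I r u w = (\<Prod>k\<in>I. r k) * (unit_ball_vol (real (card I + 1)) / pi *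
     (sqrt ((\<Sum>k\<in>I. (w k)\<^sup>2) * (1 + (\<Sum>k\<in>I. (u k)\<^sup>2)) - (\<Sum>k\<in>I. u k * w k)\<^sup>2) / (1 + (\<Sum>k\<in>I. (u k)\<^sup>2))))"

section \<open>Dilation and size of ellipsoid integrals\<close>

context
  fixes I :: "'i set" and r :: "'i \<Rightarrow> real"
  assumes I: "finite I" and r: "\<And>k. k \<in> I \<Longrightarrow> r k > 0"
begin

lemma nn_integral_dilate:
  assumes s: "s > 0" and f: "f \<in> borel_measurable (Pi\<^sub>M I (\<lambda>_. lborel))"
  shows "(\<integral>\<^sup>+ c. f c \<partial>Pi\<^sub>M I (\<lambda>_. lborel)) =
    ennreal (s ^ card I) * (\<integral>\<^sup>+ c. f (\<lambda>i\<in>I. s * c i) \<partial>Pi\<^sub>M I (\<lambda>_. lborel))"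
  using nn_integral_PiM_diagonal_subst[OF I f, of "\<lambda>_. s"] s by simp

lemma indicator_ellipsoid_norm_dilate:
  assumes "s > 0"
  shows "indicator {..s} (ellipsoid_norm I r u (\<lambda>i\<in>I. s * c i)) = (indicator {..1} (ellipsoid_norm I r u c) :: ennreal)"
proof -
  have "ellipsoid_norm I r u (\<lambda>i\<in>I. s * c i) = s * ellipsoid_norm I r u c"
    using assms by (subst ellipsoid_norm_cong[where d = "\<lambda>i. s * c i"]) (auto simp: ellipsoid_norm_scale)
  then show ?thesis using assms by (auto simp: indicator_def)
qed

lemma ellipsoid_abs_integral_dilate:
  assumes s: "s > 0"
  shows "(\<integral>\<^sup>+ c. indicator {..s} (ellipsoid_norm I r u c) * ennreal \<bar>linear_form I r w c\<bar> \<partial>Pi\<^sub>M I (\<lambda>_. lborel)) =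
    ennreal (s ^ (card I + 1)) *
      (\<integral>\<^sup>+ c. indicator {..1} (ellipsoid_norm I r u c) * ennreal \<bar>linear_form I r w c\<bar> \<partial>Pi\<^sub>M I (\<lambda>_. lborel))"
proof -
  have lin: "linear_form I r w (\<lambda>i\<in>I. s * c i) = s * linear_form I r w c" for c
    by (subst linear_form_cong[where d = "\<lambda>i. s * c i"]) (auto simp: linear_form_scale)
  have "(\<integral>\<^sup>+ c. indicator {..s} (ellipsoid_norm I r u c) * ennreal \<bar>linear_form I r w c\<bar> \<partial>Pi\<^sub>M I (\<lambda>_. lborel)) =
    ennreal (s ^ card I) *
      (\<integral>\<^sup>+ c. ennreal s * (indicator {..1} (ellipsoid_norm I r u c) * ennreal \<bar>linear_form I r w c\<bar>) \<partial>Pi\<^sub>M I (\<lambda>_. lborel))"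
    using s by (subst nn_integral_dilate[OF s]) (auto simp: indicator_ellipsoid_norm_dilate lin abs_mult ennreal_mult mult_ac)
  also have "(\<integral>\<^sup>+ c. ennreal s * (indicator {..1} (ellipsoid_norm I r u c) * ennreal \<bar>linear_form I r w c\<bar>) \<partial>Pi\<^sub>M I (\<lambda>_. lborel)) =
     ennreal s * (\<integral>\<^sup>+ c. (indicator {..1} (ellipsoid_norm I r u c) * ennreal \<bar>linear_form I r w c\<bar>) \<partial>Pi\<^sub>M I (\<lambda>_. lborel))"
    by (rule nn_integral_cmult) measurable
  finally show ?thesis using s by (simp add: ennreal_mult mult_ac)
qed

lemma ellipsoid_volume_dilate:
  assumes s: "s > 0"
  shows "(\<integral>\<^sup>+ c. indicator {..s} (ellipsoid_norm I r u c) \<partial>Pi\<^sub>M I (\<lambda>_. lborel)) =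
    ennreal (s ^ card I) * (\<integral>\<^sup>+ c. indicator {..1} (ellipsoid_norm I r u c) \<partial>Pi\<^sub>M I (\<lambda>_. lborel))"
  by (subst nn_integral_dilate[OF s]) (auto simp: indicator_ellipsoid_norm_dilate s)

text \<open>The ellipsoid lies in the box of the semi-axes whatever \<open>u\<close> is, which gives
  a bound uniform in \<open>u\<close>.\<close>

lemma ellipsoid_volume_le:
  "(\<integral>\<^sup>+ c. indicator {..1} (ellipsoid_norm I r u c) \<partial>Pi\<^sub>M I (\<lambda>_. lborel)) \<le> ennreal (\<Prod>k\<in>I. 2 * r k)"
proof -
  interpret product_sigma_finite "\<lambda>_. lborel :: real measure" by standard
  let ?B = "\<Pi>\<^sub>E k\<in>I. {- r k..r k}"
  have "(\<integral>\<^sup>+ c. indicator {..1} (ellipsoid_norm I r u c) \<partial>Pi\<^sub>M I (\<lambda>_. lborel)) \<le> (\<integral>\<^sup>+ c. indicator ?B c \<partial>Pi\<^sub>M I (\<lambda>_. lborel))"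
  proof (intro nn_integral_mono)
    fix c assume c: "c \<in> space (Pi\<^sub>M I (\<lambda>_. lborel :: real measure))"
    have "c \<in> ?B" if "ellipsoid_norm I r u c \<le> 1"
    proof -
      have "\<bar>c k\<bar> \<le> r k" if "k \<in> I" for k
      proof -
        have "\<bar>c k\<bar> \<le> r k * ellipsoid_norm I r u c"
          by (rule ellipsoid_norm_coordinate_le[of I k r c u]) (use I r that in auto)
        also have "\<dots> \<le> r k * 1"
          by (intro mult_left_mono) (use r that \<open>ellipsoid_norm I r u c \<le> 1\<close> less_imp_le in auto)
        finally show ?thesis by simp
      qed
      then show ?thesis using c by (force simp: space_PiM PiE_def Pi_def abs_le_iff)
    qed
    then show "indicator {..1} (ellipsoid_norm I r u c) \<le> (indicator ?B c :: ennreal)"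
      by (auto simp: indicator_def)
  qed
  also have "\<dots> = emeasure (Pi\<^sub>M I (\<lambda>_. lborel)) ?B"
    using I by (intro nn_integral_indicator sets_PiM_I_finite) auto
  also have "\<dots> = (\<Prod>k\<in>I. emeasure lborel {- r k..r k})"
    using I by (intro emeasure_PiM) auto
  also have "\<dots> = (\<Prod>k\<in>I. ennreal (2 * r k))"
    using r by (intro prod.cong) (auto simp: less_imp_le)
  also have "\<dots> = ennreal (\<Prod>k\<in>I. 2 * r k)"
    using r by (intro prod_ennreal) (auto simp: less_imp_le)
  finally show ?thesis .
qed

lemma ellipsoid_abs_moment:
  assumes "I \<noteq> {}"
  shows "(\<integral>\<^sup>+ c. indicator {..1} (ellipsoid_norm I r u c) * ennreal \<bar>linear_form I r w c\<bar> \<partial>Pi\<^sub>M I (\<lambda>_. lborel)) =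
    ennreal (ellipsoid_abs_moment I r u w)"
proof -
  have [simp]: "r k * c / r k = c" if "k \<in> I" for k c using r[OF that] by simp
  have q: "indicator {..1} (ellipsoid_norm I r u (\<lambda>i\<in>I. r i * c i)) =
      (indicator {..1} ((\<Sum>k\<in>I. (c k)\<^sup>2) + (\<Sum>k\<in>I. u k * c k)\<^sup>2) :: ennreal)" for c
  proof -
    have "ellipsoid_norm I r u (\<lambda>i\<in>I. r i * c i) = sqrt ((\<Sum>k\<in>I. (c k)\<^sup>2) + (\<Sum>k\<in>I. u k * c k)\<^sup>2)"
      by (simp add: ellipsoid_norm_def)
    then show ?thesis by (simp add: indicator_def)
  qed
  have l: "linear_form I r w (\<lambda>i\<in>I. r i * c i) = (\<Sum>k\<in>I. w k * c k)" for c
    by (simp add: linear_form_def)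
  have "(\<integral>\<^sup>+ c. indicator {..1} (ellipsoid_norm I r u c) * ennreal \<bar>linear_form I r w c\<bar> \<partial>Pi\<^sub>M I (\<lambda>_. lborel)) =
    ennreal (\<Prod>k\<in>I. r k) * (\<integral>\<^sup>+ c. indicator {..1} ((\<Sum>k\<in>I. (c k)\<^sup>2) + (\<Sum>k\<in>I. u k * c k)\<^sup>2) * ennreal \<bar>\<Sum>k\<in>I. w k * c k\<bar>
      \<partial>Pi\<^sub>M I (\<lambda>_. lborel))"
    by (subst nn_integral_PiM_diagonal_subst[OF I _ r]) (auto simp: q l)
  also have "\<dots> = ennreal (ellipsoid_abs_moment I r u w)"
    unfolding nn_integral_abs_form_ellipsoid[OF I assms] ellipsoid_abs_moment_def
    using r by (intro ennreal_mult'[symmetric] prod_nonneg) (auto intro: less_imp_le)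
  finally show ?thesis .
qed

end

text \<open>Rounding a point to its lattice corner changes the norm by at most \<open>a\<close> and
  the form by at most \<open>l\<close>, so the lattice sum lies between the integrals over the
  ellipsoids of size Q - a and Q + a, up to \<open>l\<close> times the number of lattice points. By
  homogeneity of degree card I + 1 the two sides differ by O(Q^(card I)). The constant is chosen
  before \<open>u\<close> and \<open>w\<close>: later these vary with the angle.\<close>

lemma lattice_sum_asymptotics:
  fixes r :: "'i \<Rightarrow> real"
  assumes I: "finite I" "I \<noteq> {}" and r: "\<And>k. k \<in> I \<Longrightarrow> r k > 0" and M: "M \<ge> 0"
  shows "\<exists>C\<ge>0. \<forall>u w Q. (\<forall>k\<in>I. \<bar>u k\<bar> \<le> M \<and> \<bar>w k\<bar> \<le> M) \<and> Q \<ge> 1 \<longrightarrow>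
    finite {b \<in> (\<Pi>\<^sub>E i\<in>I. \<int>). ellipsoid_norm I r u b \<le> Q} \<and>
    real (card {b \<in> (\<Pi>\<^sub>E i\<in>I. \<int>). ellipsoid_norm I r u b \<le> Q}) \<le> C * Q ^ card I \<and>
    \<bar>(\<Sum>b \<in> {b \<in> (\<Pi>\<^sub>E i\<in>I. \<int>). ellipsoid_norm I r u b \<le> Q}. \<bar>linear_form I r w b\<bar>)
       - Q ^ (card I + 1) * ellipsoid_abs_moment I r u w\<bar> \<le> C * Q ^ card I"
proof -
  define n where "n = card I"
  define \<rho> where "\<rho> = (\<Sum>k\<in>I. 1 / r k)"
  have \<rho>: "\<rho> \<ge> 0" unfolding \<rho>_def using r by (intro sum_nonneg) (auto intro: less_imp_le)
  \<comment> \<open>\<open>a\<close> and \<open>l\<close> bound the norm and the form on rounding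
    displacements, \<open>V\<close> the volume of the unit ellipsoid, and \<open>m1\<close> the form
    on the unit ellipsoid.\<close>
  define a where "a = (1 + M) * \<rho>"
  define l where "l = M * \<rho>"
  define V where "V = (\<Prod>k\<in>I. 2 * r k)"
  define m1 where "m1 = M * (\<Sum>k\<in>I. r k / r k)"
  have nonneg: "a \<ge> 0" "l \<ge> 0" "V \<ge> 0" "m1 \<ge> 0"
    using \<rho> M less_imp_le[OF r]
    by (auto simp: a_def l_def V_def m1_def intro!: prod_nonneg mult_nonneg_nonneg sum_nonneg)
  \<comment> \<open>The first summand pays for the number of lattice points, once by itself and once
    times \<open>l\<close>; the second is the bound for \<open>E * j1\<close> divided by
    Q^n.\<close>
  define C where "C = (1 + l) * (1 + a) ^ n * V + m1 * V * (real (n + 1) * (1 + a) ^ n * a)"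
  have C1: "(1 + a) ^ n * V \<le> C"
    using nonneg by (simp add: C_def distrib_right)
  have C2: "l * ((1 + a) ^ n * V) + m1 * V * (real (n + 1) * (1 + a) ^ n * a) \<le> C"
    using nonneg by (simp add: C_def distrib_right)
  have "C \<ge> 0" using C1 nonneg by (intro order.trans[OF _ C1]) auto
  moreover have "finite {b \<in> (\<Pi>\<^sub>E i\<in>I. \<int>). ellipsoid_norm I r u b \<le> Q} \<and>
    real (card {b \<in> (\<Pi>\<^sub>E i\<in>I. \<int>). ellipsoid_norm I r u b \<le> Q}) \<le> C * Q ^ card I \<and>
    \<bar>(\<Sum>b \<in> {b \<in> (\<Pi>\<^sub>E i\<in>I. \<int>). ellipsoid_norm I r u b \<le> Q}. \<bar>linear_form I r w b\<bar>)
       - Q ^ (card I + 1) * ellipsoid_abs_moment I r u w\<bar> \<le> C * Q ^ card I"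
    if uw: "\<forall>k\<in>I. \<bar>u k\<bar> \<le> M \<and> \<bar>w k\<bar> \<le> M" and Q: "Q \<ge> 1" for u w Q
  proof -
    let ?q = "ellipsoid_norm I r u" and ?l = "linear_form I r w"
    define S where "S = {b \<in> (\<Pi>\<^sub>E i\<in>I. \<int>). ?q b \<le> Q}"
    have "S \<subseteq> (\<Pi>\<^sub>E i\<in>I. of_int ` {- \<lceil>r i * Q\<rceil>..\<lceil>r i * Q\<rceil>})"
    proof
      fix b assume b: "b \<in> S"
      have "b i \<in> of_int ` {- \<lceil>r i * Q\<rceil>..\<lceil>r i * Q\<rceil>}" if i: "i \<in> I" for i
      proof -
        obtain z where z: "b i = of_int z" using b i by (auto simp: S_def elim!: Ints_cases)
        have "\<bar>b i\<bar> \<le> r i * ?q b"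
          by (rule ellipsoid_norm_coordinate_le) (use I r i in auto)
        also have "\<dots> \<le> r i * Q" using b r[OF i] by (intro mult_left_mono) (auto simp: S_def)
        finally have "z \<in> {- \<lceil>r i * Q\<rceil>..\<lceil>r i * Q\<rceil>}" unfolding z by (auto; linarith)
        then show ?thesis using z by auto
      qed
      then show "b \<in> (\<Pi>\<^sub>E i\<in>I. of_int ` {- \<lceil>r i * Q\<rceil>..\<lceil>r i * Q\<rceil>})"
        using b by (auto simp: S_def PiE_def)
    qed
    then have fin: "finite S" by (rule finite_subset) (use I in \<open>auto intro!: finite_PiE\<close>)
    define J0 where "J0 = (\<integral>\<^sup>+ c. indicator {..1} (?q c) \<partial>Pi\<^sub>M I (\<lambda>_. lborel))"
    obtain j0 where j0: "J0 = ennreal j0" "0 \<le> j0" "j0 \<le> V"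
    proof -
      have le: "J0 \<le> ennreal V" unfolding J0_def V_def by (rule ellipsoid_volume_le) (use I r in auto)
      then have "J0 < top" using ennreal_less_top order_le_less_trans by blast
      with le that[of "enn2real J0"] show ?thesis
        using nonneg by (auto simp: enn2real_leI)
    qed
    define j1 where "j1 = ellipsoid_abs_moment I r u w"
    have J1: "(\<integral>\<^sup>+ c. indicator {..1} (?q c) * ennreal \<bar>?l c\<bar> \<partial>Pi\<^sub>M I (\<lambda>_. lborel)) = ennreal j1"
      unfolding j1_def by (rule ellipsoid_abs_moment) (use I r in auto)
    have j1: "0 \<le> j1" "j1 \<le> m1 * V"
    proof -
      \<comment> \<open>\<open>sqrt\<close> takes negative values at negative arguments, so the sign
        of \<open>j1\<close> rests on Cauchy-Schwarz.\<close>
      have "(\<Sum>k\<in>I. u k * w k)\<^sup>2 \<le> (\<Sum>k\<in>I. (u k)\<^sup>2) * (\<Sum>k\<in>I. (w k)\<^sup>2)"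
        by (rule Cauchy_Schwarz_ineq_sum)
      moreover have "0 \<le> (\<Sum>k\<in>I. (w k)\<^sup>2)" "0 \<le> (\<Sum>k\<in>I. (u k)\<^sup>2)" by (simp_all add: sum_nonneg)
      moreover from calculation have "0 \<le> (\<Sum>k\<in>I. (w k)\<^sup>2) * (1 + (\<Sum>k\<in>I. (u k)\<^sup>2)) - (\<Sum>k\<in>I. u k * w k)\<^sup>2"
        by (simp add: algebra_simps)
      ultimately show "0 \<le> j1"
        unfolding j1_def ellipsoid_abs_moment_def using less_imp_le[OF r]
        by (intro mult_nonneg_nonneg prod_nonneg divide_nonneg_nonneg) auto
      have "ennreal j1 \<le> (\<integral>\<^sup>+ c. ennreal m1 * indicator {..1} (?q c) \<partial>Pi\<^sub>M I (\<lambda>_. lborel))"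
        unfolding J1[symmetric]
      proof (intro nn_integral_mono)
        fix c
        have "\<bar>?l c\<bar> \<le> m1" if "?q c \<le> 1"
          unfolding m1_def
        proof (rule linear_form_le)
          fix k assume k: "k \<in> I"
          have "\<bar>c k\<bar> \<le> r k * ?q c"
            by (rule ellipsoid_norm_coordinate_le) (use I r k in auto)
          also have "\<dots> \<le> r k * 1"
            using that r[OF k] by (intro mult_left_mono) auto
          finally show "\<bar>c k\<bar> \<le> r k" by simp
        qed (use I r uw in auto)
        then show "indicator {..1} (?q c) * ennreal \<bar>?l c\<bar> \<le> ennreal m1 * indicator {..1} (?q c)"
          by (auto simp: indicator_def ennreal_leI)
      qed
      also have "\<dots> = ennreal m1 * J0" unfolding J0_def by (rule nn_integral_cmult) measurable
      also have "\<dots> = ennreal (m1 * j0)" using j0 nonneg by (simp add: ennreal_mult)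
      finally have "j1 \<le> m1 * j0" using nonneg j0 by (simp add: ennreal_le_iff)
      also have "\<dots> \<le> m1 * V" using nonneg j0 by (intro mult_left_mono)
      finally show "j1 \<le> m1 * V" .
    qed
    have near: "?q (floor_vec I c) \<le> ?q c + a" "?q c \<le> ?q (floor_vec I c) + a"
      "\<bar>?l (floor_vec I c)\<bar> \<le> \<bar>?l c\<bar> + l" "\<bar>?l c\<bar> \<le> \<bar>?l (floor_vec I c)\<bar> + l" for c
    proof -
      let ?d = "\<lambda>k. c k - floor_vec I c k"
      have d: "\<bar>?d k\<bar> \<le> 1" if "k \<in> I" for k
        using that by (simp add: floor_vec_def) linarith
      have qd: "?q ?d \<le> a" unfolding a_def \<rho>_def
        by (rule ellipsoid_norm_le) (use I r uw d in auto)
      have "?q (\<lambda>k. (-1) * ?d k) = ?q ?d" by (subst ellipsoid_norm_scale) simp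
      then have qd': "?q (\<lambda>k. (-1) * ?d k) \<le> a" using qd by simp
      have ld: "\<bar>?l ?d\<bar> \<le> l" unfolding l_def \<rho>_def
        by (rule linear_form_le) (use I r uw d in auto)
      show "?q (floor_vec I c) \<le> ?q c + a"
        using ellipsoid_norm_triangle[of I r u c "\<lambda>k. (-1) * ?d k"] qd' by simp
      show "?q c \<le> ?q (floor_vec I c) + a"
        using ellipsoid_norm_triangle[of I r u "floor_vec I c" ?d] qd by simp
      have "?l c = ?l (floor_vec I c) + ?l ?d"
        using linear_form_add[of I r w "floor_vec I c" ?d] by simp
      then show "\<bar>?l (floor_vec I c)\<bar> \<le> \<bar>?l c\<bar> + l" "\<bar>?l c\<bar> \<le> \<bar>?l (floor_vec I c)\<bar> + l"
        using ld by linarith+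
    qed
    have Qa: "(Q + a) ^ n \<le> (1 + a) ^ n * Q ^ n"
    proof -
      have "Q + a \<le> (1 + a) * Q" using Q nonneg by (simp add: distrib_right mult_le_cancel_left1)
      then have "(Q + a) ^ n \<le> ((1 + a) * Q) ^ n" using Q nonneg by (intro power_mono) auto
      then show ?thesis by (simp add: power_mult_distrib)
    qed
    have Qa_pos: "Q + a > 0" using Q nonneg by linarith
    have vol: "(\<integral>\<^sup>+ c. indicator {..Q + a} (?q c) \<partial>Pi\<^sub>M I (\<lambda>_. lborel)) = ennreal ((Q + a) ^ n * j0)"
      using ellipsoid_volume_dilate[where I = I and r = r and u = u, OF I(1) r Qa_pos] j0 Qa_pos
      by (simp add: J0_def n_def ennreal_mult)
    have Qaj0: "(Q + a) ^ n * j0 \<le> (1 + a) ^ n * V * Q ^ n"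
      using mult_mono[OF Qa j0(3)] j0 Q nonneg by (simp add: mult_ac)
    have card_le: "real (card S) \<le> (Q + a) ^ n * j0"
    proof -
      have "ennreal (real (card S)) = (\<Sum>b\<in>S. (indicator {..Q} (?q b) :: ennreal))"
        by (simp add: S_def ennreal_of_nat_eq_real_of_nat)
      also have "\<dots> = (\<integral>\<^sup>+ c. indicator {..Q} (?q (floor_vec I c)) \<partial>Pi\<^sub>M I (\<lambda>_. lborel))"
        by (rule sum_lattice_eq_nn_integral[OF I(1) fin]) (auto simp: S_def)
      also have "\<dots> \<le> (\<integral>\<^sup>+ c. indicator {..Q + a} (?q c) \<partial>Pi\<^sub>M I (\<lambda>_. lborel))"
        using near(2) by (intro nn_integral_mono) (force simp: indicator_def intro: order.trans)
      finally show ?thesis unfolding vol using j0 Qa_pos by (simp add: ennreal_le_iff)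
    qed
    define T where "T = (\<Sum>b\<in>S. \<bar>?l b\<bar>)"
    have T0: "T \<ge> 0" by (simp add: T_def sum_nonneg)
    have lin: "(\<integral>\<^sup>+ c. indicator {..s} (?q c) * ennreal \<bar>?l c\<bar> \<partial>Pi\<^sub>M I (\<lambda>_. lborel)) = ennreal (s ^ (n + 1) * j1)" if "s > 0" for s
      using ellipsoid_abs_integral_dilate[where I = I and r = r and u = u and w = w, OF I(1) r that] j1 that
      by (simp add: J1 n_def ennreal_mult)
    have upper: "T \<le> (Q + a) ^ (n + 1) * j1 + l * ((Q + a) ^ n * j0)"
    proof -
      have "ennreal T = (\<Sum>b\<in>S. indicator {..Q} (?q b) * ennreal \<bar>?l b\<bar>)"
        by (simp add: T_def S_def)
      also have "\<dots> = (\<integral>\<^sup>+ c. indicator {..Q} (?q (floor_vec I c)) * ennreal \<bar>?l (floor_vec I c)\<bar> \<partial>Pi\<^sub>M I (\<lambda>_. lborel))"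
        by (rule sum_lattice_eq_nn_integral[OF I(1) fin]) (auto simp: S_def)
      also have "\<dots> \<le> (\<integral>\<^sup>+ c. indicator {..Q + a} (?q c) * ennreal \<bar>?l c\<bar> + ennreal l * indicator {..Q + a} (?q c) \<partial>Pi\<^sub>M I (\<lambda>_. lborel))"
      proof (intro nn_integral_mono)
        fix c
        have "?q c \<le> Q + a" if "?q (floor_vec I c) \<le> Q" using that near(2)[of c] by linarith
        moreover have "ennreal \<bar>?l (floor_vec I c)\<bar> \<le> ennreal \<bar>?l c\<bar> + ennreal l"
          using near(3)[of c] nonneg by (simp flip: ennreal_plus)
        ultimately show "indicator {..Q} (?q (floor_vec I c)) * ennreal \<bar>?l (floor_vec I c)\<bar> \<le>
            indicator {..Q + a} (?q c) * ennreal \<bar>?l c\<bar> + ennreal l * indicator {..Q + a} (?q c)"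
          by (auto simp: indicator_def)
      qed
      also have "\<dots> = ennreal ((Q + a) ^ (n + 1) * j1) + ennreal l * ennreal ((Q + a) ^ n * j0)"
        unfolding lin[OF Qa_pos, symmetric] vol[symmetric]
        by (subst nn_integral_add) (auto intro!: nn_integral_cmult)
      also have "\<dots> = ennreal ((Q + a) ^ (n + 1) * j1 + l * ((Q + a) ^ n * j0))"
        using nonneg j0 j1 Qa_pos by (simp add: ennreal_mult)
      finally show ?thesis using nonneg j0 j1 Qa_pos by (subst (asm) ennreal_le_iff) auto
    qed
    \<comment> \<open>Points of norm at most Q - a round to lattice points of norm at most Q; the
      dilation formula requires Q - a to be positive.\<close>
    have lower: "(Q - a) ^ (n + 1) * j1 \<le> T + l * real (card S)" if "Q > a"
    proof -
      have "ennreal ((Q - a) ^ (n + 1) * j1) = (\<integral>\<^sup>+ c. indicator {..Q - a} (?q c) * ennreal \<bar>?l c\<bar> \<partial>Pi\<^sub>M I (\<lambda>_. lborel))"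
        using that by (intro lin[symmetric]) simp
      also have "\<dots> \<le> (\<integral>\<^sup>+ c. indicator {..Q} (?q (floor_vec I c)) * (ennreal \<bar>?l (floor_vec I c)\<bar> + ennreal l) \<partial>Pi\<^sub>M I (\<lambda>_. lborel))"
      proof (intro nn_integral_mono)
        fix c
        have "?q (floor_vec I c) \<le> Q" if "?q c \<le> Q - a" using that near(1)[of c] by linarith
        moreover have "ennreal \<bar>?l c\<bar> \<le> ennreal \<bar>?l (floor_vec I c)\<bar> + ennreal l"
          using near(4)[of c] nonneg by (simp flip: ennreal_plus)
        ultimately show "indicator {..Q - a} (?q c) * ennreal \<bar>?l c\<bar> \<le>
            indicator {..Q} (?q (floor_vec I c)) * (ennreal \<bar>?l (floor_vec I c)\<bar> + ennreal l)"
          by (auto simp: indicator_def)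
      qed
      also have "\<dots> = (\<Sum>b\<in>S. indicator {..Q} (?q b) * (ennreal \<bar>?l b\<bar> + ennreal l))"
        by (rule sum_lattice_eq_nn_integral[OF I(1) fin, symmetric]) (auto simp: S_def)
      also have "\<dots> = (\<Sum>b\<in>S. ennreal (\<bar>?l b\<bar> + l))"
        using nonneg by (intro sum.cong) (auto simp: S_def)
      also have "\<dots> = ennreal (T + l * real (card S))"
        using nonneg by (subst sum_ennreal) (auto simp: T_def sum.distrib)
      finally show ?thesis using nonneg T0 by (subst (asm) ennreal_le_iff) auto
    qed
    \<comment> \<open>Bounds the change of Q^(n+1) when Q moves by \<open>a\<close> in either
      direction; Q \<ge> 1 gives Q + a \<le> (1 + a) Q.\<close>
    define E where "E = real (n + 1) * (1 + a) ^ n * a * Q ^ n"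
    have E0: "E \<ge> 0" using nonneg Q by (simp add: E_def)
    have up: "(Q + a) ^ (n + 1) \<le> Q ^ (n + 1) + E"
    proof -
      have "(Q + a) ^ (n + 1) - Q ^ (n + 1) \<le> real (n + 1) * (Q + a) ^ n * a"
        using power_diff_le[of Q "Q + a" n] nonneg Q by simp
      also have "\<dots> \<le> real (n + 1) * ((1 + a) ^ n * Q ^ n) * a"
        using Qa nonneg by (intro mult_right_mono mult_left_mono) auto
      finally show ?thesis by (simp add: E_def mult_ac)
    qed
    have low: "Q ^ (n + 1) * j1 \<le> T + l * real (card S) + E * j1"
    proof (cases "Q > a")
      case True
      have "Q ^ (n + 1) - (Q - a) ^ (n + 1) \<le> real (n + 1) * Q ^ n * a"
        using power_diff_le[of "Q - a" Q n] nonneg True by simp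
      also have "\<dots> \<le> real (n + 1) * Q ^ n * a * (1 + a) ^ n"
      proof -
        have "1 \<le> (1 + a) ^ n" using nonneg by simp
        moreover have "0 \<le> real (n + 1) * Q ^ n * a" using nonneg Q by simp
        ultimately show ?thesis using mult_left_mono[of 1 "(1 + a) ^ n" "real (n + 1) * Q ^ n * a"] by simp
      qed
      finally have "Q ^ (n + 1) \<le> (Q - a) ^ (n + 1) + E" by (simp add: E_def mult_ac)
      then have "Q ^ (n + 1) * j1 \<le> ((Q - a) ^ (n + 1) + E) * j1" using j1 by (intro mult_right_mono)
      then show ?thesis using lower[OF True] by (simp add: distrib_right)
    next
      case False
      \<comment> \<open>For Q \<le> a there is no inner ellipsoid, but then the main term itself is
        of the size of the error.\<close>
      have "Q ^ (n + 1) = Q * Q ^ n" by simp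
      also have "\<dots> \<le> a * Q ^ n" using False Q by (intro mult_right_mono) auto
      also have "\<dots> \<le> E"
      proof -
        have "1 * 1 \<le> real (n + 1) * (1 + a) ^ n" using nonneg by (intro mult_mono) auto
        then have "1 * (a * Q ^ n) \<le> real (n + 1) * (1 + a) ^ n * (a * Q ^ n)"
          using nonneg Q by (intro mult_right_mono) auto
        then show ?thesis by (simp add: E_def mult_ac)
      qed
      finally have "Q ^ (n + 1) * j1 \<le> E * j1" using j1 by (intro mult_right_mono)
      then show ?thesis using T0 nonneg by (meson add_increasing mult_nonneg_nonneg of_nat_0_le_iff order.trans add_nonneg_nonneg)
    qed
    have Ej1: "E * j1 \<le> m1 * V * (real (n + 1) * (1 + a) ^ n * a) * Q ^ n"
      using mult_left_mono[OF j1(2) E0] by (simp add: E_def mult_ac)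
    have lj0: "l * ((Q + a) ^ n * j0) \<le> l * ((1 + a) ^ n * V) * Q ^ n"
      using mult_left_mono[OF Qaj0 nonneg(2)] by (simp add: mult_ac)
    have bound: "l * ((Q + a) ^ n * j0) + E * j1 \<le> C * Q ^ n"
    proof -
      have "l * ((Q + a) ^ n * j0) + E * j1 \<le> (l * ((1 + a) ^ n * V) + m1 * V * (real (n + 1) * (1 + a) ^ n * a)) * Q ^ n"
        using Ej1 lj0 by (simp add: distrib_right)
      also have "\<dots> \<le> C * Q ^ n" using C2 Q by (intro mult_right_mono) auto
      finally show ?thesis .
    qed
    have "T \<le> Q ^ (n + 1) * j1 + E * j1 + l * ((Q + a) ^ n * j0)"
      using upper mult_right_mono[OF up j1(1)] by (simp add: distrib_right)
    moreover have "Q ^ (n + 1) * j1 \<le> T + l * ((Q + a) ^ n * j0) + E * j1"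
      using low mult_left_mono[OF card_le nonneg(2)] by linarith
    ultimately have "\<bar>T - Q ^ (n + 1) * j1\<bar> \<le> C * Q ^ n" using bound by linarith
    moreover have "real (card S) \<le> C * Q ^ n"
    proof -
      have "(1 + a) ^ n * V * Q ^ n \<le> C * Q ^ n" using C1 Q by (intro mult_right_mono) auto
      then show ?thesis using card_le Qaj0 by linarith
    qed
    ultimately show ?thesis using fin by (simp add: T_def S_def n_def j1_def)
  qed
  ultimately show ?thesis by blast
qed

text \<open>The mixed second derivative of ln K is (K K_xy - K_x K_y) / K^2. At x = y = t the
  covariance K is \<open>A\<close>, the mixed derivative is \<open>B\<close>, and both first
  derivatives are - \<open>D\<close>.\<close>

lemma angle_density_eq:
  fixes t :: real
  assumes "lam m > 0"
  defines "A \<equiv> (lam m)\<^sup>2 / 2 + (\<Sum>k=1..m. (lam (m - k))\<^sup>2 * (cos (real k * t))\<^sup>2)"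
    and "B \<equiv> \<Sum>k=1..m. (lam (m - k))\<^sup>2 * (real k * sin (real k * t))\<^sup>2"
    and "D \<equiv> \<Sum>k=1..m. (lam (m - k))\<^sup>2 * (cos (real k * t) * (real k * sin (real k * t)))"
  shows "angle_density m lam t = sqrt (A * B - D\<^sup>2) / A" "A > 0"
proof -
  define g where "g = (\<lambda>x y. - (\<Sum>k=1..m. (lam (m - k))\<^sup>2 * cos (real k * x) * (real k * sin (real k * y))))"
  have cov_y: "((\<lambda>y. covariance m lam x y) has_real_derivative g x y) (at y)" for x y
    unfolding covariance_def g_def
    by (auto intro!: derivative_eq_intros sum.cong simp: sum_negf[symmetric])
  have cov_x: "((\<lambda>x. covariance m lam x y) has_real_derivative g y x) (at x)" for x y
    unfolding covariance_def g_def
    by (auto intro!: derivative_eq_intros sum.cong simp: sum_negf[symmetric])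
  have g_x: "((\<lambda>x. g x y) has_real_derivative (\<Sum>k=1..m. (lam (m - k))\<^sup>2 * (real k * sin (real k * x)) * (real k * sin (real k * y)))) (at x)" for x y
    unfolding g_def
    by (auto intro!: derivative_eq_intros sum.cong simp: sum_negf[symmetric])
  have A: "covariance m lam t t = A"
    by (simp add: covariance_def A_def power2_eq_square mult_ac)
  show "A > 0" unfolding A_def using assms(1) by (intro add_pos_nonneg sum_nonneg) auto
  \<comment> \<open>Off the diagonal the covariance may be negative, and the quotient rule for the
    logarithm is used where it is positive. Positivity near t suffices, since the outer derivative
    is local.\<close>
  have "isCont (\<lambda>x. covariance m lam x t) t" using cov_x DERIV_isCont by blast
  then have "\<forall>\<^sub>F x in at t. covariance m lam x t > 0"
    using \<open>A > 0\<close> A unfolding isCont_def by (intro order_tendstoD) auto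
  then have "\<forall>\<^sub>F x in nhds t. covariance m lam x t > 0"
    using \<open>A > 0\<close> A by (auto simp: eventually_at_filter eventually_nhds elim!: eventually_mono)
  then have "\<forall>\<^sub>F x in nhds t. deriv (\<lambda>y. ln (covariance m lam x y)) t = g x t / covariance m lam x t"
  proof (rule eventually_mono)
    fix x assume "covariance m lam x t > 0"
    then have "((\<lambda>y. ln (covariance m lam x y)) has_real_derivative g x t / covariance m lam x t) (at t)"
      by (auto intro!: derivative_eq_intros cov_y)
    then show "deriv (\<lambda>y. ln (covariance m lam x y)) t = g x t / covariance m lam x t"
      by (rule DERIV_imp_deriv)
  qed
  then have "deriv (\<lambda>x. deriv (\<lambda>y. ln (covariance m lam x y)) t) t = deriv (\<lambda>x. g x t / covariance m lam x t) t"
    by (rule deriv_cong_ev) simp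
  also have "\<dots> = (B * A - g t t * g t t) / (A * A)"
  proof (rule DERIV_imp_deriv)
    have B: "(\<Sum>k=1..m. (lam (m - k))\<^sup>2 * (real k * sin (real k * t)) * (real k * sin (real k * t))) = B"
      by (simp add: B_def power2_eq_square mult_ac)
    show "((\<lambda>x. g x t / covariance m lam x t) has_real_derivative (B * A - g t t * g t t) / (A * A)) (at t)"
      using DERIV_divide[OF g_x cov_x, of t t t] \<open>A > 0\<close> unfolding A B by simp
  qed
  also have "g t t = - D" by (simp add: g_def D_def mult_ac)
  also have "(B * A - (- D) * (- D)) / (A * A) = (A * B - D\<^sup>2) / A\<^sup>2"
    by (simp add: power2_eq_square mult.commute)
  finally show "angle_density m lam t = sqrt (A * B - D\<^sup>2) / A"
    using \<open>A > 0\<close> by (simp add: angle_density_def real_sqrt_divide)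
qed

section \<open>Real zeros of integer cosine polynomials\<close>

context
  fixes m :: nat and lam :: "nat \<Rightarrow> real"
  assumes m: "m \<ge> 1" and lam: "\<And>k. k \<le> m \<Longrightarrow> lam k > 0"
begin

text \<open>The coefficient of index m - k occurs again at index m + k with the same weight, so its
  square counts twice in the height; hence the division by sqrt 2.\<close>

definition semi_axis :: "nat \<Rightarrow> real" where
  "semi_axis k = lam (m - k) / sqrt 2"

text \<open>Chosen so that the linear form with these weights is the middle coefficient forced by a
  root at \<theta>, divided by \<open>lam m\<close>, up to sign; \<open>sin_weight\<close> likewise
  gives the derivative of that coefficient in \<theta>.\<close>

definition cos_weight :: "real \<Rightarrow> nat \<Rightarrow> real" where
  "cos_weight \<theta> k = 2 * semi_axis k * cos (real k * \<theta>) / lam m"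

definition sin_weight :: "real \<Rightarrow> nat \<Rightarrow> real" where
  "sin_weight \<theta> k = 2 * semi_axis k * (real k * sin (real k * \<theta>))"

text \<open>Twice the constant of the theorem, without zeta: at this stage P and -P are both
  counted, primitive or not.\<close>

definition density_constant :: real where
  "density_constant = unit_ball_vol (real (m + 1)) / (pi * 2 powr (real m / 2)) * (\<Prod>k\<le>m. lam k)"

lemma semi_axis_pos: "semi_axis k > 0"
  using lam[of "m - k"] by (simp add: semi_axis_def)

lemma prod_semi_axis: "lam m * (\<Prod>k=1..m. semi_axis k) = (\<Prod>k\<le>m. lam k) / 2 powr (real m / 2)"
proof -
  have "(\<Prod>k=1..m. lam (m - k)) = (\<Prod>k<m. lam k)"
    by (rule prod.reindex_bij_witness[of _ "\<lambda>k. m - k" "\<lambda>k. m - k"]) auto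
  moreover have "sqrt 2 ^ m = 2 powr (real m / 2)"
    by (simp add: powr_half_sqrt[symmetric] powr_powr flip: powr_realpow)
  moreover have "(\<Prod>k\<le>m. lam k) = (\<Prod>k<m. lam k) * lam m"
    by (simp flip: lessThan_Suc_atMost)
  ultimately show ?thesis
    by (simp add: semi_axis_def prod_dividef)
qed

text \<open>For these weights 1 + U = 2 A / lam_m^2, W = 2 B and V = 2 D / lam_m, so the moment
  formula becomes \<open>lam m\<close> times sqrt (A B - D^2) / A.\<close>

lemma ellipsoid_abs_moment_eq_density:
  "ellipsoid_abs_moment {1..m} semi_axis (cos_weight \<theta>) (sin_weight \<theta>) = density_constant * angle_density m lam \<theta>"
proof -
  define A where "A = (lam m)\<^sup>2 / 2 + (\<Sum>k=1..m. (lam (m - k))\<^sup>2 * (cos (real k * \<theta>))\<^sup>2)"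
  define B where "B = (\<Sum>k=1..m. (lam (m - k))\<^sup>2 * (real k * sin (real k * \<theta>))\<^sup>2)"
  define D where "D = (\<Sum>k=1..m. (lam (m - k))\<^sup>2 * (cos (real k * \<theta>) * (real k * sin (real k * \<theta>))))"
  have lm: "lam m > 0" using lam by simp
  have p: "angle_density m lam \<theta> = sqrt (A * B - D\<^sup>2) / A" "A > 0"
    using angle_density_eq[where lam = lam and m = m and t = \<theta>, OF lm] unfolding A_def B_def D_def by blast+
  have sa: "semi_axis k * semi_axis k = (lam (m - k))\<^sup>2 / 2" for k
    by (simp add: semi_axis_def power2_eq_square)
  have U: "1 + (\<Sum>k=1..m. (cos_weight \<theta> k)\<^sup>2) = 2 / (lam m)\<^sup>2 * A"
  proof -
    have "(cos_weight \<theta> k)\<^sup>2 = 2 / (lam m)\<^sup>2 * ((lam (m - k))\<^sup>2 * (cos (real k * \<theta>))\<^sup>2)" for k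
      by (simp add: cos_weight_def power_mult_distrib power_divide power2_eq_square[of "semi_axis k"] sa)
    then show ?thesis using lm by (simp add: A_def distrib_left sum_distrib_left)
  qed
  have W: "(\<Sum>k=1..m. (sin_weight \<theta> k)\<^sup>2) = 2 * B"
  proof -
    have "(sin_weight \<theta> k)\<^sup>2 = 2 * ((lam (m - k))\<^sup>2 * (real k * sin (real k * \<theta>))\<^sup>2)" for k
      by (simp add: sin_weight_def power_mult_distrib power2_eq_square[of "semi_axis k"] sa)
    then show ?thesis by (simp add: B_def sum_distrib_left)
  qed
  have V: "(\<Sum>k=1..m. cos_weight \<theta> k * sin_weight \<theta> k) = 2 / lam m * D"
  proof -
    have "cos_weight \<theta> k * sin_weight \<theta> k = 2 / lam m * ((lam (m - k))\<^sup>2 * (cos (real k * \<theta>) * (real k * sin (real k * \<theta>))))" for k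
    proof -
      have "cos_weight \<theta> k * sin_weight \<theta> k = 4 * (semi_axis k * semi_axis k) * (cos (real k * \<theta>) * (real k * sin (real k * \<theta>))) / lam m"
        by (simp add: cos_weight_def sin_weight_def)
      then show ?thesis unfolding sa by simp
    qed
    then show ?thesis by (simp add: D_def sum_distrib_left)
  qed
  have "2 * B * (2 / (lam m)\<^sup>2 * A) - (2 / lam m * D)\<^sup>2 = (2 / lam m)\<^sup>2 * (A * B - D\<^sup>2)"
    by (simp add: power_mult_distrib power_divide right_diff_distrib)
  then have "sqrt (2 * B * (2 / (lam m)\<^sup>2 * A) - (2 / lam m * D)\<^sup>2) = 2 / lam m * sqrt (A * B - D\<^sup>2)"
    using lm by (simp add: real_sqrt_mult)
  then have "sqrt (2 * B * (2 / (lam m)\<^sup>2 * A) - (2 / lam m * D)\<^sup>2) / (2 / (lam m)\<^sup>2 * A) = lam m * angle_density m lam \<theta>"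
    using lm p by (simp add: power2_eq_square field_simps)
  then show ?thesis
    unfolding ellipsoid_abs_moment_def U W V
    using prod_semi_axis lm by (simp add: density_constant_def field_simps)
qed

lemma continuous_angle_density: "continuous_on X (angle_density m lam)"
proof -
  have lm: "lam m > 0" using lam by simp
  have "angle_density m lam = (\<lambda>t. sqrt (((lam m)\<^sup>2 / 2 + (\<Sum>k=1..m. (lam (m - k))\<^sup>2 * (cos (real k * t))\<^sup>2)) *
     (\<Sum>k=1..m. (lam (m - k))\<^sup>2 * (real k * sin (real k * t))\<^sup>2) -
     (\<Sum>k=1..m. (lam (m - k))\<^sup>2 * (cos (real k * t) * (real k * sin (real k * t))))\<^sup>2) /
     ((lam m)\<^sup>2 / 2 + (\<Sum>k=1..m. (lam (m - k))\<^sup>2 * (cos (real k * t))\<^sup>2)))"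
    using angle_density_eq(1)[where lam = lam and m = m, OF lm] by blast
  then show ?thesis
    by (simp only:) (intro continuous_intros, use angle_density_eq(2)[where lam = lam and m = m, OF lm] in \<open>auto simp: less_imp_neq[symmetric]\<close>)
qed

section \<open>Fibres over the non-middle coefficients\<close>

definition cos_part :: "(nat \<Rightarrow> real) \<Rightarrow> real \<Rightarrow> real" where
  "cos_part c \<theta> = - (2 * (\<Sum>k=1..m. c k * cos (real k * \<theta>)))"

definition cos_part_deriv :: "(nat \<Rightarrow> real) \<Rightarrow> real \<Rightarrow> real" where
  "cos_part_deriv c \<theta> = 2 * (\<Sum>k=1..m. (c k * real k) * sin (real k * \<theta>))"

lemma cos_part_has_derivative: "(cos_part c has_real_derivative cos_part_deriv c \<theta>) (at \<theta>)"
  unfolding cos_part_def cos_part_deriv_def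
  by (auto intro!: derivative_eq_intros sum.cong simp: sum_negf[symmetric] sum_distrib_left)

lemma linear_form_cos_weight: "linear_form {1..m} semi_axis (cos_weight \<theta>) c = - cos_part c \<theta> / lam m"
  using semi_axis_pos lam[of m]
  by (simp add: linear_form_def cos_part_def cos_weight_def sum_distrib_left sum_divide_distrib less_imp_neq[symmetric] mult_ac)

lemma linear_form_sin_weight: "linear_form {1..m} semi_axis (sin_weight \<theta>) c = cos_part_deriv c \<theta>"
  using semi_axis_pos
  by (simp add: linear_form_def cos_part_deriv_def sin_weight_def sum_distrib_left less_imp_neq[symmetric] mult_ac)

text \<open>The largest square of the middle coefficient that the height bound leaves once the
  others are fixed; it is negative when no middle coefficient is admissible.\<close>

definition slack :: "real \<Rightarrow> (nat \<Rightarrow> real) \<Rightarrow> real" where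
  "slack Q c = (lam m)\<^sup>2 * (Q\<^sup>2 - (\<Sum>k=1..m. (c k / semi_axis k)\<^sup>2))"

text \<open>For fixed \<open>c\<close> the right-hand side restricts the angle; for fixed \<theta>
  the left-hand side describes an ellipsoid in \<open>c\<close>. This double reading makes the
  exchange of sum and integral useful.\<close>

lemma ellipsoid_norm_le_iff:
  assumes "Q \<ge> 0"
  shows "ellipsoid_norm {1..m} semi_axis (cos_weight \<theta>) c \<le> Q \<longleftrightarrow> (cos_part c \<theta>)\<^sup>2 \<le> slack Q c"
proof -
  have lm: "(lam m)\<^sup>2 > 0" using lam[of m] by simp
  have "ellipsoid_norm {1..m} semi_axis (cos_weight \<theta>) c =
     sqrt ((\<Sum>k=1..m. (c k / semi_axis k)\<^sup>2) + (cos_part c \<theta>)\<^sup>2 / (lam m)\<^sup>2)"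
    using linear_form_cos_weight[of \<theta> c] by (simp add: ellipsoid_norm_def linear_form_def power_divide)
  also have "\<dots> \<le> Q \<longleftrightarrow> (\<Sum>k=1..m. (c k / semi_axis k)\<^sup>2) + (cos_part c \<theta>)\<^sup>2 / (lam m)\<^sup>2 \<le> Q\<^sup>2"
    using assms by (intro real_sqrt_le_iff') (auto intro!: add_nonneg_nonneg sum_nonneg)
  also have "\<dots> \<longleftrightarrow> (cos_part c \<theta>)\<^sup>2 / (lam m)\<^sup>2 \<le> Q\<^sup>2 - (\<Sum>k=1..m. (c k / semi_axis k)\<^sup>2)" by auto
  also have "\<dots> \<longleftrightarrow> (cos_part c \<theta>)\<^sup>2 \<le> slack Q c"
    unfolding slack_def using lm by (simp add: pos_divide_le_eq mult.commute)
  finally show ?thesis .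
qed

lemma trig_poly_eq_0_iff: "trig_poly m (c(0 := n)) \<theta> = 0 \<longleftrightarrow> cos_part c \<theta> = n"
proof -
  have "(\<Sum>k=1..m. (c(0 := n)) k * cos (real k * \<theta>)) = (\<Sum>k=1..m. c k * cos (real k * \<theta>))"
    by (intro sum.cong) auto
  then show ?thesis unfolding trig_poly_def cos_part_def by auto
qed

lemma count_cos_part_integer_values:
  assumes c: "k0 \<in> {1..m}" "c k0 \<noteq> 0" and \<beta>: "- pi \<le> \<beta>1" "\<beta>1 \<le> \<beta>2" "\<beta>2 \<le> pi"
  shows "\<exists>v. ((\<lambda>x. if (cos_part c x)\<^sup>2 \<le> R then \<bar>cos_part_deriv c x\<bar> else 0) has_integral v) {\<beta>1..\<beta>2} \<and>
    finite {x \<in> {\<beta>1..\<beta>2}. cos_part c x \<in> \<int> \<and> (cos_part c x)\<^sup>2 \<le> R} \<and>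
    \<bar>real (card {x \<in> {\<beta>1..\<beta>2}. cos_part c x \<in> \<int> \<and> (cos_part c x)\<^sup>2 \<le> R}) - v\<bar> \<le> 3 * real (3 * (2 * m + 1)) + 2"
proof -
  define Z where "Z n = {\<theta> \<in> {-pi..pi}. trig_poly m (c(0 := n)) \<theta> = 0}" for n
  define Z' where "Z' = {\<theta> \<in> {-pi..pi}. (\<Sum>k=1..m. (c k * real k) * sin (real k * \<theta>)) = 0}"
  have Z: "finite (Z n) \<and> card (Z n) \<le> 2 * m + 1" for n
    unfolding Z_def using c by (intro card_trig_poly_roots_le[of k0]) auto
  have Z': "finite Z' \<and> card Z' \<le> 2 * m + 1"
    unfolding Z'_def using c by (intro card_sine_poly_roots_le[of k0]) auto
  show ?thesis
  \<comment> \<open>The interval is cut at the critical points of \<open>cos_part c\<close> and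
    where it equals sqrt R or - sqrt R: three families of at most 2m + 1 points each.\<close>
  proof (rule count_integer_values[where Z = "Z' \<union> (Z (sqrt R) \<union> Z (- sqrt R))"])
    show "continuous_on {\<beta>1..\<beta>2} (cos_part_deriv c)"
      unfolding cos_part_deriv_def by (intro continuous_intros)
    have "card (Z' \<union> (Z (sqrt R) \<union> Z (- sqrt R))) \<le> card Z' + (card (Z (sqrt R)) + card (Z (- sqrt R)))"
      by (meson add_left_mono card_Un_le order_trans)
    also have "\<dots> \<le> (2 * m + 1) + ((2 * m + 1) + (2 * m + 1))"
      by (intro add_mono conjunct2[OF Z] conjunct2[OF Z'])
    finally show "card (Z' \<union> (Z (sqrt R) \<union> Z (- sqrt R))) \<le> 3 * (2 * m + 1)" by simp
    fix x assume x: "x \<in> {\<beta>1<..<\<beta>2}" and *: "cos_part_deriv c x = 0 \<or> (cos_part c x)\<^sup>2 = R"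
    have x': "x \<in> {-pi..pi}" using x \<beta> by auto
    show "x \<in> Z' \<union> (Z (sqrt R) \<union> Z (- sqrt R))"
    proof (cases "cos_part_deriv c x = 0")
      case True
      then show ?thesis using x' by (simp add: Z'_def cos_part_deriv_def)
    next
      case False
      then have "sqrt R = \<bar>cos_part c x\<bar>" using * by auto
      then have "cos_part c x = sqrt R \<or> cos_part c x = - sqrt R" by linarith
      then show ?thesis using x' unfolding Z_def trig_poly_eq_0_iff by auto
    qed
  qed (use \<beta> Z Z' cos_part_has_derivative in auto)
qed

text \<open>Entry 0 is the middle coefficient and entry k the one at distance k from it. The
  condition is the bound Q for the elliptic height, expressed in these half coefficients.\<close>

definition height_lattice :: "real \<Rightarrow> (nat \<Rightarrow> real) set" where
  "height_lattice Q = {b \<in> (\<Pi>\<^sub>E k\<in>{..m}. \<int>).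
     (b 0)\<^sup>2 / (lam m)\<^sup>2 + (\<Sum>k=1..m. (b k / semi_axis k)\<^sup>2) \<le> Q\<^sup>2}"

lemma finite_Ints_square_le: "finite {n \<in> \<int>. n\<^sup>2 \<le> (R :: real)}"
proof (rule finite_subset)
  have "\<bar>n\<bar> \<le> sqrt R" if "n\<^sup>2 \<le> R" for n
    using that by (intro real_le_rsqrt) simp
  then show "{n \<in> \<int>. n\<^sup>2 \<le> R} \<subseteq> {- sqrt R..sqrt R} \<inter> \<int>"
    by (force simp: abs_le_iff)
  show "finite ({- sqrt R..sqrt R} \<inter> \<int>)"
    by (cases "- sqrt R \<le> sqrt R") (auto intro: card_Ints_atLeastAtMost)
qed

lemma sum_height_lattice_fibres:
  assumes B: "B = {c \<in> (\<Pi>\<^sub>E k\<in>{1..m}. \<int>). (\<Sum>k=1..m. (c k / semi_axis k)\<^sup>2) \<le> Q\<^sup>2}" "finite B"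
  shows "finite (height_lattice Q)"
    and "(\<Sum>b\<in>height_lattice Q. g b) = (\<Sum>c\<in>B. \<Sum>n\<in>{n \<in> \<int>. n\<^sup>2 \<le> slack Q c}. g (c(0 := n)))"
proof -
  let ?ns = "\<lambda>c. {n \<in> \<int>. n\<^sup>2 \<le> slack Q c}"
  have lm: "(lam m)\<^sup>2 > 0" using lam[of m] by simp
  have fin_ns: "finite (?ns c)" for c by (rule finite_Ints_square_le)
  have slack: "n\<^sup>2 \<le> slack Q c \<longleftrightarrow> n\<^sup>2 / (lam m)\<^sup>2 + (\<Sum>k=1..m. (c k / semi_axis k)\<^sup>2) \<le> Q\<^sup>2" for n c
    using lm by (simp add: slack_def pos_divide_le_eq[symmetric] mult.commute[of "(lam m)\<^sup>2"] le_diff_eq)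
  have "(\<Sum>k=1..m. ((c(0 := n)) k / semi_axis k)\<^sup>2) = (\<Sum>k=1..m. (c k / semi_axis k)\<^sup>2)" for c n
    by (intro sum.cong) auto
  have ins: "{..m} = insert 0 {1..m}" by auto
  have fwd: "c(0 := n) \<in> height_lattice Q" if "c \<in> B" "n \<in> ?ns c" for c n
  proof -
    have "c(0 := n) \<in> (\<Pi>\<^sub>E k\<in>insert 0 {1..m}. \<int>)"
      using that by (intro PiE_fun_upd) (auto simp: B)
    then show ?thesis
      using that \<open>\<And>c n. (\<Sum>k=1..m. ((c(0 := n)) k / semi_axis k)\<^sup>2) = (\<Sum>k=1..m. (c k / semi_axis k)\<^sup>2)\<close>
      unfolding height_lattice_def ins mem_Collect_eq slack by simp
  qed
  have bwd: "restrict b {1..m} \<in> B" "b 0 \<in> ?ns (restrict b {1..m})" "(restrict b {1..m})(0 := b 0) = b"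
    if "b \<in> height_lattice Q" for b
  proof -
    have b: "b \<in> (\<Pi>\<^sub>E k\<in>{..m}. \<int>)"
      and le: "(b 0)\<^sup>2 / (lam m)\<^sup>2 + (\<Sum>k=1..m. (b k / semi_axis k)\<^sup>2) \<le> Q\<^sup>2"
      using that by (auto simp: height_lattice_def)
    have "(b 0)\<^sup>2 / (lam m)\<^sup>2 \<ge> 0" by simp
    then have "(\<Sum>k=1..m. (b k / semi_axis k)\<^sup>2) \<le> Q\<^sup>2" using le by linarith
    then show "restrict b {1..m} \<in> B" using b unfolding B by auto
    show "b 0 \<in> ?ns (restrict b {1..m})" using b le unfolding mem_Collect_eq slack by auto
    show "(restrict b {1..m})(0 := b 0) = b"
      using b by (auto simp: fun_eq_iff PiE_def extensional_def restrict_def)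
  qed
  have restr: "restrict (c(0 := n)) {1..m} = c" if "c \<in> B" for c n
    using that unfolding B by (auto simp: fun_eq_iff PiE_def extensional_def restrict_def)
  have "height_lattice Q \<subseteq> (\<lambda>(c, n). c(0 := n)) ` (Sigma B ?ns)"
  proof
    fix b assume b: "b \<in> height_lattice Q"
    have "(restrict b {1..m}, b 0) \<in> Sigma B ?ns"
      by (rule SigmaI) (rule bwd(1)[OF b], rule bwd(2)[OF b])
    moreover have "b = (\<lambda>(c, n). c(0 := n)) (restrict b {1..m}, b 0)"
      unfolding prod.case by (rule bwd(3)[OF b, symmetric])
    ultimately show "b \<in> (\<lambda>(c, n). c(0 := n)) ` (Sigma B ?ns)" by (rule image_eqI[rotated])
  qed
  then show "finite (height_lattice Q)"
    using B(2) fin_ns by (meson finite_SigmaI finite_imageI finite_subset)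
  have "(\<Sum>b\<in>height_lattice Q. g b) = (\<Sum>(c, n)\<in>Sigma B ?ns. g (c(0 := n)))"
    using fwd bwd restr
    by (intro sum.reindex_bij_witness[of _ "\<lambda>(c, n). c(0 := n)" "\<lambda>b. (restrict b {1..m}, b 0)"]) auto
  then show "(\<Sum>b\<in>height_lattice Q. g b) = (\<Sum>c\<in>B. \<Sum>n\<in>?ns c. g (c(0 := n)))"
    using B(2) fin_ns by (simp add: sum.Sigma)
qed

text \<open>For fixed \<open>c\<close> an angle is a root for exactly one middle coefficient n,
  namely \<open>cos_part c\<close> at that angle. Summing over n therefore counts the angles where
  \<open>cos_part c\<close> is an integer of admissible size.\<close>

lemma sum_trig_poly_roots_fibre:
  fixes Q c
  assumes \<beta>: "- pi \<le> \<beta>1" "\<beta>1 \<le> \<beta>2" "\<beta>2 \<le> pi"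
  defines "N \<equiv> \<lambda>b. if \<exists>k\<le>m. b k \<noteq> 0 then real (card {\<theta> \<in> {\<beta>1..\<beta>2}. trig_poly m b \<theta> = 0}) else 0"
    and "\<phi> \<equiv> \<lambda>x. if (cos_part c x)\<^sup>2 \<le> slack Q c then \<bar>cos_part_deriv c x\<bar> else 0"
  shows "\<phi> integrable_on {\<beta>1..\<beta>2} \<and>
    \<bar>(\<Sum>n\<in>{n \<in> \<int>. n\<^sup>2 \<le> slack Q c}. N (c(0 := n))) - integral {\<beta>1..\<beta>2} \<phi>\<bar> \<le> 3 * real (3 * (2 * m + 1)) + 2"
proof (cases "\<exists>k\<in>{1..m}. c k \<noteq> 0")
  case True
  then obtain k0 where k0: "k0 \<in> {1..m}" "c k0 \<noteq> 0" by blast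
  let ?A = "{x \<in> {\<beta>1..\<beta>2}. cos_part c x \<in> \<int> \<and> (cos_part c x)\<^sup>2 \<le> slack Q c}"
  obtain v where v: "(\<phi> has_integral v) {\<beta>1..\<beta>2}" "finite ?A" "\<bar>real (card ?A) - v\<bar> \<le> 3 * real (3 * (2 * m + 1)) + 2"
    using count_cos_part_integer_values[of k0 c \<beta>1 \<beta>2 "slack Q c", OF k0 \<beta>] unfolding \<phi>_def by blast
  have "N (c(0 := n)) = real (card {\<theta> \<in> {\<beta>1..\<beta>2}. cos_part c \<theta> = n})" for n
    using k0 unfolding N_def trig_poly_eq_0_iff by auto
  moreover have "{\<theta> \<in> {\<beta>1..\<beta>2}. cos_part c \<theta> = n} = {\<theta> \<in> ?A. cos_part c \<theta> = n}" if "n \<in> {n \<in> \<int>. n\<^sup>2 \<le> slack Q c}" for n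
    using that by auto
  ultimately have "(\<Sum>n\<in>{n \<in> \<int>. n\<^sup>2 \<le> slack Q c}. N (c(0 := n))) =
      real (\<Sum>n\<in>{n \<in> \<int>. n\<^sup>2 \<le> slack Q c}. card {\<theta> \<in> ?A. cos_part c \<theta> = n})"
    by simp
  also have "(\<Sum>n\<in>{n \<in> \<int>. n\<^sup>2 \<le> slack Q c}. card {\<theta> \<in> ?A. cos_part c \<theta> = n}) =
      (\<Sum>n\<in>cos_part c ` ?A. card {\<theta> \<in> ?A. cos_part c \<theta> = n})"
  proof (intro sum.mono_neutral_right finite_Ints_square_le ballI)
    fix n assume "n \<in> {n \<in> \<int>. n\<^sup>2 \<le> slack Q c} - cos_part c ` ?A"
    then have "{\<theta> \<in> ?A. cos_part c \<theta> = n} = {}" by auto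
    then show "card {\<theta> \<in> ?A. cos_part c \<theta> = n} = 0" by (simp only: card.empty)
  qed auto
  also have "\<dots> = card ?A"
    using sum.image_gen[OF v(2), of "\<lambda>_. 1 :: nat" "cos_part c"] by (simp only: card_eq_sum)
  finally have sum: "(\<Sum>n\<in>{n \<in> \<int>. n\<^sup>2 \<le> slack Q c}. N (c(0 := n))) = real (card ?A)" .
  have "\<phi> integrable_on {\<beta>1..\<beta>2}" using v(1) by blast
  then show ?thesis unfolding sum integral_unique[OF v(1)] using v(3) by blast
next
  case False
  then have z: "cos_part c \<theta> = 0" "cos_part_deriv c \<theta> = 0" for \<theta>
    by (auto simp: cos_part_def cos_part_deriv_def)
  \<comment> \<open>With c = 0 the polynomial is a constant: either zero, which \<open>N\<close>
    excludes, or without roots.\<close>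
  have "N (c(0 := n)) = 0" for n
  proof (cases "n = 0")
    case True
    then have "\<not> (\<exists>k\<le>m. (c(0 := n)) k \<noteq> 0)" using False by auto
    then show ?thesis unfolding N_def by (rule if_not_P)
  next
    case n: False
    then show ?thesis unfolding N_def trig_poly_eq_0_iff by (simp add: z)
  qed
  moreover have "\<phi> = (\<lambda>_. 0)" by (auto simp: \<phi>_def z fun_eq_iff)
  ultimately show ?thesis by (simp add: integrable_0)
qed

text \<open>Counting along fibres costs a bounded error for each of the O(Q^m) vectors
  \<open>c\<close> and leaves a finite sum of integrals. Under the integral sign, at each angle,
  stands a lattice sum over an ellipsoid, whose error is uniform in the angle.\<close>

lemma trig_poly_root_count_asymptotics:
  "\<exists>C\<ge>0. \<forall>Q \<beta>1 \<beta>2. Q \<ge> 1 \<and> - pi \<le> \<beta>1 \<and> \<beta>1 \<le> \<beta>2 \<and> \<beta>2 \<le> pi \<longrightarrow>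
     finite (height_lattice Q) \<and>
     \<bar>(\<Sum>b \<in> {b \<in> height_lattice Q. \<exists>k\<le>m. b k \<noteq> 0}. real (card {\<theta> \<in> {\<beta>1..\<beta>2}. trig_poly m b \<theta> = 0}))
       - density_constant * Q ^ (m + 1) * integral {\<beta>1..\<beta>2} (angle_density m lam)\<bar> \<le> C * Q ^ m"
proof -
  have lm: "lam m > 0" using lam by simp
  \<comment> \<open>Since |cos| and |sin| are at most 1, this bounds every weight at every
    angle.\<close>
  define M where "M = (\<Sum>k=1..m. 2 * semi_axis k / lam m + 2 * semi_axis k * real k)"
  have terms: "0 \<le> 2 * semi_axis k / lam m + 2 * semi_axis k * real k" for k
    using semi_axis_pos[of k] lm by (simp add: less_imp_le)
  have M: "M \<ge> 0" unfolding M_def using terms by (intro sum_nonneg) auto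
  have bounds: "\<bar>cos_weight \<theta> k\<bar> \<le> M \<and> \<bar>sin_weight \<theta> k\<bar> \<le> M" if k: "k \<in> {1..m}" for \<theta> k
  proof -
    have "2 * semi_axis k / lam m + 2 * semi_axis k * real k \<le> M"
      unfolding M_def using k terms by (intro member_le_sum) auto
    moreover have "\<bar>cos_weight \<theta> k\<bar> \<le> 2 * semi_axis k / lam m"
      using semi_axis_pos[of k] lm abs_cos_le_one[of "real k * \<theta>"]
      by (simp add: cos_weight_def abs_mult divide_right_mono mult_left_le)
    moreover have "\<bar>sin_weight \<theta> k\<bar> \<le> 2 * semi_axis k * real k"
      using semi_axis_pos[of k] abs_sin_le_one[of "real k * \<theta>"]
      by (simp add: sin_weight_def abs_mult mult_left_le)
    moreover have "0 \<le> 2 * semi_axis k / lam m" "0 \<le> 2 * semi_axis k * real k"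
      using semi_axis_pos[of k] lm by (auto simp: less_imp_le)
    ultimately show ?thesis by linarith
  qed
  obtain C1 where C1: "C1 \<ge> 0" and asym: "\<And>u w Q. (\<forall>k\<in>{1..m}. \<bar>u k\<bar> \<le> M \<and> \<bar>w k\<bar> \<le> M) \<and> Q \<ge> 1 \<Longrightarrow>
    finite {b \<in> (\<Pi>\<^sub>E i\<in>{1..m}. \<int>). ellipsoid_norm {1..m} semi_axis u b \<le> Q} \<and>
    real (card {b \<in> (\<Pi>\<^sub>E i\<in>{1..m}. \<int>). ellipsoid_norm {1..m} semi_axis u b \<le> Q}) \<le> C1 * Q ^ m \<and>
    \<bar>(\<Sum>b \<in> {b \<in> (\<Pi>\<^sub>E i\<in>{1..m}. \<int>). ellipsoid_norm {1..m} semi_axis u b \<le> Q}. \<bar>linear_form {1..m} semi_axis w b\<bar>)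
       - Q ^ (m + 1) * ellipsoid_abs_moment {1..m} semi_axis u w\<bar> \<le> C1 * Q ^ m"
    using lattice_sum_asymptotics[of "{1..m}" semi_axis M] m semi_axis_pos M by auto
  \<comment> \<open>The error of one fibre. In the final constant, K0 * C1 pays for all fibres, and
    2 pi C1 for the pointwise lattice error integrated over the arc.\<close>
  define K0 where "K0 = 3 * real (3 * (2 * m + 1)) + 2"
  have "K0 * C1 + 2 * pi * C1 \<ge> 0" using C1 by (simp add: K0_def)
  moreover have "finite (height_lattice Q) \<and>
     \<bar>(\<Sum>b \<in> {b \<in> height_lattice Q. \<exists>k\<le>m. b k \<noteq> 0}. real (card {\<theta> \<in> {\<beta>1..\<beta>2}. trig_poly m b \<theta> = 0}))
       - density_constant * Q ^ (m + 1) * integral {\<beta>1..\<beta>2} (angle_density m lam)\<bar> \<le> (K0 * C1 + 2 * pi * C1) * Q ^ m"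
    if Q: "Q \<ge> 1" and \<beta>: "- pi \<le> \<beta>1" "\<beta>1 \<le> \<beta>2" "\<beta>2 \<le> pi" for Q \<beta>1 \<beta>2
  proof -
    define B where "B = {c \<in> (\<Pi>\<^sub>E k\<in>{1..m}. \<int>). (\<Sum>k=1..m. (c k / semi_axis k)\<^sup>2) \<le> Q\<^sup>2}"
    have B_eq: "B = {c \<in> (\<Pi>\<^sub>E k\<in>{1..m}. \<int>). ellipsoid_norm {1..m} semi_axis (\<lambda>_. 0) c \<le> Q}"
      unfolding B_def ellipsoid_norm_def using Q by (auto simp: real_sqrt_le_iff' sum_nonneg)
    have B: "finite B" "real (card B) \<le> C1 * Q ^ m"
      unfolding B_eq using asym[of "\<lambda>_. 0" "\<lambda>_. 0" Q] M Q by auto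
    define N where "N = (\<lambda>b. if \<exists>k\<le>m. b k \<noteq> 0 then real (card {\<theta> \<in> {\<beta>1..\<beta>2}. trig_poly m b \<theta> = 0}) else 0)"
    define \<phi> where "\<phi> = (\<lambda>c x. if (cos_part c x)\<^sup>2 \<le> slack Q c then \<bar>cos_part_deriv c x\<bar> else 0)"
    define F where "F = (\<Sum>b \<in> {b \<in> height_lattice Q. \<exists>k\<le>m. b k \<noteq> 0}. real (card {\<theta> \<in> {\<beta>1..\<beta>2}. trig_poly m b \<theta> = 0}))"
    have fin: "finite (height_lattice Q)" by (rule sum_height_lattice_fibres(1)[OF B_def B(1)])
    have F: "F = (\<Sum>c\<in>B. \<Sum>n\<in>{n \<in> \<int>. n\<^sup>2 \<le> slack Q c}. N (c(0 := n)))"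
    proof -
      have "F = (\<Sum>b\<in>height_lattice Q. N b)"
        unfolding F_def N_def using fin by (simp only: sum.inter_filter)
      then show ?thesis unfolding sum_height_lattice_fibres(2)[OF B_def B(1)] .
    qed
    have int: "\<phi> c integrable_on {\<beta>1..\<beta>2}" and
      fibre: "\<bar>(\<Sum>n\<in>{n \<in> \<int>. n\<^sup>2 \<le> slack Q c}. N (c(0 := n))) - integral {\<beta>1..\<beta>2} (\<phi> c)\<bar> \<le> K0" for c
      using sum_trig_poly_roots_fibre[OF \<beta>, of c Q] unfolding N_def \<phi>_def K0_def by blast+
    have "\<bar>F - (\<Sum>c\<in>B. integral {\<beta>1..\<beta>2} (\<phi> c))\<bar> \<le> (\<Sum>c\<in>B. K0)"
      unfolding F sum_subtractf[symmetric] using fibre by (intro order.trans[OF sum_abs] sum_mono)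
    also have "\<dots> \<le> K0 * C1 * Q ^ m"
      using mult_left_mono[OF B(2), of K0] by (simp add: K0_def mult_ac)
    finally have 1: "\<bar>F - (\<Sum>c\<in>B. integral {\<beta>1..\<beta>2} (\<phi> c))\<bar> \<le> K0 * C1 * Q ^ m" .
    define T where "T = (\<lambda>x. \<Sum>c\<in>B. \<phi> c x)"
    have T: "(\<Sum>c\<in>B. integral {\<beta>1..\<beta>2} (\<phi> c)) = integral {\<beta>1..\<beta>2} T" "T integrable_on {\<beta>1..\<beta>2}"
      unfolding T_def using B(1) int by (auto simp: integral_sum intro: integrable_sum)
    \<comment> \<open>At a fixed angle the surviving \<open>c\<close> are exactly the lattice points
      of the ellipsoid at that angle. It is contained in the one with zero \<open>u\<close>, over
      which \<open>B\<close> ranges.\<close>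
    have T_le: "\<bar>T x - density_constant * Q ^ (m + 1) * angle_density m lam x\<bar> \<le> C1 * Q ^ m" for x
    proof -
      let ?S = "{c \<in> (\<Pi>\<^sub>E i\<in>{1..m}. \<int>). ellipsoid_norm {1..m} semi_axis (cos_weight x) c \<le> Q}"
      have "T x = (\<Sum>c\<in>B. if ellipsoid_norm {1..m} semi_axis (cos_weight x) c \<le> Q then \<bar>linear_form {1..m} semi_axis (sin_weight x) c\<bar> else 0)"
        unfolding T_def \<phi>_def using Q by (simp only: ellipsoid_norm_le_iff[OF order.trans[OF zero_le_one Q]] linear_form_sin_weight)
      also have "\<dots> = (\<Sum>c\<in>{c \<in> B. ellipsoid_norm {1..m} semi_axis (cos_weight x) c \<le> Q}. \<bar>linear_form {1..m} semi_axis (sin_weight x) c\<bar>)"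
        by (rule sum.inter_filter[OF B(1), symmetric])
      also have "{c \<in> B. ellipsoid_norm {1..m} semi_axis (cos_weight x) c \<le> Q} = ?S"
      proof -
        have "ellipsoid_norm {1..m} semi_axis (\<lambda>_. 0) c \<le> ellipsoid_norm {1..m} semi_axis (cos_weight x) c" for c
          by (simp add: ellipsoid_norm_def)
        then show ?thesis unfolding B_eq by (auto intro: order.trans)
      qed
      finally have "T x = (\<Sum>c\<in>?S. \<bar>linear_form {1..m} semi_axis (sin_weight x) c\<bar>)" .
      moreover have "\<bar>(\<Sum>c\<in>?S. \<bar>linear_form {1..m} semi_axis (sin_weight x) c\<bar>)
          - Q ^ (m + 1) * ellipsoid_abs_moment {1..m} semi_axis (cos_weight x) (sin_weight x)\<bar> \<le> C1 * Q ^ m"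
        using asym[of "cos_weight x" "sin_weight x" Q] bounds Q by blast
      ultimately show ?thesis unfolding ellipsoid_abs_moment_eq_density by (simp only: mult_ac)
    qed
    have p: "angle_density m lam integrable_on {\<beta>1..\<beta>2}"
      by (intro integrable_continuous_real continuous_angle_density)
    have "((\<lambda>x. T x - density_constant * Q ^ (m + 1) * angle_density m lam x) has_integral
        (integral {\<beta>1..\<beta>2} T - density_constant * Q ^ (m + 1) * integral {\<beta>1..\<beta>2} (angle_density m lam))) {\<beta>1..\<beta>2}"
      using T(2) p by (intro has_integral_diff has_integral_mult_right integrable_integral)
    then have "norm (integral {\<beta>1..\<beta>2} T - density_constant * Q ^ (m + 1) * integral {\<beta>1..\<beta>2} (angle_density m lam))
        \<le> C1 * Q ^ m * measure lborel {\<beta>1..\<beta>2}"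
      by (rule has_integral_bound_real[rotated 2, where S = "{}"]) (use T_le C1 Q in auto)
    also have "\<dots> \<le> C1 * Q ^ m * (2 * pi)"
      using C1 Q \<beta> by (intro mult_left_mono) auto
    finally have 2: "\<bar>integral {\<beta>1..\<beta>2} T - density_constant * Q ^ (m + 1) * integral {\<beta>1..\<beta>2} (angle_density m lam)\<bar>
        \<le> 2 * pi * C1 * Q ^ m" by (simp only: real_norm_def mult_ac)
    show ?thesis using fin 1 2 unfolding T(1) F_def[symmetric] by (simp add: distrib_right)
  qed
  ultimately show ?thesis by blast
qed

end

section \<open>Minimal polynomials of numbers on the unit circle\<close>

abbreviation ipoly :: "int poly \<Rightarrow> 'a :: comm_ring_1 \<Rightarrow> 'a" where
  "ipoly P x \<equiv> poly (map_poly of_int P) x"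

lemma of_int_poly_mult: "(map_poly of_int (p * q) :: 'a :: comm_ring_1 poly) = map_poly of_int p * map_poly of_int q"
  by (rule poly_eqI) (simp add: coeff_map_poly coeff_mult)

lemma of_int_poly_add: "(map_poly of_int (p + q) :: 'a :: comm_ring_1 poly) = map_poly of_int p + map_poly of_int q"
  by (rule poly_eqI) (simp add: coeff_map_poly)

lemma of_int_poly_smult: "(map_poly of_int (smult c p) :: 'a :: comm_ring_1 poly) = smult (of_int c) (map_poly of_int p)"
  by (rule poly_eqI) (simp add: coeff_map_poly)

lemma of_int_poly_uminus: "(map_poly of_int (- p) :: 'a :: comm_ring_1 poly) = - map_poly of_int p"
  by (rule poly_eqI) (simp add: coeff_map_poly)

lemma degree_of_int_poly [simp]: "degree (map_poly of_int p :: 'a :: {comm_ring_1, ring_char_0} poly) = degree p"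
  by (rule degree_map_poly) simp

lemma of_int_poly_eq_0_iff [simp]: "(map_poly of_int p :: 'a :: {comm_ring_1, ring_char_0} poly) = 0 \<longleftrightarrow> p = 0"
  by (auto simp: poly_eq_iff coeff_map_poly)

lemma of_int_poly_inj:
  assumes "(map_poly of_int p :: 'a :: {comm_ring_1, ring_char_0} poly) = map_poly of_int q"
  shows "p = q"
proof (rule poly_eqI)
  fix k
  have "(of_int (coeff p k) :: 'a) = of_int (coeff q k)"
    using arg_cong[OF assms, of "\<lambda>p. coeff p k"] by (simp add: coeff_map_poly)
  then show "coeff p k = coeff q k" by simp
qed

lemma clear_denominators:
  fixes f :: "rat poly"
  shows "\<exists>c F. c \<noteq> (0 :: int) \<and> map_poly of_int F = smult (of_int c) f"
proof (induction f)
  case 0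
  show ?case by (intro exI[of _ 1] exI[of _ 0]) simp
next
  case (pCons a f)
  then obtain c F where cF: "c \<noteq> 0" "map_poly of_int F = smult (of_int c) f" by blast
  obtain x y where xy: "a = of_int x / of_int y" "y \<noteq> 0"
    by (metis quotient_of_div quotient_of_denom_pos surj_pair less_irrefl)
  have "map_poly of_int (pCons (c * x) (smult y F)) = smult (of_int (c * y)) (pCons a f)"
    using cF xy by (simp add: map_poly_pCons of_int_poly_smult mult_ac)
  then show ?case using cF xy by (intro exI[of _ "c * y"] exI[of _ "pCons (c * x) (smult y F)"]) auto
qed

text \<open>Gauss: contents multiply, so \<open>a\<close> divides the content of \<open>q\<close>
  and can be cancelled. This removes the scalar introduced by pseudo-division.\<close>

lemma dvd_of_smult_eq_mult:
  fixes A P q :: "int poly"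
  assumes "a \<noteq> 0" "Polynomial.content A = 1" "smult a P = A * q"
  shows "A dvd P"
proof -
  have "normalize a * Polynomial.content P = Polynomial.content q"
    using arg_cong[OF assms(3), of Polynomial.content] assms(2) by (simp add: content_mult)
  then have "a dvd Polynomial.content q" by (metis dvd_triv_left normalize_dvd_iff)
  then have "[:a:] dvd q" by (simp add: const_poly_dvd_iff_dvd_content)
  then obtain q' where "q = smult a q'" by (metis dvdE mult.commute mult_smult_right smult_one mult_pCons_left pCons_0_0 add_0_right mult_zero_left smult_conv_map_poly)
  then have "smult a P = smult a (A * q')" using assms(3) by simp
  then have "P = A * q'" using assms(1) by (simp add: smult_cancel)
  then show ?thesis by simp
qed

text \<open>Take the primitive part, with the right sign, of a nonzero integer polynomial of least
  degree vanishing at \<alpha>. A pseudo-remainder vanishes at \<alpha> and has smaller degree, so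
  it is 0; this gives divisibility. For irreducibility, rational factors are cleared of
  denominators.\<close>

lemma exists_minimal_int_poly:
  fixes \<alpha> :: complex
  assumes "algebraic \<alpha>"
  shows "\<exists>A. prime_int_poly A \<and> ipoly A \<alpha> = 0 \<and> (\<forall>P. ipoly P \<alpha> = 0 \<longrightarrow> A dvd P)"
proof -
  define n where "n = (LEAST n. \<exists>P. P \<noteq> 0 \<and> ipoly P \<alpha> = 0 \<and> degree P = n)"
  have ex: "\<exists>n. \<exists>P. P \<noteq> 0 \<and> ipoly P \<alpha> = 0 \<and> degree P = n"
    using assms by (auto elim: algebraicE')
  obtain A0 where A0: "A0 \<noteq> 0" "ipoly A0 \<alpha> = 0" "degree A0 = n"
    using LeastI_ex[OF ex] unfolding n_def by blast
  have minimal: "n \<le> degree P" if "P \<noteq> 0" "ipoly P \<alpha> = 0" for P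
    unfolding n_def using that by (intro Least_le) blast
  define A where "A = (if lead_coeff (primitive_part A0) > 0 then primitive_part A0 else - primitive_part A0)"
  have "ipoly A0 \<alpha> = of_int (Polynomial.content A0) * ipoly (primitive_part A0) \<alpha>"
    by (metis content_times_primitive_part of_int_poly_smult poly_smult)
  then have "ipoly (primitive_part A0) \<alpha> = 0" using A0 by simp
  then have root: "ipoly A \<alpha> = 0" by (auto simp: A_def of_int_poly_uminus)
  have "content (- p) = content p" for p :: "int poly"
    using content_smult[of "-1" p] by simp
  then have content: "Polynomial.content A = 1" using A0 by (simp add: A_def)
  have nz: "primitive_part A0 \<noteq> 0" using A0 by simp
  have lead: "lead_coeff A > 0"
    using nz by (auto simp: A_def not_less order_less_le)
  have deg: "degree A = n" using A0 by (simp add: A_def)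
  have A_nz: "A \<noteq> 0" using nz by (auto simp: A_def)
  have dvd: "A dvd P" if P: "ipoly P \<alpha> = 0" for P
  proof -
    obtain a q where aq: "a \<noteq> 0" "smult a P = A * q + pseudo_mod P A"
      and r: "pseudo_mod P A = 0 \<or> degree (pseudo_mod P A) < degree A"
      using pseudo_mod[OF A_nz, of P] by blast
    have "ipoly (smult a P) \<alpha> = ipoly (A * q + pseudo_mod P A) \<alpha>" using aq(2) by simp
    then have "ipoly (pseudo_mod P A) \<alpha> = 0"
      by (simp add: of_int_poly_smult of_int_poly_add of_int_poly_mult P root)
    then have "pseudo_mod P A = 0" using r minimal[of "pseudo_mod P A"] deg by (meson not_le)
    then show ?thesis using aq content by (intro dvd_of_smult_eq_mult[of a]) auto
  qed
  have "n > 0"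
  proof (rule Nat.gr0I)
    assume "n = 0"
    then obtain c where "A = [:c:]" using deg by (auto elim: degree_eq_zeroE)
    then show False using root A_nz by (simp add: map_poly_pCons)
  qed
  \<comment> \<open>A factor vanishing at \<alpha> has full degree by minimality, so its cofactor is
    constant.\<close>
  have unit: "is_unit g" if fg: "map_poly of_int A = f * g" and F: "c \<noteq> 0" "map_poly of_int F = smult (of_int c) f" "ipoly F \<alpha> = 0"
    for f g :: "rat poly" and F c
  proof -
    have nz: "f \<noteq> 0" "g \<noteq> 0" using fg A_nz by (metis mult_zero_left mult_zero_right of_int_poly_eq_0_iff)+
    then have "F \<noteq> 0" using F(1,2) by (metis of_int_0_eq_iff of_int_poly_eq_0_iff smult_eq_0_iff)
    then have "n \<le> degree F" using F by (intro minimal)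
    also have "degree F = degree f" using F(1,2) by (metis degree_of_int_poly degree_smult_eq of_int_0_eq_iff)
    finally have "degree g = 0"
      using arg_cong[OF fg, of degree] nz deg by (simp add: degree_mult_eq)
    then show ?thesis using nz by (simp add: is_unit_iff_degree)
  qed
  have "irreducible (map_poly of_int A :: rat poly)"
  proof (rule irreducibleI)
    show "map_poly of_int A \<noteq> (0 :: rat poly)" using A_nz by simp
    then show "\<not> is_unit (map_poly of_int A :: rat poly)" using deg \<open>n > 0\<close> by (simp add: is_unit_iff_degree)
    fix f g :: "rat poly" assume fg: "map_poly of_int A = f * g"
    obtain c F where cF: "c \<noteq> 0" "map_poly of_int F = smult (of_int c) f" using clear_denominators by blast
    obtain d G where dG: "d \<noteq> 0" "map_poly of_int G = smult (of_int d) g" using clear_denominators by blast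
    have "(map_poly of_int (F * G) :: rat poly) = map_poly of_int (smult (c * d) A)"
      by (simp add: of_int_poly_mult of_int_poly_smult cF dG fg mult_ac)
    then have "F * G = smult (c * d) A"
      by (rule of_int_poly_inj)
    then have "ipoly (F * G) \<alpha> = 0" by (simp add: of_int_poly_smult root)
    then have "ipoly F \<alpha> = 0 \<or> ipoly G \<alpha> = 0" by (simp add: of_int_poly_mult)
    then show "is_unit f \<or> is_unit g"
      using unit[OF fg cF] unit[of g f, OF _ dG] fg by (metis mult.commute)
  qed
  then have "prime_int_poly A" using content lead by (simp add: prime_int_poly_def)
  then show ?thesis using root dvd by blast
qed

lemma prime_int_poly_nonzero: "prime_int_poly P \<Longrightarrow> P \<noteq> 0"
  by (auto simp: prime_int_poly_def)

lemma prime_int_poly_dvd_imp_eq: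
  assumes P: "prime_int_poly P" and A: "prime_int_poly A" and dvd: "A dvd P"
  shows "P = A"
proof -
  obtain q where q: "P = A * q" using dvd by (auto elim: dvdE)
  have "irreducible (map_poly of_int P :: rat poly)" using P by (simp add: prime_int_poly_def)
  moreover have "(map_poly of_int P :: rat poly) = map_poly of_int A * map_poly of_int q"
    by (simp add: q of_int_poly_mult)
  moreover have "\<not> is_unit (map_poly of_int A :: rat poly)"
    using A by (auto simp: prime_int_poly_def irreducible_not_unit)
  ultimately have "is_unit (map_poly of_int q :: rat poly)" using irreducibleD by blast
  moreover have "q \<noteq> 0" using q prime_int_poly_nonzero[OF P] by auto
  ultimately have "degree q = 0" by (simp add: is_unit_iff_degree)
  then obtain c where c: "q = [:c:]" by (auto elim: degree_eq_zeroE)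
  then have Pc: "P = smult c A" by (simp add: q)
  have "\<bar>c\<bar> = 1" using P A content_smult[of c A] by (simp add: Pc prime_int_poly_def)
  moreover have "c * lead_coeff A > 0" "lead_coeff A > 0" using P A by (auto simp: Pc prime_int_poly_def split: if_splits)
  ultimately have "c = 1" by (auto simp: abs_if zero_less_mult_iff split: if_splits)
  then show ?thesis by (simp add: Pc)
qed

lemma algebraic_of_ipoly_root:
  assumes "P \<noteq> 0" "ipoly P (\<alpha> :: complex) = 0"
  shows "algebraic \<alpha>"
  by (rule algebraicI[of "map_poly of_int P"]) (use assms in \<open>auto simp: coeff_map_poly\<close>)

lemma prime_int_poly_dvd:
  assumes P: "prime_int_poly P" "ipoly P (\<alpha> :: complex) = 0" and R: "ipoly R \<alpha> = 0"
  shows "P dvd R"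
proof -
  have "algebraic \<alpha>" using P prime_int_poly_nonzero algebraic_of_ipoly_root by blast
  then obtain A where "prime_int_poly A" "\<And>P. ipoly P \<alpha> = 0 \<Longrightarrow> A dvd P"
    using exists_minimal_int_poly by blast
  then show ?thesis using prime_int_poly_dvd_imp_eq P R by metis
qed

lemma prime_int_poly_unique:
  assumes "prime_int_poly P" "ipoly P (\<alpha> :: complex) = 0" "prime_int_poly R" "ipoly R \<alpha> = 0"
  shows "P = R"
  using assms prime_int_poly_dvd prime_int_poly_dvd_imp_eq by blast

lemma min_int_poly_eq:
  assumes "prime_int_poly P" "ipoly P (\<alpha> :: complex) = 0"
  shows "min_int_poly \<alpha> = P"
  unfolding min_int_poly_def using assms prime_int_poly_unique by (intro the_equality) blast+

lemma prime_int_poly_linear: "prime_int_poly [:c, 1:]"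
proof -
  have "irreducible (map_poly of_int [:c, 1:] :: rat poly)"
    by (simp add: map_poly_pCons irreducible_linear_field_poly)
  moreover have "Polynomial.content [:c, 1:] = 1"
    by (metis coeff_pCons_0 coeff_pCons_Suc content_dvd_coeff is_unit_content_iff)
  ultimately show ?thesis by (simp add: prime_int_poly_def)
qed

section \<open>Self-reciprocity of minimal polynomials on the unit circle\<close>

lemma of_int_poly_reflect: "(map_poly of_int (reflect_poly P) :: 'a :: {comm_ring_1, ring_char_0} poly) = reflect_poly (map_poly of_int P)"
  by (rule poly_eqI) (simp add: coeff_map_poly coeff_reflect_poly)

lemma ipoly_reflect:
  fixes x :: "'a :: field_char_0"
  shows "x \<noteq> 0 \<Longrightarrow> ipoly (reflect_poly P) x = x ^ degree P * ipoly P (inverse x)"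
  by (simp add: of_int_poly_reflect poly_reflect_poly_nz)

lemma ipoly_cis_inverse: "ipoly P (inverse (cis \<theta>)) = cnj (ipoly P (cis \<theta>))"
  by (subst poly_cnj_real) (auto simp: coeff_map_poly cis_cnj)

text \<open>On the circle the inverse is the conjugate, which is again a root of P. So P divides its
  reflection, and by degrees the reflection is c P with c^2 = 1. If c = -1, then P vanishes at 1 and
  must be X - 1.\<close>

lemma prime_int_poly_reflect:
  assumes P: "prime_int_poly P" and root: "ipoly P (cis \<theta>) = 0" and "cis \<theta> \<noteq> 1"
  shows "reflect_poly P = P"
proof -
  have P0: "P \<noteq> 0" using prime_int_poly_nonzero[OF P] .
  have "ipoly (reflect_poly P) (cis \<theta>) = 0"
    by (simp add: ipoly_reflect ipoly_cis_inverse root del: cis_inverse)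
  then have "P dvd reflect_poly P" using prime_int_poly_dvd[OF P root] by blast
  then obtain q where q: "reflect_poly P = P * q" by (auto elim: dvdE)
  have q0: "q \<noteq> 0" using q P0 by (metis mult_zero_right reflect_poly_eq_0_iff)
  have "degree P + degree q \<le> degree P"
    using degree_reflect_poly_le[of P] unfolding q degree_mult_eq[OF P0 q0] .
  then obtain c where "q = [:c:]" by (auto elim: degree_eq_zeroE)
  then have c: "reflect_poly P = smult c P" using q by simp
  \<comment> \<open>Reflection is an involution only on polynomials with nonzero constant
    term.\<close>
  have "coeff P 0 \<noteq> 0"
    using arg_cong[OF c, of "\<lambda>p. coeff p 0"] P0 by auto
  then have "P = reflect_poly (reflect_poly P)" by simp
  also have "\<dots> = smult (c * c) P" by (simp add: c reflect_poly_smult)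
  finally have "lead_coeff P = c * c * lead_coeff P" by (metis coeff_smult)
  then have "c * c = 1" using P0 by simp
  then have "c = 1 \<or> c = -1" by (simp add: zmult_eq_1_iff)
  moreover have False if "c = -1"
  proof -
    have "ipoly (reflect_poly P) (1 :: complex) = ipoly P 1" by (simp add: ipoly_reflect)
    moreover have "ipoly (reflect_poly P) (1 :: complex) = - ipoly P 1"
      by (simp add: c that of_int_poly_uminus)
    ultimately have "ipoly P (1 :: complex) = 0" by simp
    then have "P = [:-1, 1:]"
      by (intro prime_int_poly_unique[OF P _ prime_int_poly_linear, of 1]) (auto simp: map_poly_pCons)
    then show False using root assms(3) by (simp add: map_poly_pCons)
  qed
  ultimately show ?thesis using c by auto
qed

text \<open>A self-reciprocal polynomial of odd degree vanishes at -1, which forces P = X +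
  1.\<close>

lemma prime_int_poly_even_degree:
  assumes P: "prime_int_poly P" and root: "ipoly P (cis \<theta>) = 0" and "cis \<theta> \<noteq> 1" "cis \<theta> \<noteq> -1"
  shows "even (degree P)"
proof (rule ccontr)
  assume odd: "odd (degree P)"
  have "ipoly P (-1 :: complex) = ipoly (reflect_poly P) (-1)"
    using prime_int_poly_reflect[OF assms(1-3)] by simp
  also have "\<dots> = - ipoly P (-1)" using odd by (simp add: ipoly_reflect)
  finally have "ipoly P (-1 :: complex) = 0" by simp
  then have "P = [:1, 1:]"
    by (intro prime_int_poly_unique[OF P _ prime_int_poly_linear, of "-1"]) (auto simp: map_poly_pCons)
  then show False using root assms(4) by (simp add: map_poly_pCons add_eq_0_iff)
qed

text \<open>A primitive self-reciprocal polynomial with a root \<open>e\<^sup>i\<^sup>\<theta> \<noteq> \<plusminus>1\<close> is divisible by the minimal polynomial of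
  that root, which is self-reciprocal of even degree, and so is the cofactor.\<close>

lemma nonprime_palindromic_factors:
  assumes refl: "reflect_poly P = P" and even: "even (degree P)" and content: "Polynomial.content P = 1"
    and lead: "lead_coeff P > 0" and np: "\<not> prime_int_poly P"
    and root: "ipoly P (cis \<theta>) = 0" "cis \<theta> \<noteq> 1" "cis \<theta> \<noteq> -1"
  shows "\<exists>A B. P = A * B \<and> reflect_poly A = A \<and> reflect_poly B = B \<and> even (degree A) \<and> even (degree B) \<and>
    degree A > 0 \<and> degree B > 0"
proof -
  have P0: "P \<noteq> 0" using lead by auto
  obtain A where A: "prime_int_poly A" "ipoly A (cis \<theta>) = 0" "A dvd P"
    using exists_minimal_int_poly algebraic_of_ipoly_root[OF P0 root(1)] root by blast
  obtain B where B: "P = A * B" using A(3) by (auto elim: dvdE)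
  have nz: "A \<noteq> 0" "B \<noteq> 0" using B P0 by auto
  have rA: "reflect_poly A = A" using prime_int_poly_reflect[OF A(1,2)] root by blast
  have eA: "even (degree A)" using prime_int_poly_even_degree[OF A(1,2)] root by blast
  have "A * reflect_poly B = A * B"
    using refl unfolding B reflect_poly_mult rA .
  then have rB: "reflect_poly B = B" using nz by simp
  have deg: "degree P = degree A + degree B" using nz by (simp add: B degree_mult_eq)
  then have eB: "even (degree B)" using even eA by simp
  have dA: "degree A > 0"
  proof (rule Nat.gr0I)
    assume "degree A = 0"
    then obtain c where "A = [:c:]" by (auto elim: degree_eq_zeroE)
    then show False using A(2) nz by (simp add: map_poly_pCons)
  qed
  \<comment> \<open>A constant cofactor must be 1, by content and sign, and then P would be the
    prime polynomial A.\<close>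
  have dB: "degree B > 0"
  proof (rule Nat.gr0I)
    assume "degree B = 0"
    then obtain c where c: "B = [:c:]" by (auto elim: degree_eq_zeroE)
    then have Pc: "P = smult c A" by (simp add: B)
    have "\<bar>c\<bar> = 1" using content A(1) by (simp add: Pc prime_int_poly_def)
    moreover have "c * lead_coeff A > 0" "lead_coeff A > 0" using lead A(1) by (auto simp: Pc prime_int_poly_def split: if_splits)
    ultimately have "c = 1" by (auto simp: abs_if zero_less_mult_iff split: if_splits)
    then show False using np A(1) by (simp add: Pc)
  qed
  show ?thesis using B rA rB eA eB dA dB by blast
qed

section \<open>Products of self-reciprocal polynomials\<close>

definition poly_height :: "complex poly \<Rightarrow> real" where
  "poly_height p = (MAX k\<in>{..degree p}. norm (coeff p k))"

lemma norm_coeff_le_poly_height: "norm (coeff p k) \<le> poly_height p"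
proof (cases "k \<le> degree p")
  case True
  then show ?thesis unfolding poly_height_def by (intro Max_ge) auto
next
  case False
  have "0 \<le> norm (coeff p 0)" by simp
  also have "\<dots> \<le> poly_height p" unfolding poly_height_def by (intro Max_ge) auto
  finally show ?thesis using False by (simp add: coeff_eq_0)
qed

lemma poly_height_nonneg: "0 \<le> poly_height p"
  using norm_coeff_le_poly_height[of p 0] norm_ge_zero order_trans by blast

lemma poly_height_leI: "(\<And>k. norm (coeff p k) \<le> M) \<Longrightarrow> poly_height p \<le> M"
  unfolding poly_height_def by (subst Max_le_iff) auto

lemma poly_height_linear_mult_le:
  "poly_height ([:- \<alpha>, 1:] * B) \<le> 2 * max 1 (norm \<alpha>) * poly_height B"
proof (rule poly_height_leI)
  fix k
  have "norm (coeff ([:- \<alpha>, 1:] * B) k) \<le> norm (coeff (pCons 0 B) k) + norm \<alpha> * norm (coeff B k)"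
    using norm_triangle_ineq4[of "coeff (pCons 0 B) k" "\<alpha> * coeff B k"] by (simp add: norm_mult add.commute)
  moreover have "norm (coeff (pCons 0 B) k) \<le> poly_height B"
    by (cases k) (auto simp: norm_coeff_le_poly_height poly_height_nonneg)
  moreover have "norm \<alpha> * norm (coeff B k) \<le> max 1 (norm \<alpha>) * poly_height B"
    by (intro mult_mono norm_coeff_le_poly_height) auto
  moreover have "poly_height B \<le> max 1 (norm \<alpha>) * poly_height B"
    using mult_right_mono[of 1 "max 1 (norm \<alpha>)" "poly_height B"] poly_height_nonneg[of B] by simp
  ultimately show "norm (coeff ([:- \<alpha>, 1:] * B) k) \<le> 2 * max 1 (norm \<alpha>) * poly_height B" by linarith
qed

text \<open>The coefficients of \<open>B\<close> are recovered from those of \<open>(z - \<alpha>) B\<close> recursively, from below if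
  \<open>\<bar>\<alpha>\<bar> \<ge> 1\<close> and from above otherwise.\<close>

lemma poly_height_le_linear_mult:
  assumes "degree B \<le> n"
  shows "max 1 (norm \<alpha>) * poly_height B \<le> real (n + 1) * poly_height ([:- \<alpha>, 1:] * B)"
proof -
  let ?D = "[:- \<alpha>, 1:] * B"
  let ?M = "poly_height ?D"
  have M0: "?M \<ge> 0" by (rule poly_height_nonneg)
  have D0: "coeff ?D 0 = - (\<alpha> * coeff B 0)" by simp
  have DS: "coeff ?D (Suc k) = coeff B k - \<alpha> * coeff B (Suc k)" for k by simp
  have out: "coeff B k = 0" if "k > n" for k using that assms by (simp add: coeff_eq_0)
  show ?thesis
  proof (cases "norm \<alpha> \<ge> 1")
    case True
    have ind: "norm \<alpha> * norm (coeff B k) \<le> real (k + 1) * ?M" for k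
    proof (induction k)
      case 0
      have "norm \<alpha> * norm (coeff B 0) = norm (coeff ?D 0)" unfolding D0 by (simp add: norm_mult)
      then show ?case using norm_coeff_le_poly_height[of ?D 0] by simp
    next
      case (Suc k)
      have "\<alpha> * coeff B (Suc k) = coeff B k - coeff ?D (Suc k)" unfolding DS by simp
      then have "norm \<alpha> * norm (coeff B (Suc k)) \<le> norm (coeff B k) + norm (coeff ?D (Suc k))"
        by (metis norm_mult norm_triangle_ineq4)
      also have "norm (coeff B k) \<le> norm \<alpha> * norm (coeff B k)"
        using mult_right_mono[OF True norm_ge_zero[of "coeff B k"]] by simp
      finally show ?case using Suc norm_coeff_le_poly_height[of ?D "Suc k"]
        by (simp add: distrib_right)
    qed
    have le: "norm \<alpha> * norm (coeff B k) \<le> real (n + 1) * ?M" for k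
    proof (cases "k \<le> n")
      case True
      have "real (k + 1) * ?M \<le> real (n + 1) * ?M" using True M0 by (intro mult_right_mono) auto
      then show ?thesis using ind[of k] by linarith
    qed (use out M0 in auto)
    have pos: "norm \<alpha> > 0" using True by linarith
    have "poly_height B \<le> real (n + 1) * ?M / norm \<alpha>"
      using le pos by (intro poly_height_leI) (simp add: pos_le_divide_eq mult.commute)
    then show ?thesis using True pos by (simp add: pos_le_divide_eq mult.commute max_absorb2)
  next
    case False
    have ind: "norm (coeff B (n - k)) \<le> real (k + 1) * ?M" if "k \<le> n" for k
      using that
    proof (induction k)
      case 0
      have "coeff ?D (Suc n) = coeff B n" unfolding DS using out by simp
      then have "norm (coeff B n) \<le> ?M" using norm_coeff_le_poly_height[of ?D "Suc n"] by metis
      then show ?case by simp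
    next
      case (Suc k)
      have e: "n - k = Suc (n - Suc k)" using Suc.prems by simp
      have "coeff B (n - Suc k) = coeff ?D (n - k) + \<alpha> * coeff B (n - k)" unfolding e DS by simp
      then have "norm (coeff B (n - Suc k)) \<le> norm (coeff ?D (n - k)) + norm \<alpha> * norm (coeff B (n - k))"
        by (metis norm_mult norm_triangle_ineq)
      also have "norm \<alpha> * norm (coeff B (n - k)) \<le> 1 * norm (coeff B (n - k))"
        using False by (intro mult_right_mono) auto
      finally show ?case using Suc norm_coeff_le_poly_height[of ?D "n - k"]
        by (simp add: distrib_right)
    qed
    have "norm (coeff B k) \<le> real (n + 1) * ?M" for k
    proof (cases "k \<le> n")
      case True
      have "real (n - k + 1) * ?M \<le> real (n + 1) * ?M" using M0 by (intro mult_right_mono) auto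
      then show ?thesis using ind[of "n - k"] True by simp
    qed (use out M0 in auto)
    then have "poly_height B \<le> real (n + 1) * ?M" by (rule poly_height_leI)
    then show ?thesis using False by (simp add: max_absorb1)
  qed
qed

text \<open>Linear factors over the complex numbers are moved from A to B one at a time. Each
  changes the height of A and that of the product by max 1 |\<alpha>|, up to constants, so the
  unbounded factor cancels.\<close>

lemma poly_height_mult_ge:
  "\<exists>C\<ge>0. \<forall>A B. degree A = d \<and> degree B \<le> n \<longrightarrow> poly_height A * poly_height B \<le> C * poly_height (A * B)"
proof (induction d)
  case 0
  have "poly_height A * poly_height B \<le> 1 * poly_height (A * B)" if "degree A = 0" for A B
  proof -
    obtain c where A: "A = [:c:]" using \<open>degree A = 0\<close> by (auto elim: degree_eq_zeroE)
    have hA: "poly_height A = norm c" by (simp add: A poly_height_def)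
    show ?thesis
    proof (cases "c = 0")
      case True
      then show ?thesis unfolding hA by (simp add: poly_height_nonneg)
    next
      case False
      have "poly_height B \<le> poly_height (A * B) / norm c"
      proof (rule poly_height_leI)
        fix k
        have "norm c * norm (coeff B k) \<le> poly_height (A * B)"
          using norm_coeff_le_poly_height[of "A * B" k] by (simp add: A norm_mult)
        then show "norm (coeff B k) \<le> poly_height (A * B) / norm c"
          using False by (simp add: pos_le_divide_eq mult.commute)
      qed
      then show ?thesis using False unfolding hA by (simp add: pos_le_divide_eq mult.commute)
    qed
  qed
  then show ?case by (intro exI[of _ 1]) auto
next
  case (Suc d)
  then obtain C where C: "C \<ge> 0" "\<And>A B. degree A = d \<Longrightarrow> degree B \<le> n \<Longrightarrow> poly_height A * poly_height B \<le> C * poly_height (A * B)"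
    by blast
  have "poly_height A * poly_height B \<le> 2 * C * real (d + n + 1) * poly_height (A * B)" if "degree A = Suc d" "degree B \<le> n" for A B
  proof -
    have "\<not> constant (poly A)" using that(1) by (simp add: constant_degree)
    then obtain \<alpha> where "poly A \<alpha> = 0" using fundamental_theorem_of_algebra by blast
    then obtain A' where A: "A = [:- \<alpha>, 1:] * A'" by (auto simp: poly_eq_0_iff_dvd elim: dvdE)
    have A'0: "A' \<noteq> 0" using A that(1) by auto
    have dA: "degree A' = d"
      using that(1) A'0 unfolding A by (subst (asm) degree_mult_eq) auto
    have deg: "degree (A' * B) \<le> d + n" using degree_mult_le[of A' B] dA that(2) by linarith
    have "poly_height A * poly_height B \<le> 2 * max 1 (norm \<alpha>) * poly_height A' * poly_height B"
      unfolding A by (intro mult_right_mono poly_height_linear_mult_le poly_height_nonneg)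
    also have "\<dots> = 2 * max 1 (norm \<alpha>) * (poly_height A' * poly_height B)" by (simp only: mult.assoc)
    also have "\<dots> \<le> 2 * max 1 (norm \<alpha>) * (C * poly_height (A' * B))"
      using C(2)[OF dA that(2)] by (intro mult_left_mono) auto
    also have "\<dots> = 2 * C * (max 1 (norm \<alpha>) * poly_height (A' * B))" by simp
    also have "\<dots> \<le> 2 * C * (real (d + n + 1) * poly_height ([:- \<alpha>, 1:] * (A' * B)))"
      using C(1) poly_height_le_linear_mult[OF deg] by (intro mult_left_mono) auto
    also have "[:- \<alpha>, 1:] * (A' * B) = A * B" unfolding A by (simp only: mult.assoc)
    finally show ?thesis by (simp only: mult.assoc)
  qed
  moreover have "2 * C * real (d + n + 1) \<ge> 0" using C(1) by simp
  ultimately show ?case by blast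
qed

text \<open>A natural number, so that polynomials can be sorted by their exact height and bounds
  divided with \<open>div\<close>.\<close>

definition int_height :: "int poly \<Rightarrow> nat" where
  "int_height P = (MAX k\<in>{..degree P}. nat \<bar>coeff P k\<bar>)"

lemma abs_coeff_le_int_height: "\<bar>coeff P k\<bar> \<le> int (int_height P)"
proof (cases "k \<le> degree P")
  case True
  then have "nat \<bar>coeff P k\<bar> \<le> int_height P" unfolding int_height_def by (intro Max_ge) auto
  then show ?thesis by simp
qed (simp add: coeff_eq_0)

lemma int_height_leI: "(\<And>k. \<bar>coeff P k\<bar> \<le> int h) \<Longrightarrow> int_height P \<le> h"
  unfolding int_height_def by (subst Max_le_iff) (auto simp: nat_le_iff)

lemma poly_height_of_int: "poly_height (map_poly of_int P) = real (int_height P)"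
proof (rule antisym)
  show "poly_height (map_poly of_int P) \<le> real (int_height P)"
  proof (rule poly_height_leI)
    fix k
    have "real_of_int \<bar>coeff P k\<bar> \<le> real_of_int (int (int_height P))"
      using abs_coeff_le_int_height by (simp only: of_int_le_iff)
    then show "norm (coeff (map_poly complex_of_int P) k) \<le> real (int_height P)"
      by (simp add: coeff_map_poly)
  qed
  have "int_height P \<in> (\<lambda>k. nat \<bar>coeff P k\<bar>) ` {..degree P}"
    unfolding int_height_def by (intro Max_in) auto
  then obtain k where "int_height P = nat \<bar>coeff P k\<bar>" by auto
  then have "real (int_height P) = norm (coeff (map_poly complex_of_int P) k)"
    by (simp add: coeff_map_poly)
  then show "real (int_height P) \<le> poly_height (map_poly of_int P)"
    by (simp only: norm_coeff_le_poly_height)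
qed

lemma int_height_mult_ge:
  "\<exists>C\<ge>1. \<forall>A B :: int poly. degree A \<le> n \<and> degree B \<le> n \<longrightarrow> int_height A * int_height B \<le> C * int_height (A * B)"
proof -
  have "\<forall>d. \<exists>C\<ge>0. \<forall>A B. degree A = d \<and> degree B \<le> n \<longrightarrow> poly_height A * poly_height B \<le> C * poly_height (A * B)"
    using poly_height_mult_ge by blast
  then obtain c where c: "\<And>d. c d \<ge> 0"
    "\<And>d A B. degree A = d \<Longrightarrow> degree B \<le> n \<Longrightarrow> poly_height A * poly_height B \<le> c d * poly_height (A * B)"
    by metis
  define C where "C = Suc (nat \<lceil>\<Sum>d\<le>n. c d\<rceil>)"
  have "int_height A * int_height B \<le> C * int_height (A * B)" if "degree A \<le> n" "degree B \<le> n" for A B :: "int poly"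
  proof -
    have "c (degree A) \<le> (\<Sum>d\<le>n. c d)" using that c(1) by (intro member_le_sum) auto
    also have "\<dots> \<le> real C" unfolding C_def by linarith
    finally have cC: "c (degree A) \<le> real C" .
    have "real (int_height A) * real (int_height B) \<le> c (degree A) * real (int_height (A * B))"
      using c(2)[of "map_poly of_int A" "degree A" "map_poly of_int B"] that
      by (simp add: poly_height_of_int flip: of_int_poly_mult)
    also have "\<dots> \<le> real C * real (int_height (A * B))" using cC by (intro mult_right_mono) auto
    finally show ?thesis by (simp flip: of_nat_mult)
  qed
  moreover have "C \<ge> 1" by (simp add: C_def)
  ultimately show ?thesis by blast
qed

section \<open>Counting products of two self-reciprocal polynomials\<close>

definition self_reciprocal :: "nat \<Rightarrow> int poly set" where
  "self_reciprocal j = {A. reflect_poly A = A \<and> degree A = 2 * j}"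

definition int_box :: "nat \<Rightarrow> nat \<Rightarrow> (nat \<Rightarrow> int) set" where
  "int_box j h = (\<Pi>\<^sub>E k\<in>{..j}. {- int h..int h})"

lemma finite_int_box: "finite (int_box j h)"
  by (simp add: int_box_def finite_PiE)

lemma card_int_box: "card (int_box j h) = (2 * h + 1) ^ (j + 1)"
  by (simp add: int_box_def card_PiE nat_add_distrib nat_mult_distrib)

lemma self_reciprocal_coeff:
  assumes "A \<in> self_reciprocal j" "k \<le> 2 * j"
  shows "coeff A k = coeff A (2 * j - k)"
proof -
  have A: "reflect_poly A = A" "degree A = 2 * j" using assms(1) by (auto simp: self_reciprocal_def)
  show ?thesis using coeff_reflect_poly[of A k] assms(2) unfolding A by simp
qed

lemma inj_on_coeffs_self_reciprocal: "inj_on (\<lambda>A. restrict (coeff A) {..j}) (self_reciprocal j)"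
proof (rule inj_onI)
  fix A B assume A: "A \<in> self_reciprocal j" and B: "B \<in> self_reciprocal j"
    and eq: "restrict (coeff A) {..j} = restrict (coeff B) {..j}"
  have low: "coeff A k = coeff B k" if "k \<le> j" for k
    using fun_cong[OF eq, of k] that by simp
  show "A = B"
  proof (rule poly_eqI)
    fix k
    consider "k \<le> j" | "j < k" "k \<le> 2 * j" | "k > 2 * j" by linarith
    then show "coeff A k = coeff B k"
    proof cases
      case 2
      have "coeff A (2 * j - k) = coeff B (2 * j - k)" using 2 by (intro low) auto
      then show ?thesis using self_reciprocal_coeff[OF A 2(2)] self_reciprocal_coeff[OF B 2(2)] by simp
    next
      case 3
      then show ?thesis using A B by (simp add: self_reciprocal_def coeff_eq_0)
    qed (use low in auto)
  qed
qed

lemma card_self_reciprocal_height_le: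
  "finite {A \<in> self_reciprocal j. int_height A \<le> h}"
  "card {A \<in> self_reciprocal j. int_height A \<le> h} \<le> (2 * h + 1) ^ (j + 1)"
proof -
  let ?S = "{A \<in> self_reciprocal j. int_height A \<le> h}"
  have inj: "inj_on (\<lambda>A. restrict (coeff A) {..j}) ?S"
    by (rule inj_on_subset[OF inj_on_coeffs_self_reciprocal]) auto
  have sub: "(\<lambda>A. restrict (coeff A) {..j}) ` ?S \<subseteq> int_box j h"
  proof safe
    fix A assume "int_height A \<le> h"
    then have "\<bar>coeff A k\<bar> \<le> int h" for k
      using abs_coeff_le_int_height[of A k] by linarith
    then show "restrict (coeff A) {..j} \<in> int_box j h"
      by (auto simp: int_box_def abs_le_iff minus_le_iff)
  qed
  show "finite ?S" using finite_imageD[OF finite_subset[OF sub finite_int_box] inj] .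
  show "card ?S \<le> (2 * h + 1) ^ (j + 1)"
    using card_inj_on_le[OF inj sub finite_int_box] by (simp add: card_int_box)
qed

text \<open>The first j + 1 coefficients determine the polynomial and lie in the shell between two
  consecutive boxes. A shell is smaller than its box by one power of h.\<close>

lemma card_self_reciprocal_height_eq:
  assumes "h \<ge> 1"
  shows "real (card {A \<in> self_reciprocal j. int_height A = h}) \<le> 2 * real (j + 1) * real (2 * h + 1) ^ j"
proof -
  let ?S = "{A \<in> self_reciprocal j. int_height A = h}"
  have inj: "inj_on (\<lambda>A. restrict (coeff A) {..j}) ?S"
    by (rule inj_on_subset[OF inj_on_coeffs_self_reciprocal]) auto
  have box: "int_box j (h - 1) \<subseteq> int_box j h" unfolding int_box_def by (intro PiE_mono) auto
  have sub: "(\<lambda>A. restrict (coeff A) {..j}) ` ?S \<subseteq> int_box j h - int_box j (h - 1)"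
  proof safe
    fix A assume A: "A \<in> self_reciprocal j" and h: "h = int_height A"
    have "\<bar>coeff A k\<bar> \<le> int (int_height A)" for k by (rule abs_coeff_le_int_height)
    then show "restrict (coeff A) {..j} \<in> int_box j (int_height A)"
      by (auto simp: int_box_def abs_le_iff minus_le_iff)
    assume "restrict (coeff A) {..j} \<in> int_box j (int_height A - 1)"
    then have low: "\<bar>coeff A k\<bar> \<le> int (h - 1)" if "k \<le> j" for k
      using that PiE_mem[of "restrict (coeff A) {..j}" "{..j}" _ k] by (force simp: int_box_def h abs_le_iff)
    have "\<bar>coeff A k\<bar> \<le> int (h - 1)" for k
    proof -
      consider "k \<le> j" | "j < k" "k \<le> 2 * j" | "k > 2 * j" by linarith
      then show ?thesis
      proof cases
        case 2
        have "\<bar>coeff A (2 * j - k)\<bar> \<le> int (h - 1)" using 2 by (intro low) auto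
        then show ?thesis using self_reciprocal_coeff[OF A 2(2)] by simp
      next
        case 3
        then show ?thesis using A by (simp add: self_reciprocal_def coeff_eq_0)
      qed (use low in auto)
    qed
    then have "int_height A \<le> h - 1" by (rule int_height_leI)
    then show False using assms h by simp
  qed
  have "card ?S \<le> card (int_box j h - int_box j (h - 1))"
    using card_inj_on_le[OF inj sub] finite_int_box by blast
  also have "\<dots> = card (int_box j h) - card (int_box j (h - 1))"
    using box finite_int_box by (intro card_Diff_subset) auto
  finally have "real (card ?S) \<le> real (card (int_box j h)) - real (card (int_box j (h - 1)))"
    using card_mono[OF finite_int_box box] by linarith
  also have "\<dots> = real (2 * h + 1) ^ Suc j - real (2 * (h - 1) + 1) ^ Suc j"
    unfolding card_int_box of_nat_power Suc_eq_plus1 by (rule refl)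
  also have "\<dots> \<le> real (Suc j) * real (2 * h + 1) ^ j * (real (2 * h + 1) - real (2 * (h - 1) + 1))"
    by (rule power_diff_le) auto
  also have "real (2 * h + 1) - real (2 * (h - 1) + 1) = 2" using assms by (simp add: of_nat_diff)
  finally show ?thesis by (simp only: Suc_eq_plus1 mult_ac)
qed

lemma self_reciprocal_height_pos:
  assumes "A \<in> self_reciprocal j" "j \<ge> 1"
  shows "int_height A \<ge> 1"
proof -
  have "A \<noteq> 0" using assms by (auto simp: self_reciprocal_def)
  then have "lead_coeff A \<noteq> 0" by simp
  then have "\<bar>lead_coeff A\<bar> \<ge> 1" by linarith
  then show ?thesis using abs_coeff_le_int_height[of A "degree A"] by linarith
qed

text \<open>Sort by the exact height h of A; then B has height at most X / h. This gives h^j (X /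
  h)^(l+1). With the factor of smaller degree on the shell, the exponent l + 1 - j is at least
  1.\<close>

lemma card_self_reciprocal_pairs_le:
  assumes "1 \<le> j" "j \<le> l"
  defines "S X \<equiv> {(A, B). A \<in> self_reciprocal j \<and> B \<in> self_reciprocal l \<and> int_height A * int_height B \<le> X}"
  shows "finite (S X) \<and>
    real (card (S X)) \<le> 2 * real (j + 1) * 3 ^ (j + l + 1) * (real X ^ (l + 1) * (\<Sum>h=1..X. 1 / real h ^ (l + 1 - j)))"
proof -
  let ?T = "\<lambda>h. {A \<in> self_reciprocal j. int_height A = h} \<times> {B \<in> self_reciprocal l. int_height B \<le> X div h}"
  have fin: "finite (?T h)" for h
    by (intro finite_cartesian_product card_self_reciprocal_height_le(1)
      finite_subset[OF _ card_self_reciprocal_height_le(1)[of j h]]) auto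
  have sub: "S X \<subseteq> (\<Union>h\<in>{1..X}. ?T h)"
  proof
    fix x assume "x \<in> S X"
    then obtain A B where x: "x = (A, B)" "A \<in> self_reciprocal j" "B \<in> self_reciprocal l" "int_height A * int_height B \<le> X"
      by (auto simp: S_def)
    have pos: "int_height A \<ge> 1" "int_height B \<ge> 1"
      using self_reciprocal_height_pos[OF x(2)] self_reciprocal_height_pos[OF x(3)] assms by auto
    have "int_height A * 1 \<le> int_height A * int_height B" using pos by (intro mult_left_mono) auto
    from order.trans[OF this x(4)] have "int_height A \<in> {1..X}" using pos by simp
    moreover have "int_height B \<le> X div int_height A"
      using pos x(4) by (simp add: less_eq_div_iff_mult_less_eq mult.commute)
    ultimately show "x \<in> (\<Union>h\<in>{1..X}. ?T h)" using x by blast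
  qed
  then have finS: "finite (S X)" using fin finite_subset by blast
  have "card (S X) \<le> card (\<Union>h\<in>{1..X}. ?T h)" using sub fin by (intro card_mono) auto
  also have "\<dots> \<le> (\<Sum>h=1..X. card (?T h))" by (rule card_UN_le) simp
  finally have "real (card (S X)) \<le> (\<Sum>h=1..X. real (card (?T h)))"
    by (simp flip: of_nat_sum)
  also have "\<dots> \<le> (\<Sum>h=1..X. 2 * real (j + 1) * 3 ^ (j + l + 1) * (real X ^ (l + 1) * (1 / real h ^ (l + 1 - j))))"
  proof (rule sum_mono)
    fix h assume h: "h \<in> {1..X}"
    have hX: "real X / real h \<ge> 1" using h by simp
    have "real (card (?T h)) = real (card {A \<in> self_reciprocal j. int_height A = h}) * real (card {B \<in> self_reciprocal l. int_height B \<le> X div h})"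
      by (simp add: card_cartesian_product)
    also have "\<dots> \<le> (2 * real (j + 1) * real (2 * h + 1) ^ j) * real ((2 * (X div h) + 1) ^ (l + 1))"
      using h card_self_reciprocal_height_le(2)[of l "X div h"]
      by (intro mult_mono card_self_reciprocal_height_eq) (auto simp del: of_nat_power power_Suc)
    \<comment> \<open>The factors 3 come from 1 \<le> h and 1 \<le> X / h, which absorb the +1 of
      the box sides.\<close>
    also have "\<dots> \<le> (2 * real (j + 1) * (3 * real h) ^ j) * (3 * (real X / real h)) ^ (l + 1)"
    proof (intro mult_mono)
      show "real (2 * h + 1) ^ j \<le> (3 * real h) ^ j" using h by (intro power_mono) auto
      have "real (X div h) * real h \<le> real X" by (simp flip: of_nat_mult)
      then have "real (X div h) \<le> real X / real h" using h by (simp add: pos_le_divide_eq)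
      then have "real (2 * (X div h) + 1) \<le> 3 * (real X / real h)" using hX by simp
      then show "real ((2 * (X div h) + 1) ^ (l + 1)) \<le> (3 * (real X / real h)) ^ (l + 1)"
        unfolding of_nat_power by (rule power_mono) simp
    qed auto
    also have "\<dots> = 2 * real (j + 1) * 3 ^ (j + l + 1) * (real X ^ (l + 1) * (real h ^ j / real h ^ (l + 1)))"
      by (simp add: power_mult_distrib power_divide power_add)
    also have "real h ^ j / real h ^ (l + 1) = 1 / real h ^ (l + 1 - j)"
    proof -
      have "real h ^ (l + 1) = real h ^ j * real h ^ (l + 1 - j)"
        using assms(2) by (simp flip: power_add)
      then show ?thesis using h by simp
    qed
    finally show "real (card (?T h)) \<le> 2 * real (j + 1) * 3 ^ (j + l + 1) * (real X ^ (l + 1) * (1 / real h ^ (l + 1 - j)))" .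
  qed
  finally show ?thesis using finS by (simp add: sum_distrib_left mult_ac)
qed

text \<open>With 1 + ln x in place of ln x the term dominates x^m from x = 1 on and is
  submultiplicative, so constant factors can be moved out of the argument.\<close>

definition error_term :: "nat \<Rightarrow> real \<Rightarrow> real" where
  "error_term m x = x ^ m * (if m \<ge> 3 then 1 else 1 + ln x)"

text \<open>If j < l, the sum is at most 2 and l + 1 \<le> m. If j = l, it is harmonic, and m = 2 l:
  for m = 2 the logarithm stays, and for larger m it is absorbed by a spare power of X.\<close>

lemma power_sum_le_error_term:
  assumes "1 \<le> j" "j \<le> l" "j + l = m" "X \<ge> 1"
  shows "real X ^ (l + 1) * (\<Sum>h=1..X. 1 / real h ^ (l + 1 - j)) \<le> 2 * error_term m (real X)"
proof (cases "j = l")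
  case True
  have X1: "real X \<ge> 1" using assms by simp
  have ln0: "ln (real X) \<ge> 0" using X1 by simp
  have "real X ^ (l + 1) * (\<Sum>h=1..X. 1 / real h ^ (l + 1 - j)) \<le> real X ^ (l + 1) * (1 + ln (real X))"
    using True harmonic_sum_le[OF assms(4)] by (intro mult_left_mono) auto
  also have "\<dots> \<le> 1 * error_term m (real X)"
  proof (cases "m \<ge> 3")
    case m3: True
    have "1 + ln (real X) \<le> real X" using ln_le_minus_one[of "real X"] X1 by simp
    then have "real X ^ (l + 1) * (1 + ln (real X)) \<le> real X ^ (l + 1) * real X"
      by (intro mult_left_mono) auto
    also have "\<dots> = real X ^ (l + 2)" by simp
    also have "\<dots> \<le> real X ^ m"
      using True assms m3 X1 by (intro power_increasing) auto
    finally show ?thesis using m3 by (simp add: error_term_def)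
  next
    case False
    then have "m = 2" "l = 1" using True assms by auto
    then show ?thesis by (simp add: error_term_def power2_eq_square)
  qed
  also have "\<dots> \<le> 2 * error_term m (real X)"
    using X1 ln0 by (intro mult_right_mono) (auto simp: error_term_def)
  finally show ?thesis .
next
  case False
  have X1: "real X \<ge> 1" using assms by simp
  have m3: "m \<ge> 3" using False assms by linarith
  have "real X ^ (l + 1) * (\<Sum>h=1..X. 1 / real h ^ (l + 1 - j)) \<le> real X ^ m * 2"
    using False assms X1 by (intro mult_mono power_increasing sum_inverse_power_le sum_nonneg) auto
  then show ?thesis using m3 by (simp add: error_term_def)
qed

lemma error_term_mult_le:
  assumes "c \<ge> 1" "x \<ge> 1"
  shows "error_term m (c * x) \<le> error_term m c * error_term m x"
proof -
  have "ln (c * x) = ln c + ln x" using assms by (simp add: ln_mult)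
  moreover have "ln c \<ge> 0" "ln x \<ge> 0" using assms by auto
  ultimately have "1 + ln (c * x) \<le> (1 + ln c) * (1 + ln x)" by (simp add: algebra_simps)
  then have "c ^ m * x ^ m * (1 + ln (c * x)) \<le> c ^ m * x ^ m * ((1 + ln c) * (1 + ln x))"
    using assms by (intro mult_left_mono) auto
  then show ?thesis by (auto simp: error_term_def power_mult_distrib mult_ac)
qed

definition reciprocal_products :: "nat \<Rightarrow> nat \<Rightarrow> int poly set" where
  "reciprocal_products m X = {A * B | A B j. 1 \<le> j \<and> j < m \<and> A \<in> self_reciprocal j \<and> B \<in> self_reciprocal (m - j) \<and> int_height (A * B) \<le> X}"

text \<open>The comparison of heights turns a bound on the height of A B into one on the product of
  the two heights, at the cost of a constant c; the pairs are then counted.\<close>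

lemma card_self_reciprocal_products_le:
  "\<exists>C\<ge>0. \<forall>X\<ge>1. finite (reciprocal_products m X) \<and>
    real (card (reciprocal_products m X))
      \<le> C * error_term m (real X)"
proof -
  obtain c :: nat where c: "c \<ge> 1" "\<And>A B :: int poly. degree A \<le> 2 * m \<Longrightarrow> degree B \<le> 2 * m \<Longrightarrow> int_height A * int_height B \<le> c * int_height (A * B)"
    using int_height_mult_ge[of "2 * m"] by blast
  \<comment> \<open>The factors may be exchanged, so it is enough to treat half-degrees j \<le> m -
    j.\<close>
  define J where "J = {j. 1 \<le> j \<and> j \<le> m - j}"
  have J: "finite J" by (rule finite_subset[of _ "{..m}"]) (auto simp: J_def)
  define K where "K = (\<Sum>j\<in>J. 2 * real (j + 1) * 3 ^ (j + (m - j) + 1))"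
  have K0: "K \<ge> 0" by (simp add: K_def sum_nonneg)
  have e0: "error_term m x \<ge> 0" if "x \<ge> 1" for x using that by (auto simp: error_term_def)
  have "finite (reciprocal_products m X) \<and>
    real (card (reciprocal_products m X))
      \<le> K * 2 * error_term m (real c) * error_term m (real X)" if X: "X \<ge> 1" for X
  proof -
    let ?R = "reciprocal_products m X"
    define S where "S j = {(A, B). A \<in> self_reciprocal j \<and> B \<in> self_reciprocal (m - j) \<and> int_height A * int_height B \<le> c * X}" for j
    have S: "finite (S j)" "real (card (S j)) \<le> 2 * real (j + 1) * 3 ^ (j + (m - j) + 1) * (2 * error_term m (real (c * X)))" if "j \<in> J" for j
    proof -
      have j: "1 \<le> j" "j \<le> m - j" "j + (m - j) = m" using that by (auto simp: J_def)
      have cX: "c * X \<ge> 1" using c(1) X by (metis mult_le_mono nat_mult_1)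
      show "finite (S j)" unfolding S_def using card_self_reciprocal_pairs_le[OF j(1,2)] by blast
      have "real (card (S j)) \<le> 2 * real (j + 1) * 3 ^ (j + (m - j) + 1) * (real (c * X) ^ (m - j + 1) * (\<Sum>h=1..c * X. 1 / real h ^ (m - j + 1 - j)))"
        unfolding S_def using card_self_reciprocal_pairs_le[OF j(1,2)] by blast
      also have "\<dots> \<le> 2 * real (j + 1) * 3 ^ (j + (m - j) + 1) * (2 * error_term m (real (c * X)))"
        by (intro mult_left_mono power_sum_le_error_term j cX) auto
      finally show "real (card (S j)) \<le> 2 * real (j + 1) * 3 ^ (j + (m - j) + 1) * (2 * error_term m (real (c * X)))" .
    qed
    have sub: "?R \<subseteq> (\<Union>j\<in>J. (\<lambda>(A, B). A * B) ` S j)"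
    proof
      fix P assume "P \<in> ?R"
      then obtain A B j where P: "P = A * B" "1 \<le> j" "j < m" "A \<in> self_reciprocal j" "B \<in> self_reciprocal (m - j)" "int_height (A * B) \<le> X"
        unfolding reciprocal_products_def by blast
      have "int_height A * int_height B \<le> c * int_height (A * B)"
        using P by (intro c(2)) (auto simp: self_reciprocal_def)
      also have "\<dots> \<le> c * X" using P(6) by simp
      finally have le: "int_height A * int_height B \<le> c * X" .
      show "P \<in> (\<Union>j\<in>J. (\<lambda>(A, B). A * B) ` S j)"
      proof (cases "j \<le> m - j")
        case True
        then have "(A, B) \<in> S j" "j \<in> J" using P le by (auto simp: S_def J_def)
        then show ?thesis using P(1) by force
      next
        case False
        then have "m - (m - j) = j" using P by simp
        then have "(B, A) \<in> S (m - j)" "m - j \<in> J" using False P le by (auto simp: S_def J_def mult.commute)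
        moreover have "P = (\<lambda>(A, B). A * B) (B, A)" using P(1) by (simp add: mult.commute)
        ultimately show ?thesis by blast
      qed
    qed
    have finU: "finite (\<Union>j\<in>J. (\<lambda>(A, B). A * B) ` S j)" using J S(1) by blast
    then have fin: "finite ?R" using sub finite_subset by blast
    have "card ?R \<le> card (\<Union>j\<in>J. (\<lambda>(A, B). A * B) ` S j)" by (rule card_mono[OF finU sub])
    also have "\<dots> \<le> (\<Sum>j\<in>J. card ((\<lambda>(A, B). A * B) ` S j))" by (rule card_UN_le[OF J])
    also have "\<dots> \<le> (\<Sum>j\<in>J. card (S j))" using S(1) by (intro sum_mono card_image_le)
    finally have "real (card ?R) \<le> (\<Sum>j\<in>J. real (card (S j)))" by (simp flip: of_nat_sum)
    also have "\<dots> \<le> (\<Sum>j\<in>J. 2 * real (j + 1) * 3 ^ (j + (m - j) + 1) * (2 * error_term m (real (c * X))))"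
      using S(2) by (intro sum_mono)
    also have "\<dots> = K * (2 * error_term m (real (c * X)))" unfolding K_def sum_distrib_right ..
    also have "\<dots> \<le> K * (2 * (error_term m (real c) * error_term m (real X)))"
      using K0 c(1) X error_term_mult_le[of "real c" "real X" m] by (intro mult_left_mono) auto
    finally show ?thesis using fin by (simp add: mult_ac)
  qed
  moreover have "K * 2 * error_term m (real c) \<ge> 0" using K0 e0[of "real c"] c(1) by simp
  ultimately show ?thesis by blast
qed

section \<open>Counting the algebraic numbers\<close>

text \<open>The final bookkeeping: g counts roots of all primitive polynomials, y of the prime ones,
  b of the remaining ones with positive leading coefficient, and c of those whose coefficient of
  index 2m vanishes.\<close>

lemma abs_diff_le_of_double:
  fixes g :: real
  assumes "\<bar>g - 2 * x\<bar> \<le> a" "g = 2 * (b + y) + c" "0 \<le> a" "0 \<le> b" "b \<le> b'" "0 \<le> c" "c \<le> c'"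
  shows "\<bar>y - x\<bar> \<le> a + b' + c'"
  using assms by (simp add: abs_le_iff)

context
  fixes m :: nat and lam :: "nat \<Rightarrow> real"
  assumes m: "m \<ge> 1" and lam: "\<And>k. k \<le> 2 * m \<Longrightarrow> lam k > 0"
    and sym: "\<And>k. k \<le> 2 * m \<Longrightarrow> lam k = lam (2 * m - k)"
begin

section \<open>Palindromic polynomials and their half coefficients\<close>

lemma lam_pos_half: "k \<le> m \<Longrightarrow> lam k > 0"
  using lam by simp

lemmas semi_axis_eq = semi_axis_def[of m lam, OF m lam_pos_half]
lemmas height_lattice_eq = height_lattice_def[of m lam, OF m lam_pos_half]

text \<open>Symmetry is about index m, whatever the actual degree is. Polynomials with vanishing
  outer coefficients are thus included, which makes the correspondence with nonzero lattice points
  bijective.\<close>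

definition palindromic :: "int poly set" where
  "palindromic = {P. degree P \<le> 2 * m \<and> (\<forall>k\<le>2 * m. coeff P k = coeff P (2 * m - k))}"

definition height_ball :: "real \<Rightarrow> int poly set" where
  "height_ball Q = {P \<in> palindromic. P \<noteq> 0 \<and> elliptic_height_poly m lam (map_poly of_int P) \<le> Q}"

text \<open>Indexed from the middle outwards, and restricted so as to land in
  \<open>height_lattice\<close>.\<close>

definition half_coeffs :: "int poly \<Rightarrow> nat \<Rightarrow> real" where
  "half_coeffs P = (\<lambda>k\<in>{..m}. of_int (coeff P (m - k)))"

definition root_count :: "real \<Rightarrow> real \<Rightarrow> int poly \<Rightarrow> real" where
  "root_count \<beta>1 \<beta>2 P = real (card {\<theta> \<in> {\<beta>1..\<beta>2}. ipoly P (cis \<theta>) = 0})"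

lemma degree_palindromic: "P \<in> palindromic \<Longrightarrow> degree P \<le> 2 * m"
  unfolding palindromic_def by blast

lemma palindromic_reflect: "P \<in> palindromic \<Longrightarrow> k \<le> 2 * m \<Longrightarrow> coeff P k = coeff P (2 * m - k)"
  unfolding palindromic_def by blast

lemma palindromic_coeff: "P \<in> palindromic \<Longrightarrow> k \<le> m \<Longrightarrow> coeff P (m + k) = coeff P (m - k)"
  using palindromic_reflect[of P "m + k"] by (simp add: mult_2)

lemma palindromic_eqI:
  assumes "P \<in> palindromic" "R \<in> palindromic" "\<And>k. k \<le> m \<Longrightarrow> coeff P k = coeff R k"
  shows "P = R"
proof (rule poly_eqI)
  fix k
  consider "k \<le> m" | "m < k" "k \<le> 2 * m" | "k > 2 * m" by linarith
  then show "coeff P k = coeff R k"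
  proof cases
    case 2
    then have "coeff P (2 * m - k) = coeff R (2 * m - k)" by (intro assms(3)) auto
    moreover have "coeff P k = coeff P (2 * m - k)" "coeff R k = coeff R (2 * m - k)"
      using palindromic_reflect[OF assms(1) 2(2)] palindromic_reflect[OF assms(2) 2(2)] by blast+
    ultimately show ?thesis by simp
  next
    case 3
    then have "degree P < k" "degree R < k"
      using degree_palindromic[OF assms(1)] degree_palindromic[OF assms(2)] by linarith+
    then show ?thesis by (simp add: coeff_eq_0)
  qed (use assms(3) in auto)
qed

lemma ipoly_cis_palindromic:
  assumes "P \<in> palindromic"
  shows "ipoly P (cis \<theta>) = cis \<theta> ^ m * of_real (trig_poly m (half_coeffs P) \<theta>)"
proof -
  have "ipoly P (cis \<theta>) = (\<Sum>k\<le>degree P. of_int (coeff P k) * cis \<theta> ^ k)"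
    by (simp add: poly_altdef coeff_map_poly)
  also have "\<dots> = (\<Sum>k\<le>2 * m. of_int (coeff P k) * cis \<theta> ^ k)"
    using degree_palindromic[OF assms] by (intro sum.mono_neutral_left) (auto simp: coeff_eq_0)
  also have "\<dots> = cis \<theta> ^ m * (of_int (coeff P m) +
      (\<Sum>k=1..m. of_int (coeff P (m + k)) * cis (real k * \<theta>) + of_int (coeff P (m - k)) * cis (- (real k * \<theta>))))"
    by (rule cis_sum_shift)
  also have "of_int (coeff P m) +
      (\<Sum>k=1..m. of_int (coeff P (m + k)) * cis (real k * \<theta>) + of_int (coeff P (m - k)) * cis (- (real k * \<theta>))) =
      complex_of_real (trig_poly m (half_coeffs P) \<theta>)"
    unfolding trig_poly_cis
    by (intro arg_cong2[of _ _ _ _ "(+)"] sum.cong) (auto simp: half_coeffs_def palindromic_coeff[OF assms])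
  finally show ?thesis .
qed

lemma ipoly_cis_palindromic_eq_0_iff:
  assumes "P \<in> palindromic"
  shows "ipoly P (cis \<theta>) = 0 \<longleftrightarrow> trig_poly m (half_coeffs P) \<theta> = 0"
  unfolding ipoly_cis_palindromic[OF assms] by simp

text \<open>By the symmetry of the weights the terms of index m - k and m + k coincide; their sum is
  the square with semi-axis lam (m - k) / sqrt 2.\<close>

lemma elliptic_height_palindromic:
  assumes "P \<in> palindromic"
  shows "elliptic_height_poly m lam (map_poly of_int P) =
    sqrt ((half_coeffs P 0)\<^sup>2 / (lam m)\<^sup>2 + (\<Sum>k=1..m. (half_coeffs P k / semi_axis m lam k)\<^sup>2))"
proof -
  have "lam (m + k) = lam (m - k)" if "k \<le> m" for k using sym[of "m + k"] that by simp
  then have "(of_int (coeff P (m + k)))\<^sup>2 / (lam (m + k))\<^sup>2 + (of_int (coeff P (m - k)))\<^sup>2 / (lam (m - k))\<^sup>2 =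
     (half_coeffs P k / semi_axis m lam k)\<^sup>2" if "k \<in> {1..m}" for k
    using that by (simp only: palindromic_coeff[OF assms] atLeastAtMost_iff)
      (simp add: half_coeffs_def semi_axis_eq power_divide power_mult_distrib)
  then have "(\<Sum>k=1..m. (of_int (coeff P (m + k)))\<^sup>2 / (lam (m + k))\<^sup>2 + (of_int (coeff P (m - k)))\<^sup>2 / (lam (m - k))\<^sup>2) =
     (\<Sum>k=1..m. (half_coeffs P k / semi_axis m lam k)\<^sup>2)"
    by (rule sum.cong[OF refl])
  then show ?thesis
    unfolding elliptic_height_poly_def sum_atMost_double by (simp add: coeff_map_poly half_coeffs_def)
qed

lemma bij_betw_half_coeffs:
  assumes Q: "Q \<ge> 0"
  shows "bij_betw half_coeffs (height_ball Q) {b \<in> height_lattice m lam Q. \<exists>k\<le>m. b k \<noteq> 0}"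
proof (rule bij_betw_imageI)
  show "inj_on half_coeffs (height_ball Q)"
  proof (rule inj_onI)
    fix P R assume P: "P \<in> height_ball Q" and R: "R \<in> height_ball Q" and eq: "half_coeffs P = half_coeffs R"
    show "P = R"
    proof (rule palindromic_eqI)
      fix k assume "k \<le> m"
      then show "coeff P k = coeff R k" using fun_cong[OF eq, of "m - k"] by (simp add: half_coeffs_def)
    qed (use P R in \<open>auto simp: height_ball_def\<close>)
  qed
  show "half_coeffs ` height_ball Q = {b \<in> height_lattice m lam Q. \<exists>k\<le>m. b k \<noteq> 0}"
  proof (intro equalityI subsetI)
    fix b assume "b \<in> half_coeffs ` height_ball Q"
    then obtain P where P: "P \<in> height_ball Q" "b = half_coeffs P" by blast
    have pal: "P \<in> palindromic" using P(1) by (simp add: height_ball_def)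
    have "\<exists>k\<le>m. b k \<noteq> 0"
    proof (rule ccontr)
      assume "\<not> ?thesis"
      then have "b (m - k) = 0" if "k \<le> m" for k by simp
      then have "coeff P k = coeff 0 k" if "k \<le> m" for k
        using that P(2) by (auto simp: half_coeffs_def)
      then have "P = 0" by (intro palindromic_eqI[OF pal]) (auto simp: palindromic_def)
      then show False using P(1) by (simp add: height_ball_def)
    qed
    moreover have "b \<in> height_lattice m lam Q"
      using P Q elliptic_height_palindromic[OF pal] real_le_rsqrt
      by (auto simp: height_lattice_eq height_ball_def half_coeffs_def real_sqrt_le_iff' sum_nonneg)
    ultimately show "b \<in> {b \<in> height_lattice m lam Q. \<exists>k\<le>m. b k \<noteq> 0}" by blast
  next
    fix b assume b: "b \<in> {b \<in> height_lattice m lam Q. \<exists>k\<le>m. b k \<noteq> 0}"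
    \<comment> \<open>The lattice vector mirrored at index m; the floor only converts integral reals
      to integers.\<close>
    define c where "c = (\<lambda>k. \<lfloor>b (if k \<le> m then m - k else k - m)\<rfloor>)"
    define P where "P = (\<Sum>k\<le>2 * m. monom (c k) k)"
    have coeff: "coeff P k = (if k \<le> 2 * m then c k else 0)" for k
      by (simp add: P_def coeff_sum)
    have deg: "degree P \<le> 2 * m" by (rule degree_le) (simp add: coeff)
    have c_sym: "c k = c (2 * m - k)" if "k \<le> 2 * m" for k
    proof -
      have "(if k \<le> m then m - k else k - m) = (if 2 * m - k \<le> m then m - (2 * m - k) else 2 * m - k - m)"
        using that by auto
      then show ?thesis unfolding c_def by (rule arg_cong)
    qed
    have pal: "P \<in> palindromic"
      unfolding palindromic_def mem_Collect_eq
    proof (intro conjI allI impI deg)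
      fix k assume k: "k \<le> 2 * m"
      have "coeff P k = c k" using k by (simp add: coeff)
      also have "c k = c (2 * m - k)" by (rule c_sym[OF k])
      also have "\<dots> = coeff P (2 * m - k)" by (simp add: coeff)
      finally show "coeff P k = coeff P (2 * m - k)" .
    qed
    have b_ext: "b \<in> (\<Pi>\<^sub>E k\<in>{..m}. \<int>)" using b by (auto simp: height_lattice_eq)
    have bP: "half_coeffs P = b"
    proof
      fix k
      show "half_coeffs P k = b k"
      proof (cases "k \<le> m")
        case True
        then have "b k \<in> \<int>" using b_ext by auto
        then show ?thesis using True by (auto simp: half_coeffs_def coeff c_def elim!: Ints_cases)
      next
        case False
        then show ?thesis using b_ext by (auto simp: half_coeffs_def PiE_def extensional_def)
      qed
    qed
    have "P \<noteq> 0"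
    proof
      assume "P = 0"
      then have "half_coeffs P k = 0" if "k \<le> m" for k using that by (simp add: half_coeffs_def)
      then show False using b bP by auto
    qed
    moreover have "elliptic_height_poly m lam (map_poly of_int P) \<le> Q"
      unfolding elliptic_height_palindromic[OF pal] bP using b Q
      by (subst real_sqrt_le_iff') (auto simp: height_lattice_eq sum_nonneg)
    ultimately have "P \<in> height_ball Q" using pal by (simp add: height_ball_def)
    with bP[symmetric] show "b \<in> half_coeffs ` height_ball Q" by (rule image_eqI)
  qed
qed

lemma abs_coeff_height_ball_le:
  assumes "P \<in> height_ball Q" "k \<le> 2 * m"
  shows "\<bar>of_int (coeff P k)\<bar> \<le> lam k * Q"
proof -
  have "(of_int (coeff P k))\<^sup>2 / (lam k)\<^sup>2 \<le> (\<Sum>k\<le>2 * m. (of_int (coeff P k))\<^sup>2 / (lam k)\<^sup>2)"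
    using assms(2) by (intro member_le_sum) auto
  then have "sqrt ((of_int (coeff P k))\<^sup>2 / (lam k)\<^sup>2) \<le> elliptic_height_poly m lam (map_poly of_int P)"
    unfolding elliptic_height_poly_def by (simp add: coeff_map_poly)
  also have "\<dots> \<le> Q" using assms(1) by (simp add: height_ball_def)
  finally show ?thesis using lam[OF assms(2)] by (simp add: real_sqrt_divide pos_divide_le_eq mult.commute)
qed

lemma root_count_le:
  assumes "P \<in> height_ball Q" "- pi \<le> \<beta>1" "\<beta>2 \<le> pi"
  shows "finite {\<theta> \<in> {\<beta>1..\<beta>2}. ipoly P (cis \<theta>) = 0}" "root_count \<beta>1 \<beta>2 P \<le> real (2 * m + 1)"
proof -
  let ?Z = "{\<theta> \<in> {-pi..pi}. ipoly P (cis \<theta>) = 0}"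
  have P: "(map_poly of_int P :: complex poly) \<noteq> 0" "degree (map_poly of_int P :: complex poly) \<le> 2 * m"
    using assms(1) degree_palindromic by (auto simp: height_ball_def)
  note Z = card_unit_circle_roots_le[OF P]
  have sub: "{\<theta> \<in> {\<beta>1..\<beta>2}. ipoly P (cis \<theta>) = 0} \<subseteq> ?Z" using assms(2,3) by auto
  show "finite {\<theta> \<in> {\<beta>1..\<beta>2}. ipoly P (cis \<theta>) = 0}" by (rule finite_subset[OF sub Z(1)])
  show "root_count \<beta>1 \<beta>2 P \<le> real (2 * m + 1)"
    unfolding root_count_def of_nat_le_iff using card_mono[OF Z(1) sub] Z(2) by linarith
qed

lemma root_count_nonneg: "root_count \<beta>1 \<beta>2 P \<ge> 0"
  by (simp add: root_count_def)

text \<open>A natural number, at least 1, that dominates every weight. Coefficients, and hence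
  contents, in the ball of radius Q are then at most \<open>coeff_bound * Q\<close>.\<close>

definition coeff_bound :: nat where
  "coeff_bound = Suc (nat \<lceil>\<Sum>k\<le>2 * m. lam k\<rceil>)"

lemma lam_le_coeff_bound:
  assumes "k \<le> 2 * m"
  shows "lam k \<le> real coeff_bound"
proof -
  have "lam k \<le> (\<Sum>k\<le>2 * m. lam k)" using assms lam by (intro member_le_sum) (auto intro: less_imp_le)
  then show ?thesis unfolding coeff_bound_def by linarith
qed

lemma abs_coeff_le_coeff_bound:
  assumes "P \<in> height_ball Q" "Q \<ge> 0"
  shows "\<bar>of_int (coeff P k)\<bar> \<le> real coeff_bound * Q"
proof (cases "k \<le> 2 * m")
  case True
  have "\<bar>of_int (coeff P k)\<bar> \<le> lam k * Q" by (rule abs_coeff_height_ball_le[OF assms(1) True])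
  also have "\<dots> \<le> real coeff_bound * Q" using lam_le_coeff_bound[OF True] assms(2) by (intro mult_right_mono)
  finally show ?thesis .
next
  case False
  then have "coeff P k = 0" using assms(1) degree_palindromic[of P] by (intro coeff_eq_0) (auto simp: height_ball_def)
  then show ?thesis using assms(2) by simp
qed

text \<open>A family determined by m of the m + 1 free coefficients has one dimension less than the
  ball and disappears in the error. The two degenerate families below are of this kind.\<close>

lemma card_height_ball_subset_le:
  assumes S: "S \<subseteq> height_ball Q" and Q: "Q \<ge> 1" and K: "finite K" "card K = m"
    and inj: "inj_on (\<lambda>P. restrict (coeff P) K) S"
  shows "finite S \<and> real (card S) \<le> (3 * real coeff_bound) ^ m * Q ^ m"
proof -
  define h where "h = nat \<lfloor>real coeff_bound * Q\<rfloor>"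
  have cb: "real coeff_bound \<ge> 1" by (simp add: coeff_bound_def)
  have cQ: "real coeff_bound * Q \<ge> 1" using mult_mono[OF cb Q] Q by simp
  have sub: "(\<lambda>P. restrict (coeff P) K) ` S \<subseteq> (\<Pi>\<^sub>E k\<in>K. {- int h..int h})"
  proof (rule image_subsetI)
    fix P assume P: "P \<in> S"
    have "\<bar>coeff P k\<bar> \<le> int h" for k
    proof -
      have "of_int \<bar>coeff P k\<bar> \<le> real coeff_bound * Q"
        using abs_coeff_le_coeff_bound[of P Q k] S P Q by auto
      then have "\<bar>coeff P k\<bar> \<le> \<lfloor>real coeff_bound * Q\<rfloor>" by (simp only: le_floor_iff)
      then show ?thesis unfolding h_def by linarith
    qed
    then show "restrict (coeff P) K \<in> (\<Pi>\<^sub>E k\<in>K. {- int h..int h})" by (auto simp: abs_le_iff minus_le_iff)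
  qed
  have finE: "finite (\<Pi>\<^sub>E k\<in>K. {- int h..int h})" using K(1) by (intro finite_PiE) auto
  have fin: "finite S" using finite_imageD[OF finite_subset[OF sub finE] inj] .
  have "card S \<le> card (\<Pi>\<^sub>E k\<in>K. {- int h..int h})" by (rule card_inj_on_le[OF inj sub finE])
  also have "\<dots> = (2 * h + 1) ^ m" using K by (simp add: card_PiE nat_add_distrib nat_mult_distrib)
  finally have "real (card S) \<le> real ((2 * h + 1) ^ m)" by (simp only: of_nat_le_iff)
  also have "\<dots> = real (2 * h + 1) ^ m" by (rule of_nat_power)
  also have "\<dots> \<le> (3 * (real coeff_bound * Q)) ^ m"
  proof (rule power_mono)
    have "real h \<le> real coeff_bound * Q" unfolding h_def using cQ by simp
    then show "real (2 * h + 1) \<le> 3 * (real coeff_bound * Q)" using cQ by simp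
  qed simp
  finally show ?thesis using fin by (simp add: power_mult_distrib mult_ac)
qed

text \<open>By symmetry the constant term vanishes too, so the coefficients of index 1 to m
  suffice.\<close>

lemma card_vanishing_leading_coeff_le:
  assumes "Q \<ge> 1"
  shows "finite {P \<in> height_ball Q. coeff P (2 * m) = 0} \<and>
    real (card {P \<in> height_ball Q. coeff P (2 * m) = 0}) \<le> (3 * real coeff_bound) ^ m * Q ^ m"
proof (rule card_height_ball_subset_le[where K = "{1..m}"])
  show "inj_on (\<lambda>P. restrict (coeff P) {1..m}) {P \<in> height_ball Q. coeff P (2 * m) = 0}"
  proof (rule inj_onI)
    fix P R assume P: "P \<in> {P \<in> height_ball Q. coeff P (2 * m) = 0}" and R: "R \<in> {P \<in> height_ball Q. coeff P (2 * m) = 0}"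
      and eq: "restrict (coeff P) {1..m} = restrict (coeff R) {1..m}"
    have pal: "P \<in> palindromic" "R \<in> palindromic" using P R by (auto simp: height_ball_def)
    show "P = R"
    proof (rule palindromic_eqI[OF pal])
      fix k assume k: "k \<le> m"
      show "coeff P k = coeff R k"
      proof (cases "k = 0")
        case True
        then show ?thesis using P R palindromic_coeff[OF pal(1), of m] palindromic_coeff[OF pal(2), of m]
          by (simp flip: mult_2)
      next
        case False
        then show ?thesis using fun_cong[OF eq, of k] k by simp
      qed
    qed
  qed
qed (use assms in auto)

text \<open>A prescribed root determines the middle coefficient from the others. Used at the points
  1 and -1.\<close>

lemma card_vanishing_at_cis_le:
  assumes "Q \<ge> 1"
  shows "finite {P \<in> height_ball Q. ipoly P (cis \<theta>) = 0} \<and>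
    real (card {P \<in> height_ball Q. ipoly P (cis \<theta>) = 0}) \<le> (3 * real coeff_bound) ^ m * Q ^ m"
proof (rule card_height_ball_subset_le[where K = "{..<m}"])
  show "inj_on (\<lambda>P. restrict (coeff P) {..<m}) {P \<in> height_ball Q. ipoly P (cis \<theta>) = 0}"
  proof (rule inj_onI)
    fix P R assume P: "P \<in> {P \<in> height_ball Q. ipoly P (cis \<theta>) = 0}" and R: "R \<in> {P \<in> height_ball Q. ipoly P (cis \<theta>) = 0}"
      and eq: "restrict (coeff P) {..<m} = restrict (coeff R) {..<m}"
    have pal: "P \<in> palindromic" "R \<in> palindromic" using P R by (auto simp: height_ball_def)
    have low: "coeff P k = coeff R k" if "k < m" for k using fun_cong[OF eq, of k] that by simp
    have "trig_poly m (half_coeffs P) \<theta> = 0" "trig_poly m (half_coeffs R) \<theta> = 0"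
      using P R pal by (auto simp: ipoly_cis_palindromic_eq_0_iff)
    moreover have "(\<Sum>k=1..m. half_coeffs P k * cos (real k * \<theta>)) = (\<Sum>k=1..m. half_coeffs R k * cos (real k * \<theta>))"
      by (intro sum.cong) (auto simp: half_coeffs_def low)
    ultimately have "half_coeffs P 0 = half_coeffs R 0" by (simp add: trig_poly_def)
    then have mid: "coeff P m = coeff R m" by (simp add: half_coeffs_def)
    show "P = R"
    proof (rule palindromic_eqI[OF pal])
      fix k assume "k \<le> m"
      then show "coeff P k = coeff R k" using mid low[of k] by (cases "k = m") auto
    qed
  qed
qed (use assms in auto)

section \<open>From all polynomials to primitive ones\<close>

definition root_sum :: "real \<Rightarrow> real \<Rightarrow> real \<Rightarrow> real" where
  "root_sum \<beta>1 \<beta>2 Q = (\<Sum>P\<in>height_ball Q. root_count \<beta>1 \<beta>2 P)"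

text \<open>The coefficient of Q^(m+1) in the asymptotics of \<open>root_sum\<close>.\<close>

definition expected_roots :: "real \<Rightarrow> real \<Rightarrow> real" where
  "expected_roots \<beta>1 \<beta>2 = density_constant m lam * integral {\<beta>1..\<beta>2} (angle_density m lam)"

lemma root_sum_eq:
  assumes "Q \<ge> 0"
  shows "root_sum \<beta>1 \<beta>2 Q = (\<Sum>b \<in> {b \<in> height_lattice m lam Q. \<exists>k\<le>m. b k \<noteq> 0}.
    real (card {\<theta> \<in> {\<beta>1..\<beta>2}. trig_poly m b \<theta> = 0}))"
proof -
  have "root_sum \<beta>1 \<beta>2 Q = (\<Sum>P\<in>height_ball Q. real (card {\<theta> \<in> {\<beta>1..\<beta>2}. trig_poly m (half_coeffs P) \<theta> = 0}))"
    unfolding root_sum_def root_count_def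
    by (intro sum.cong) (auto simp: height_ball_def ipoly_cis_palindromic_eq_0_iff)
  also have "\<dots> = (\<Sum>b \<in> {b \<in> height_lattice m lam Q. \<exists>k\<le>m. b k \<noteq> 0}.
      real (card {\<theta> \<in> {\<beta>1..\<beta>2}. trig_poly m b \<theta> = 0}))"
    by (rule sum.reindex_bij_betw[OF bij_betw_half_coeffs[OF assms]])
  finally show ?thesis .
qed

lemma height_ball_mono: "Q \<le> Q' \<Longrightarrow> height_ball Q \<subseteq> height_ball Q'"
  by (auto simp: height_ball_def)

lemma finite_height_ball: "finite (height_ball Q)"
proof -
  let ?Q = "max Q 1"
  obtain C where C: "\<And>Q \<beta>1 \<beta>2. Q \<ge> 1 \<and> - pi \<le> \<beta>1 \<and> \<beta>1 \<le> \<beta>2 \<and> \<beta>2 \<le> pi \<Longrightarrow> finite (height_lattice m lam Q)"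
    using trig_poly_root_count_asymptotics[of m lam, OF m lam_pos_half] by blast
  \<comment> \<open>Only the finiteness clause is wanted, so any arc will do.\<close>
  have "finite (height_lattice m lam ?Q)" by (rule C[of _ 0 0]) auto
  then have "finite {b \<in> height_lattice m lam ?Q. \<exists>k\<le>m. b k \<noteq> 0}" by simp
  then have "finite (height_ball ?Q)" using bij_betw_finite[OF bij_betw_half_coeffs[of ?Q]] by simp
  then show ?thesis using height_ball_mono[of Q ?Q] finite_subset by fastforce
qed

lemma expected_roots_bounded:
  "\<exists>V\<ge>0. \<forall>\<beta>1 \<beta>2. - pi \<le> \<beta>1 \<and> \<beta>1 \<le> \<beta>2 \<and> \<beta>2 \<le> pi \<longrightarrow> \<bar>expected_roots \<beta>1 \<beta>2\<bar> \<le> V"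
proof -
  have cont: "continuous_on X (angle_density m lam)" for X
    by (rule continuous_angle_density[OF m lam_pos_half])
  have "bounded (angle_density m lam ` {-pi..pi})"
    by (intro compact_imp_bounded compact_continuous_image cont) auto
  then obtain B where B: "B > 0" "\<And>t. t \<in> {-pi..pi} \<Longrightarrow> norm (angle_density m lam t) \<le> B"
    unfolding bounded_pos by blast
  have "\<bar>expected_roots \<beta>1 \<beta>2\<bar> \<le> \<bar>density_constant m lam\<bar> * (B * (2 * pi))"
    if \<beta>: "- pi \<le> \<beta>1" "\<beta>1 \<le> \<beta>2" "\<beta>2 \<le> pi" for \<beta>1 \<beta>2
  proof -
    have "(angle_density m lam has_integral integral {\<beta>1..\<beta>2} (angle_density m lam)) {\<beta>1..\<beta>2}"
      by (intro integrable_integral integrable_continuous_real cont)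
    then have "norm (integral {\<beta>1..\<beta>2} (angle_density m lam)) \<le> B * measure lborel {\<beta>1..\<beta>2}"
      by (rule has_integral_bound_real[rotated 2, where S = "{}"]) (use B \<beta> in auto)
    also have "\<dots> \<le> B * (2 * pi)" using B \<beta> by (intro mult_left_mono) auto
    finally show ?thesis unfolding expected_roots_def abs_mult by (intro mult_left_mono) auto
  qed
  moreover have "0 \<le> \<bar>density_constant m lam\<bar> * (B * (2 * pi))" using B by simp
  ultimately show ?thesis by blast
qed

text \<open>The inversion evaluates the root sum at Q / d for d up to 2 * coeff_bound * Q, so the
  estimate must reach below 1. There both the sum and the main term are bounded, the former by
  monotonicity.\<close>

lemma root_sum_asymptotics:
  "\<exists>C\<ge>0. \<forall>Q \<beta>1 \<beta>2. Q \<ge> 1 / (2 * real coeff_bound) \<and> - pi \<le> \<beta>1 \<and> \<beta>1 \<le> \<beta>2 \<and> \<beta>2 \<le> pi \<longrightarrow>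
     \<bar>root_sum \<beta>1 \<beta>2 Q - expected_roots \<beta>1 \<beta>2 * Q ^ (m + 1)\<bar> \<le> C * Q ^ m"
proof -
  obtain C where C: "C \<ge> 0" "\<And>Q \<beta>1 \<beta>2. Q \<ge> 1 \<and> - pi \<le> \<beta>1 \<and> \<beta>1 \<le> \<beta>2 \<and> \<beta>2 \<le> pi \<Longrightarrow>
     \<bar>(\<Sum>b \<in> {b \<in> height_lattice m lam Q. \<exists>k\<le>m. b k \<noteq> 0}. real (card {\<theta> \<in> {\<beta>1..\<beta>2}. trig_poly m b \<theta> = 0}))
       - density_constant m lam * Q ^ (m + 1) * integral {\<beta>1..\<beta>2} (angle_density m lam)\<bar> \<le> C * Q ^ m"
    using trig_poly_root_count_asymptotics[of m lam, OF m lam_pos_half] by blast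
  obtain V where V: "V \<ge> 0" "\<And>\<beta>1 \<beta>2. - pi \<le> \<beta>1 \<and> \<beta>1 \<le> \<beta>2 \<and> \<beta>2 \<le> pi \<Longrightarrow> \<bar>expected_roots \<beta>1 \<beta>2\<bar> \<le> V"
    using expected_roots_bounded by blast
  define c where "c = 2 * real coeff_bound"
  have c: "c \<ge> 1" by (simp add: c_def coeff_bound_def)
  have c1: "1 \<le> c ^ m" using c by simp
  have large: "\<bar>root_sum \<beta>1 \<beta>2 Q - expected_roots \<beta>1 \<beta>2 * Q ^ (m + 1)\<bar> \<le> C * Q ^ m"
    if "Q \<ge> 1" "- pi \<le> \<beta>1 \<and> \<beta>1 \<le> \<beta>2 \<and> \<beta>2 \<le> pi" for Q \<beta>1 \<beta>2
    using C(2)[of Q \<beta>1 \<beta>2] that by (simp add: root_sum_eq expected_roots_def mult_ac)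
  have "\<bar>root_sum \<beta>1 \<beta>2 Q - expected_roots \<beta>1 \<beta>2 * Q ^ (m + 1)\<bar> \<le> ((2 * V + C) * c ^ m) * Q ^ m"
    if Q: "Q \<ge> 1 / c" and \<beta>: "- pi \<le> \<beta>1 \<and> \<beta>1 \<le> \<beta>2 \<and> \<beta>2 \<le> pi" for Q \<beta>1 \<beta>2
  proof (cases "Q \<ge> 1")
    case True
    have "C * 1 \<le> (2 * V + C) * c ^ m" using V(1) C(1) c1 by (intro mult_mono) auto
    then have "C * Q ^ m \<le> (2 * V + C) * c ^ m * Q ^ m" using True by (intro mult_right_mono) auto
    then show ?thesis using large[OF True \<beta>] by linarith
  next
    case False
    have Q0: "Q > 0" using Q c by (meson divide_pos_pos less_le_trans zero_less_one)
    have "root_sum \<beta>1 \<beta>2 Q \<le> root_sum \<beta>1 \<beta>2 1"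
      unfolding root_sum_def using False
      by (intro sum_mono2 finite_height_ball height_ball_mono root_count_nonneg) auto
    also have "\<dots> \<le> V + C" using large[OF order.refl \<beta>] V(2)[OF \<beta>] by simp
    finally have "root_sum \<beta>1 \<beta>2 Q \<le> V + C" .
    moreover have "root_sum \<beta>1 \<beta>2 Q \<ge> 0" by (simp add: root_sum_def sum_nonneg root_count_nonneg)
    moreover have "\<bar>Q ^ (m + 1)\<bar> \<le> 1"
      unfolding power_abs using Q0 False by (intro power_le_one) auto
    then have "\<bar>expected_roots \<beta>1 \<beta>2 * Q ^ (m + 1)\<bar> \<le> V * 1"
      unfolding abs_mult using V(2)[OF \<beta>] V(1) by (intro mult_mono) auto
    moreover have "\<bar>r - e\<bar> \<le> (2 * V + C) * 1" if "r \<le> V + C" "r \<ge> 0" "\<bar>e\<bar> \<le> V * 1" for r e :: real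
      using that V(1) C(1) by (simp add: abs_le_iff)
    ultimately have "\<bar>root_sum \<beta>1 \<beta>2 Q - expected_roots \<beta>1 \<beta>2 * Q ^ (m + 1)\<bar> \<le> (2 * V + C) * 1"
      by blast
    \<comment> \<open>For 1 / c \<le> Q < 1 the factor c^m lets Q^m dominate a constant.\<close>
    also have "1 \<le> (c * Q) ^ m" using Q c by (intro one_le_power) (simp add: divide_le_eq mult.commute)
    then have "(2 * V + C) * 1 \<le> (2 * V + C) * (c * Q) ^ m" using V(1) C(1) by (intro mult_left_mono) auto
    finally show ?thesis by (simp add: power_mult_distrib mult_ac)
  qed
  moreover have "(2 * V + C) * c ^ m \<ge> 0" using V(1) C(1) c by simp
  ultimately show ?thesis unfolding c_def by blast
qed

lemma elliptic_height_smult: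
  "elliptic_height_poly m lam (map_poly of_int (smult (int d) P)) = real d * elliptic_height_poly m lam (map_poly of_int P)"
proof -
  have "(\<Sum>k\<le>2 * m. (coeff (map_poly of_int (smult (int d) P)) k)\<^sup>2 / (lam k)\<^sup>2) =
    (real d)\<^sup>2 * (\<Sum>k\<le>2 * m. (coeff (map_poly of_int P) k)\<^sup>2 / (lam k)\<^sup>2)"
    by (simp add: coeff_map_poly sum_distrib_left power_mult_distrib)
  then show ?thesis unfolding elliptic_height_poly_def by (simp add: real_sqrt_mult)
qed

text \<open>The content is divisible by d exactly when P = d R, and the height scales by d. As P and
  R have the same roots, the root sum over these P is the one at Q / d.\<close>

lemma height_ball_multiples:
  assumes "d \<ge> 1"
  shows "{P \<in> height_ball Q. d dvd nat (Polynomial.content P)} = smult (int d) ` height_ball (Q / real d)"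
proof -
  have pal: "smult (int d) R \<in> palindromic \<longleftrightarrow> R \<in> palindromic" for R
    using assms by (simp add: palindromic_def)
  have ball: "smult (int d) R \<in> height_ball Q \<longleftrightarrow> R \<in> height_ball (Q / real d)" for R
    using assms unfolding height_ball_def mem_Collect_eq pal elliptic_height_smult
    by (auto simp: pos_le_divide_eq mult.commute)
  have dvd: "d dvd nat (Polynomial.content P) \<longleftrightarrow> (\<exists>R. P = smult (int d) R)" for P
  proof -
    have "0 \<le> Polynomial.content P" using normalize_content[of P] by (metis abs_ge_zero normalize_int_def)
    then have "d dvd nat (Polynomial.content P) \<longleftrightarrow> int d dvd Polynomial.content P"
      by (metis int_nat_eq int_dvd_int_iff)
    also have "\<dots> \<longleftrightarrow> [:int d:] dvd P" by (simp add: const_poly_dvd_iff_dvd_content)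
    also have "\<dots> \<longleftrightarrow> (\<exists>R. P = smult (int d) R)" by (auto simp: dvd_def)
    finally show ?thesis .
  qed
  show ?thesis using ball by (auto simp: dvd)
qed

lemma root_count_smult:
  assumes "d \<ge> 1"
  shows "root_count \<beta>1 \<beta>2 (smult (int d) P) = root_count \<beta>1 \<beta>2 P"
  using assms by (simp add: root_count_def of_int_poly_smult)

lemma content_le_coeff_bound:
  assumes "P \<in> height_ball Q" "Q \<ge> 0"
  shows "Polynomial.content P > 0" "of_int (Polynomial.content P) \<le> real coeff_bound * Q"
proof -
  have P: "P \<noteq> 0" using assms(1) by (simp add: height_ball_def)
  have "0 \<le> Polynomial.content P" using normalize_content[of P] by (metis abs_ge_zero normalize_int_def)
  then show pos: "Polynomial.content P > 0" using P by (simp add: order_less_le)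
  have "Polynomial.content P \<le> \<bar>lead_coeff P\<bar>"
    using P by (intro zdvd_imp_le) auto
  then have "of_int (Polynomial.content P) \<le> \<bar>of_int (lead_coeff P) :: real\<bar>"
    by (metis of_int_abs of_int_le_iff)
  also have "\<dots> \<le> real coeff_bound * Q" by (rule abs_coeff_le_coeff_bound[OF assms])
  finally show "of_int (Polynomial.content P) \<le> real coeff_bound * Q" .
qed

text \<open>The condition of content 1 is written as the sum of the Moebius function over the
  divisors of the content. Contents do not exceed D, so d may run over a fixed range.\<close>

lemma primitive_root_sum_eq:
  assumes Q: "Q \<ge> 0" and D: "real coeff_bound * Q \<le> real D"
  shows "(\<Sum>P\<in>{P \<in> height_ball Q. Polynomial.content P = 1}. root_count \<beta>1 \<beta>2 P) =
    (\<Sum>d=1..D. moebius d * root_sum \<beta>1 \<beta>2 (Q / real d))"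
proof -
  let ?c = "\<lambda>P. nat (Polynomial.content P)" and ?N = "root_count \<beta>1 \<beta>2"
  have c: "0 < ?c P" "?c P \<le> D" if "P \<in> height_ball Q" for P
  proof -
    show "0 < ?c P" using content_le_coeff_bound(1)[OF that Q] by simp
    have "real_of_int (Polynomial.content P) \<le> real_of_int (int D)"
      using content_le_coeff_bound(2)[OF that Q] D by simp
    then have "Polynomial.content P \<le> int D" by (simp only: of_int_le_iff)
    then show "?c P \<le> D" by simp
  qed
  have "(\<Sum>P\<in>{P \<in> height_ball Q. Polynomial.content P = 1}. ?N P) =
      (\<Sum>P\<in>height_ball Q. if Polynomial.content P = 1 then ?N P else 0)"
    by (rule sum.inter_filter[OF finite_height_ball])
  also have "\<dots> = (\<Sum>P\<in>height_ball Q. \<Sum>d=1..D. if d dvd ?c P then moebius d * ?N P else 0)"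
  proof (rule sum.cong)
    fix P assume P: "P \<in> height_ball Q"
    have "{d. d dvd ?c P} = {d \<in> {1..D}. d dvd ?c P}"
    proof (intro equalityI subsetI)
      fix d assume "d \<in> {d. d dvd ?c P}"
      then have "d dvd ?c P" by simp
      with dvd_pos_nat[OF c(1)[OF P] this] dvd_imp_le[OF this c(1)[OF P]] c(2)[OF P]
      show "d \<in> {d \<in> {1..D}. d dvd ?c P}" by simp
    qed simp
    then have "(\<Sum>d\<in>{d \<in> {1..D}. d dvd ?c P}. moebius d) = (if ?c P = 1 then 1 else 0)"
      using sum_moebius_divisors[OF c(1)[OF P]] by simp
    moreover have "?c P = 1 \<longleftrightarrow> Polynomial.content P = 1" using c[OF P] by auto
    ultimately have "(if Polynomial.content P = 1 then ?N P else 0) = (\<Sum>d\<in>{d \<in> {1..D}. d dvd ?c P}. moebius d) * ?N P"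
      by simp
    also have "\<dots> = (\<Sum>d=1..D. if d dvd ?c P then moebius d * ?N P else 0)"
      unfolding sum_distrib_right by (rule sum.inter_filter) simp
    finally show "(if Polynomial.content P = 1 then ?N P else 0) = (\<Sum>d=1..D. if d dvd ?c P then moebius d * ?N P else 0)" .
  qed simp
  also have "\<dots> = (\<Sum>d=1..D. \<Sum>P\<in>height_ball Q. if d dvd ?c P then moebius d * ?N P else 0)"
    by (rule sum.swap)
  also have "\<dots> = (\<Sum>d=1..D. moebius d * root_sum \<beta>1 \<beta>2 (Q / real d))"
  proof (rule sum.cong)
    fix d assume "d \<in> {1..D}"
    then have d: "d \<ge> 1" by simp
    have "(\<Sum>P\<in>height_ball Q. if d dvd ?c P then moebius d * ?N P else 0) = (\<Sum>P\<in>{P \<in> height_ball Q. d dvd ?c P}. moebius d * ?N P)"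
      by (rule sum.inter_filter[OF finite_height_ball, symmetric])
    also have "\<dots> = (\<Sum>R\<in>height_ball (Q / real d). moebius d * ?N (smult (int d) R))"
    proof -
      have "inj_on (smult (int d)) (height_ball (Q / real d))"
      proof (intro inj_onI poly_eqI)
        fix R R' k assume "smult (int d) R = smult (int d) R'"
        then have "int d * coeff R k = int d * coeff R' k" by (metis coeff_smult)
        then show "coeff R k = coeff R' k" using d by simp
      qed
      then show ?thesis unfolding height_ball_multiples[OF d] by (simp add: sum.reindex)
    qed
    also have "\<dots> = moebius d * root_sum \<beta>1 \<beta>2 (Q / real d)"
      by (simp add: root_sum_def root_count_smult[OF d] sum_distrib_left)
    finally show "(\<Sum>P\<in>height_ball Q. if d dvd ?c P then moebius d * ?N P else 0) = moebius d * root_sum \<beta>1 \<beta>2 (Q / real d)" .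
  qed simp
  finally show ?thesis .
qed

lemma error_term_ge: "Q \<ge> 1 \<Longrightarrow> Q ^ m \<le> error_term m Q"
  by (simp add: error_term_def mult_le_cancel_left1)

text \<open>With D of the order of Q, the tail of the Moebius series costs Q^(m+1) / D = O(Q^m), and
  the errors at Q / d sum to Q^m times the sum of 1 / d^m. The latter grows, logarithmically, only
  for m = 1.\<close>

lemma primitive_root_sum_asymptotics:
  "\<exists>C\<ge>0. \<forall>Q \<beta>1 \<beta>2. Q \<ge> 1 \<and> - pi \<le> \<beta>1 \<and> \<beta>1 \<le> \<beta>2 \<and> \<beta>2 \<le> pi \<longrightarrow>
     \<bar>(\<Sum>P\<in>{P \<in> height_ball Q. Polynomial.content P = 1}. root_count \<beta>1 \<beta>2 P)
       - expected_roots \<beta>1 \<beta>2 * Q ^ (m + 1) / riemann_zeta (real (m + 1))\<bar> \<le> C * error_term m Q"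
proof -
  obtain C where C: "C \<ge> 0" "\<And>Q \<beta>1 \<beta>2. Q \<ge> 1 / (2 * real coeff_bound) \<and> - pi \<le> \<beta>1 \<and> \<beta>1 \<le> \<beta>2 \<and> \<beta>2 \<le> pi \<Longrightarrow>
     \<bar>root_sum \<beta>1 \<beta>2 Q - expected_roots \<beta>1 \<beta>2 * Q ^ (m + 1)\<bar> \<le> C * Q ^ m"
    using root_sum_asymptotics by blast
  obtain V where V: "V \<ge> 0" "\<And>\<beta>1 \<beta>2. - pi \<le> \<beta>1 \<and> \<beta>1 \<le> \<beta>2 \<and> \<beta>2 \<le> pi \<Longrightarrow> \<bar>expected_roots \<beta>1 \<beta>2\<bar> \<le> V"
    using expected_roots_bounded by blast
  define c where "c = 2 * real coeff_bound"
  have c: "c \<ge> 1" by (simp add: c_def coeff_bound_def)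
  \<comment> \<open>Covers both cases: the value 2 for convergent sums, and 1 + ln (c Q) \<le> K (1
    + ln Q) for the harmonic one.\<close>
  define K where "K = 2 * (1 + ln c)"
  have lnc: "ln c \<ge> 0" using c by simp
  have K: "K \<ge> 2" using lnc by (simp add: K_def)
  have "\<bar>(\<Sum>P\<in>{P \<in> height_ball Q. Polynomial.content P = 1}. root_count \<beta>1 \<beta>2 P)
       - expected_roots \<beta>1 \<beta>2 * Q ^ (m + 1) / riemann_zeta (real (m + 1))\<bar> \<le> (C * K + V) * error_term m Q"
    if Q: "Q \<ge> 1" and \<beta>: "- pi \<le> \<beta>1 \<and> \<beta>1 \<le> \<beta>2 \<and> \<beta>2 \<le> pi" for Q \<beta>1 \<beta>2
  proof -
    \<comment> \<open>D \<ge> coeff_bound * Q exceeds every content and makes the tail small, while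
      D \<le> c Q keeps Q / d above 1 / c.\<close>
    define D where "D = coeff_bound * nat \<lceil>Q\<rceil>"
    have cb: "real coeff_bound \<ge> 1" by (simp add: coeff_bound_def)
    have n: "Q \<le> real (nat \<lceil>Q\<rceil>)" "real (nat \<lceil>Q\<rceil>) \<le> 2 * Q" using Q by linarith+
    have D: "real coeff_bound * Q \<le> real D" "real D \<le> c * Q"
      using n cb by (auto simp: D_def c_def mult_left_mono)
    have DQ: "Q \<le> real D" using D(1) cb Q mult_right_mono[of 1 "real coeff_bound" Q] by linarith
    have D1: "D \<ge> 1" using DQ Q by linarith
    have "\<bar>(\<Sum>d=1..D. moebius d * root_sum \<beta>1 \<beta>2 (Q / real d)) - expected_roots \<beta>1 \<beta>2 * Q ^ (m + 1) / riemann_zeta (real (m + 1))\<bar>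
      \<le> C * Q ^ m * (\<Sum>d=1..D. 1 / real d ^ m) + \<bar>expected_roots \<beta>1 \<beta>2\<bar> * Q ^ (m + 1) / real D"
    proof (rule moebius_inversion_asymptotics[OF m D1])
      fix d assume d: "1 \<le> d" "d \<le> D"
      have "1 / c \<le> Q / real D" using D(2) c Q D1 by (simp add: field_simps)
      also have "\<dots> \<le> Q / real d" using d Q by (intro divide_left_mono) auto
      finally show "\<bar>root_sum \<beta>1 \<beta>2 (Q / real d) - expected_roots \<beta>1 \<beta>2 * (Q / real d) ^ (m + 1)\<bar> \<le> C * (Q / real d) ^ m"
        using \<beta> by (intro C(2)) (simp add: c_def)
    qed (use Q in auto)
    moreover have "\<bar>expected_roots \<beta>1 \<beta>2\<bar> * Q ^ (m + 1) / real D \<le> V * error_term m Q"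
    proof -
      have "\<bar>expected_roots \<beta>1 \<beta>2\<bar> * Q ^ (m + 1) / real D = \<bar>expected_roots \<beta>1 \<beta>2\<bar> * (Q ^ m * (Q / real D))" by simp
      also have "\<dots> \<le> V * (Q ^ m * 1)"
        using V DQ D1 Q \<beta> by (intro mult_mono) auto
      also have "\<dots> \<le> V * error_term m Q" using V(1) error_term_ge[OF Q] by (intro mult_left_mono) auto
      finally show ?thesis .
    qed
    moreover have "Q ^ m * (\<Sum>d=1..D. 1 / real d ^ m) \<le> K * error_term m Q"
    proof (cases "m = 1")
      case True
      have "(\<Sum>d=1..D. 1 / real d ^ m) \<le> 1 + ln (real D)" using True harmonic_sum_le[OF D1] by simp
      also have "ln (real D) \<le> ln (c * Q)" using D(2) D1 by (intro ln_mono) auto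
      also have "ln (c * Q) = ln c + ln Q" using c Q by (simp add: ln_mult)
      also have "1 + (ln c + ln Q) \<le> K * (1 + ln Q)"
      proof -
        have "0 \<le> ln c * ln Q" using lnc Q by simp
        then show ?thesis using lnc Q by (simp add: K_def algebra_simps)
      qed
      finally have "Q ^ m * (\<Sum>d=1..D. 1 / real d ^ m) \<le> Q ^ m * (K * (1 + ln Q))"
        using Q by (intro mult_left_mono) auto
      then show ?thesis using True by (simp add: error_term_def mult_ac)
    next
      case False
      then have "(\<Sum>d=1..D. 1 / real d ^ m) \<le> 2" using m by (intro sum_inverse_power_le) simp
      then have "Q ^ m * (\<Sum>d=1..D. 1 / real d ^ m) \<le> Q ^ m * K" using K Q by (intro mult_left_mono) auto
      also have "\<dots> \<le> error_term m Q * K" using error_term_ge[OF Q] K by (intro mult_right_mono) auto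
      finally show ?thesis by (simp add: mult.commute)
    qed
    then have "C * Q ^ m * (\<Sum>d=1..D. 1 / real d ^ m) \<le> C * K * error_term m Q"
      using mult_left_mono[OF _ C(1)] by (simp only: mult.assoc)
    ultimately show ?thesis
      unfolding primitive_root_sum_eq[OF order.trans[OF zero_le_one Q] D(1)] by (simp add: distrib_right)
  qed
  moreover have "C * K + V \<ge> 0" using C(1) V(1) K by simp
  ultimately show ?thesis by blast
qed

section \<open>From primitive polynomials to algebraic numbers\<close>

definition prime_ball :: "real \<Rightarrow> int poly set" where
  "prime_ball Q = {P \<in> height_ball Q. prime_int_poly P \<and> degree P = 2 * m}"

text \<open>The prime polynomial vanishing at a point is unique, so the root sets of distinct
  elements of \<open>prime_ball\<close> are disjoint. They cover all counted angles, because the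
  minimal polynomials in question are palindromic.\<close>

lemma angle_count_eq:
  assumes \<beta>: "- pi \<le> \<beta>1" "\<beta>2 \<le> pi"
  shows "real (angle_count m lam \<beta>1 \<beta>2 Q) = (\<Sum>P\<in>prime_ball Q. root_count \<beta>1 \<beta>2 P)"
proof -
  let ?Z = "\<lambda>P. {\<theta> \<in> {\<beta>1..\<beta>2}. ipoly P (cis \<theta>) = 0}"
  have "{\<theta> \<in> {\<beta>1..\<beta>2}. algebraic (cis \<theta>) \<and> algebraic_degree (cis \<theta>) = 2 * m \<and> elliptic_height m lam (cis \<theta>) \<le> Q} =
    (\<Union>P\<in>prime_ball Q. ?Z P)"
  proof (intro equalityI subsetI)
    fix \<theta> assume \<theta>: "\<theta> \<in> {\<theta> \<in> {\<beta>1..\<beta>2}. algebraic (cis \<theta>) \<and> algebraic_degree (cis \<theta>) = 2 * m \<and> elliptic_height m lam (cis \<theta>) \<le> Q}"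
    then obtain A where A: "prime_int_poly A" "ipoly A (cis \<theta>) = 0"
      using exists_minimal_int_poly[of "cis \<theta>"] by blast
    have deg: "degree A = 2 * m" and ht: "elliptic_height_poly m lam (map_poly of_int A) \<le> Q"
      using \<theta> min_int_poly_eq[OF A] by (auto simp: algebraic_degree_def elliptic_height_def)
    \<comment> \<open>The minimal polynomial of 1 has degree 1, which is not 2m.\<close>
    have "cis \<theta> \<noteq> 1"
    proof
      assume "cis \<theta> = 1"
      then have "A = [:-1, 1:]"
        using A by (intro prime_int_poly_unique[OF A(1) _ prime_int_poly_linear, of 1]) (auto simp: map_poly_pCons)
      then show False using deg m by simp
    qed
    then have refl: "reflect_poly A = A" using prime_int_poly_reflect[OF A] by blast
    have "A \<in> palindromic"
      unfolding palindromic_def mem_Collect_eq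
    proof (intro conjI allI impI)
      fix k assume "k \<le> 2 * m"
      then show "coeff A k = coeff A (2 * m - k)"
        using coeff_reflect_poly[of A k] unfolding refl deg by simp
    qed (use deg in simp)
    then have "A \<in> prime_ball Q"
      using A(1) deg ht prime_int_poly_nonzero[OF A(1)] by (simp add: prime_ball_def height_ball_def)
    then show "\<theta> \<in> (\<Union>P\<in>prime_ball Q. ?Z P)" using \<theta> A(2) by blast
  next
    fix \<theta> assume "\<theta> \<in> (\<Union>P\<in>prime_ball Q. ?Z P)"
    then obtain P where P: "P \<in> prime_ball Q" "\<theta> \<in> {\<beta>1..\<beta>2}" "ipoly P (cis \<theta>) = 0" by blast
    have pr: "prime_int_poly P" using P(1) by (simp add: prime_ball_def)
    have "algebraic (cis \<theta>)" using algebraic_of_ipoly_root[OF prime_int_poly_nonzero[OF pr] P(3)] .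
    then show "\<theta> \<in> {\<theta> \<in> {\<beta>1..\<beta>2}. algebraic (cis \<theta>) \<and> algebraic_degree (cis \<theta>) = 2 * m \<and> elliptic_height m lam (cis \<theta>) \<le> Q}"
      using P by (simp add: algebraic_degree_def elliptic_height_def min_int_poly_eq[OF pr P(3)] prime_ball_def height_ball_def)
  qed
  moreover have "card (\<Union>P\<in>prime_ball Q. ?Z P) = (\<Sum>P\<in>prime_ball Q. card (?Z P))"
  proof (rule card_UN_disjoint)
    show "finite (prime_ball Q)"
      by (rule finite_subset[OF _ finite_height_ball[of Q]]) (auto simp: prime_ball_def)
    show "\<forall>P\<in>prime_ball Q. finite (?Z P)"
    proof
      fix P assume "P \<in> prime_ball Q"
      then have "P \<in> height_ball Q" by (simp add: prime_ball_def)
      then show "finite (?Z P)" by (rule root_count_le(1)[OF _ \<beta>])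
    qed
    show "\<forall>P\<in>prime_ball Q. \<forall>R\<in>prime_ball Q. P \<noteq> R \<longrightarrow> ?Z P \<inter> ?Z R = {}"
      using prime_int_poly_unique by (fastforce simp: prime_ball_def)
  qed
  ultimately show ?thesis by (simp add: angle_count_def root_count_def)
qed

definition positive_primitive :: "real \<Rightarrow> int poly set" where
  "positive_primitive Q = {P \<in> height_ball Q. Polynomial.content P = 1 \<and> coeff P (2 * m) > 0}"

text \<open>P \<mapsto> -P preserves content, height and roots and exchanges the two signs of the
  coefficient of index 2m. The resulting factor 2 is the +1 in the exponent of 2 in the main
  term.\<close>

lemma root_sum_primitive_split:
  "(\<Sum>P\<in>{P \<in> height_ball Q. Polynomial.content P = 1}. root_count \<beta>1 \<beta>2 P) =
    2 * (\<Sum>P\<in>positive_primitive Q. root_count \<beta>1 \<beta>2 P) +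
    (\<Sum>P\<in>{P \<in> height_ball Q. Polynomial.content P = 1 \<and> coeff P (2 * m) = 0}. root_count \<beta>1 \<beta>2 P)"
proof -
  let ?N = "root_count \<beta>1 \<beta>2"
  let ?neg = "{P \<in> height_ball Q. Polynomial.content P = 1 \<and> coeff P (2 * m) < 0}"
  let ?zero = "{P \<in> height_ball Q. Polynomial.content P = 1 \<and> coeff P (2 * m) = 0}"
  have "{P \<in> height_ball Q. Polynomial.content P = 1} = (positive_primitive Q \<union> ?neg) \<union> ?zero"
    by (auto simp: positive_primitive_def)
  also have "(\<Sum>P\<in>\<dots>. ?N P) = (\<Sum>P\<in>positive_primitive Q \<union> ?neg. ?N P) + (\<Sum>P\<in>?zero. ?N P)"
    unfolding positive_primitive_def by (intro sum.union_disjoint) (auto simp: finite_height_ball)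
  also have "(\<Sum>P\<in>positive_primitive Q \<union> ?neg. ?N P) = (\<Sum>P\<in>positive_primitive Q. ?N P) + (\<Sum>P\<in>?neg. ?N P)"
    unfolding positive_primitive_def by (intro sum.union_disjoint) (auto simp: finite_height_ball)
  also have "(\<Sum>P\<in>?neg. ?N P) = (\<Sum>P\<in>positive_primitive Q. ?N P)"
  proof -
    have content: "Polynomial.content (- P) = Polynomial.content P" for P :: "int poly"
      using content_smult[of "-1" P] by simp
    have pal: "- P \<in> palindromic" if P: "P \<in> palindromic" for P
      unfolding palindromic_def mem_Collect_eq
    proof (intro conjI allI impI)
      show "degree (- P) \<le> 2 * m" using degree_palindromic[OF P] by simp
      fix k assume "k \<le> 2 * m"
      from palindromic_reflect[OF P this] show "coeff (- P) k = coeff (- P) (2 * m - k)"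
        unfolding coeff_minus by (rule arg_cong)
    qed
    have height: "elliptic_height_poly m lam (map_poly of_int (- P)) = elliptic_height_poly m lam (map_poly of_int P)" for P
      by (simp add: elliptic_height_poly_def coeff_map_poly)
    have ball: "- P \<in> height_ball Q" if "P \<in> height_ball Q" for P
      using that pal unfolding height_ball_def mem_Collect_eq height neg_equal_0_iff_equal by blast
    have N: "?N (- P) = ?N P" for P by (simp add: root_count_def of_int_poly_uminus)
    have "uminus ` positive_primitive Q = ?neg"
    proof (intro equalityI subsetI)
      fix P assume "P \<in> uminus ` positive_primitive Q"
      then obtain R where R: "P = - R" "R \<in> positive_primitive Q" by blast
      then show "P \<in> ?neg" using ball[of R] by (simp add: positive_primitive_def content)
    next
      fix P assume P: "P \<in> ?neg"
      then have "- P \<in> positive_primitive Q" using ball[of P] by (simp add: positive_primitive_def content)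
      then show "P \<in> uminus ` positive_primitive Q" by (intro image_eqI[of _ _ "- P"]) simp_all
    qed
    then have "(\<Sum>P\<in>?neg. ?N P) = (\<Sum>P\<in>positive_primitive Q. ?N (- P))"
      by (simp add: sum.reindex flip: \<open>uminus ` positive_primitive Q = ?neg\<close>)
    then show ?thesis by (simp only: N)
  qed
  finally show ?thesis by (simp only: mult_2)
qed

lemma error_term_mono:
  assumes "1 \<le> x" "x \<le> y"
  shows "error_term m x \<le> error_term m y"
proof (cases "m \<ge> 3")
  case True
  then show ?thesis using assms by (simp add: error_term_def power_mono)
next
  case False
  have "x ^ m * (1 + ln x) \<le> y ^ m * (1 + ln y)"
    using assms by (intro mult_mono power_mono) auto
  then show ?thesis using False by (simp add: error_term_def)
qed

text \<open>Such a polynomial contributes only if it has a root on the arc. Either 1 or -1 is a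
  root, or it splits into two self-reciprocal factors of even degree; each of these families is
  small.\<close>

lemma root_sum_nonprime_le:
  "\<exists>C\<ge>0. \<forall>Q \<beta>1 \<beta>2. Q \<ge> 1 \<and> - pi \<le> \<beta>1 \<and> \<beta>2 \<le> pi \<longrightarrow>
     (\<Sum>P\<in>positive_primitive Q - prime_ball Q. root_count \<beta>1 \<beta>2 P) \<le> C * error_term m Q"
proof -
  let ?R = "reciprocal_products m"
  obtain C where C: "C \<ge> 0" "\<And>X. X \<ge> 1 \<Longrightarrow> finite (?R X) \<and> real (card (?R X)) \<le> C * error_term m (real X)"
    using card_self_reciprocal_products_le[of m] by blast
  have cb: "real coeff_bound \<ge> 1" by (simp add: coeff_bound_def)
  define K where "K = (3 * real coeff_bound) ^ m"
  define E where "E = error_term m (real coeff_bound)"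
  have E: "E \<ge> 0" using error_term_ge[OF cb] cb unfolding E_def by (meson order_trans zero_le_power of_nat_0_le_iff)
  have K: "K \<ge> 0" by (simp add: K_def)
  have "(\<Sum>P\<in>positive_primitive Q - prime_ball Q. root_count \<beta>1 \<beta>2 P) \<le> (real (2 * m + 1) * (2 * K + C * E)) * error_term m Q"
    if Q: "Q \<ge> 1" and \<beta>: "- pi \<le> \<beta>1" "\<beta>2 \<le> pi" for Q \<beta>1 \<beta>2
  proof -
    define X where "X = nat \<lfloor>real coeff_bound * Q\<rfloor>"
    have cQ: "real coeff_bound * Q \<ge> 1" using mult_mono[OF cb Q] Q by simp
    have X: "X \<ge> 1" "real X \<le> real coeff_bound * Q" using cQ unfolding X_def by linarith+
    define S0 where "S0 = {P \<in> height_ball Q. ipoly P (cis 0) = 0}"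
    define S1 where "S1 = {P \<in> height_ball Q. ipoly P (cis pi) = 0}"
    have S0: "finite S0" "real (card S0) \<le> K * Q ^ m" and S1: "finite S1" "real (card S1) \<le> K * Q ^ m"
      using card_vanishing_at_cis_le[OF Q] unfolding S0_def S1_def K_def by blast+
    have R: "finite (?R X)" "real (card (?R X)) \<le> C * error_term m (real X)" using C(2)[OF X(1)] by blast+
    \<comment> \<open>\<open>S0\<close> and \<open>S1\<close> collect the polynomials vanishing at 1
      = cis 0 and at -1 = cis pi.\<close>
    have bad: "P \<in> S0 \<union> (S1 \<union> ?R X)" if P: "P \<in> positive_primitive Q - prime_ball Q" and N: "root_count \<beta>1 \<beta>2 P \<noteq> 0" for P
    proof -
      have ball: "P \<in> height_ball Q" and content: "Polynomial.content P = 1" and lead: "coeff P (2 * m) > 0"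
        using P by (auto simp: positive_primitive_def)
      have pal: "P \<in> palindromic" using ball by (simp add: height_ball_def)
      have deg: "degree P = 2 * m"
        using degree_palindromic[OF pal] lead le_degree[of P "2 * m"] by auto
      have np: "\<not> prime_int_poly P" using P ball deg by (auto simp: prime_ball_def)
      have refl: "reflect_poly P = P"
      proof (rule poly_eqI)
        fix k
        show "coeff (reflect_poly P) k = coeff P k"
        proof (cases "k \<le> 2 * m")
          case True
          have "coeff (reflect_poly P) k = coeff P (2 * m - k)" using True by (simp add: coeff_reflect_poly deg)
          also have "\<dots> = coeff P k" by (rule palindromic_reflect[OF pal True, symmetric])
          finally show ?thesis .
        next
          case False
          then show ?thesis by (simp add: coeff_reflect_poly deg coeff_eq_0)
        qed
      qed
      obtain \<theta> where \<theta>: "ipoly P (cis \<theta>) = 0"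
        using N unfolding root_count_def by (metis (mono_tags, lifting) card.empty empty_Collect_eq of_nat_0)
      consider "cis \<theta> = 1" | "cis \<theta> = -1" | "cis \<theta> \<noteq> 1" "cis \<theta> \<noteq> -1" by blast
      then show ?thesis
      proof cases
        case 1
        then show ?thesis using \<theta> ball by (simp add: S0_def)
      next
        case 2
        then show ?thesis using \<theta> ball by (simp add: S1_def)
      next
        case 3
        obtain A B where AB: "P = A * B" "reflect_poly A = A" "reflect_poly B = B" "even (degree A)" "even (degree B)"
            "degree A > 0" "degree B > 0"
          using nonprime_palindromic_factors[OF refl _ content _ np \<theta> 3] deg lead by auto
        obtain j where j: "degree A = 2 * j" using AB(4) by (auto elim: evenE)
        obtain l where l: "degree B = 2 * l" using AB(5) by (auto elim: evenE)
        have "degree P = degree A + degree B"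
          unfolding AB(1) using AB(6,7) by (intro degree_mult_eq) auto
        then have jl: "j + l = m" "l = m - j" "1 \<le> j" "j < m" using deg j l AB(6,7) by auto
        have "int_height P \<le> X"
        proof (rule int_height_leI)
          fix k
          have "of_int \<bar>coeff P k\<bar> \<le> real coeff_bound * Q"
            using abs_coeff_le_coeff_bound[OF ball, of k] Q by simp
          then have "\<bar>coeff P k\<bar> \<le> \<lfloor>real coeff_bound * Q\<rfloor>" by (simp only: le_floor_iff)
          then show "\<bar>coeff P k\<bar> \<le> int X" unfolding X_def by linarith
        qed
        moreover have "A \<in> self_reciprocal j" "B \<in> self_reciprocal (m - j)"
          using AB j l jl by (auto simp: self_reciprocal_def)
        ultimately have "P \<in> ?R X" unfolding reciprocal_products_def using AB(1) jl(3,4) by blast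
        then show ?thesis by blast
      qed
    qed
    have fin: "finite (S0 \<union> (S1 \<union> ?R X))" using S0(1) S1(1) R(1) by blast
    have finP: "finite (positive_primitive Q - prime_ball Q)"
      by (rule finite_subset[OF _ finite_height_ball[of Q]]) (auto simp: positive_primitive_def)
    have "(\<Sum>P\<in>positive_primitive Q - prime_ball Q. root_count \<beta>1 \<beta>2 P) \<le>
      (\<Sum>P\<in>(positive_primitive Q - prime_ball Q) \<inter> (S0 \<union> (S1 \<union> ?R X)). root_count \<beta>1 \<beta>2 P)"
    proof (rule eq_refl, rule sum.mono_neutral_right[OF finP Int_lower1], rule ballI)
      fix P assume "P \<in> positive_primitive Q - prime_ball Q - (positive_primitive Q - prime_ball Q) \<inter> (S0 \<union> (S1 \<union> ?R X))"
      then show "root_count \<beta>1 \<beta>2 P = 0" using bad[of P] by blast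
    qed
    also have "\<dots> \<le> (\<Sum>P\<in>(positive_primitive Q - prime_ball Q) \<inter> (S0 \<union> (S1 \<union> ?R X)). real (2 * m + 1))"
      by (intro sum_mono root_count_le(2)[OF _ \<beta>, of _ Q]) (auto simp: positive_primitive_def)
    also have "\<dots> \<le> real (card (S0 \<union> (S1 \<union> ?R X))) * real (2 * m + 1)"
      using fin by (simp only: sum_constant) (intro mult_right_mono of_nat_mono card_mono, auto)
    also have "\<dots> \<le> ((2 * K + C * E) * error_term m Q) * real (2 * m + 1)"
    proof (rule mult_right_mono)
      have "card (S0 \<union> (S1 \<union> ?R X)) \<le> card S0 + (card S1 + card (?R X))"
        by (meson add_left_mono card_Un_le order_trans)
      then have "real (card (S0 \<union> (S1 \<union> ?R X))) \<le> real (card S0) + (real (card S1) + real (card (?R X)))"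
        by (simp only: of_nat_add[symmetric] of_nat_le_iff)
      also have "\<dots> \<le> K * Q ^ m + (K * Q ^ m + C * error_term m (real X))"
        by (intro add_mono S0 S1 R)
      also have "\<dots> \<le> K * error_term m Q + (K * error_term m Q + C * (E * error_term m Q))"
      proof (intro add_mono mult_left_mono K C(1) error_term_ge[OF Q])
        have "error_term m (real X) \<le> error_term m (real coeff_bound * Q)"
          using X by (intro error_term_mono) auto
        also have "\<dots> \<le> E * error_term m Q" unfolding E_def by (rule error_term_mult_le[OF cb Q])
        finally show "error_term m (real X) \<le> E * error_term m Q" .
      qed
      finally show "real (card (S0 \<union> (S1 \<union> ?R X))) \<le> (2 * K + C * E) * error_term m Q"
        by (simp add: algebra_simps)
    qed simp
    finally show ?thesis by (simp only: mult_ac)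
  qed
  moreover have "real (2 * m + 1) * (2 * K + C * E) \<ge> 0" using K C(1) E by simp
  ultimately show ?thesis by blast
qed

lemma main_term_eq:
  "main_term m lam \<beta>1 \<beta>2 Q = expected_roots \<beta>1 \<beta>2 * Q ^ (m + 1) / riemann_zeta (real (m + 1)) / 2"
proof -
  have "(2::real) powr (real m / 2 + 1) = 2 powr (real m / 2) * 2" by (simp add: powr_add)
  then show ?thesis
    by (simp add: main_term_def expected_roots_def density_constant_def[of m lam, OF m lam_pos_half] mult_ac)
qed

text \<open>The prime count is half of the primitive count after removal of the non-prime
  polynomials and of those with vanishing coefficient of index 2m. Both corrections are nonnegative
  and within the error.\<close>

lemma angle_count_asymptotics:
  "\<exists>C\<ge>0. \<forall>Q \<beta>1 \<beta>2. Q \<ge> 1 \<and> - pi \<le> \<beta>1 \<and> \<beta>1 \<le> \<beta>2 \<and> \<beta>2 \<le> pi \<longrightarrow>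
     \<bar>real (angle_count m lam \<beta>1 \<beta>2 Q) - main_term m lam \<beta>1 \<beta>2 Q\<bar> \<le> C * error_term m Q"
proof -
  obtain C1 where C1: "C1 \<ge> 0" "\<And>Q \<beta>1 \<beta>2. Q \<ge> 1 \<and> - pi \<le> \<beta>1 \<and> \<beta>1 \<le> \<beta>2 \<and> \<beta>2 \<le> pi \<Longrightarrow>
     \<bar>(\<Sum>P\<in>{P \<in> height_ball Q. Polynomial.content P = 1}. root_count \<beta>1 \<beta>2 P)
       - expected_roots \<beta>1 \<beta>2 * Q ^ (m + 1) / riemann_zeta (real (m + 1))\<bar> \<le> C1 * error_term m Q"
    using primitive_root_sum_asymptotics by blast
  obtain C2 where C2: "C2 \<ge> 0" "\<And>Q \<beta>1 \<beta>2. Q \<ge> 1 \<and> - pi \<le> \<beta>1 \<and> \<beta>2 \<le> pi \<Longrightarrow>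
     (\<Sum>P\<in>positive_primitive Q - prime_ball Q. root_count \<beta>1 \<beta>2 P) \<le> C2 * error_term m Q"
    using root_sum_nonprime_le by blast
  define K where "K = real (2 * m + 1) * (3 * real coeff_bound) ^ m"
  have "\<bar>real (angle_count m lam \<beta>1 \<beta>2 Q) - main_term m lam \<beta>1 \<beta>2 Q\<bar> \<le> (C1 + C2 + K) * error_term m Q"
    if Q: "Q \<ge> 1" and \<beta>: "- pi \<le> \<beta>1" "\<beta>1 \<le> \<beta>2" "\<beta>2 \<le> pi" for Q \<beta>1 \<beta>2
  proof -
    let ?N = "root_count \<beta>1 \<beta>2"
    define G where "G = (\<Sum>P\<in>{P \<in> height_ball Q. Polynomial.content P = 1}. ?N P)"
    define G0 where "G0 = (\<Sum>P\<in>{P \<in> height_ball Q. Polynomial.content P = 1 \<and> coeff P (2 * m) = 0}. ?N P)"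
    define Gb where "Gb = (\<Sum>P\<in>positive_primitive Q - prime_ball Q. ?N P)"
    define A where "A = real (angle_count m lam \<beta>1 \<beta>2 Q)"
    have sub: "prime_ball Q \<subseteq> positive_primitive Q"
      by (auto simp: prime_ball_def positive_primitive_def prime_int_poly_def)
    have fin: "finite (positive_primitive Q)" by (simp add: positive_primitive_def finite_height_ball)
    have "(\<Sum>P\<in>positive_primitive Q. ?N P) = Gb + A"
      unfolding Gb_def A_def angle_count_eq[OF \<beta>(1,3)] by (rule sum.subset_diff[OF sub fin])
    then have G: "G = 2 * (Gb + A) + G0"
      unfolding G_def G0_def root_sum_primitive_split[of \<beta>1 \<beta>2 Q] by simp
    have Gb: "0 \<le> Gb" "Gb \<le> C2 * error_term m Q"
      using C2(2)[of Q \<beta>1 \<beta>2] Q \<beta> by (auto simp: Gb_def intro!: sum_nonneg root_count_nonneg)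
    have G0: "0 \<le> G0" by (simp add: G0_def sum_nonneg root_count_nonneg)
    have "G0 \<le> (\<Sum>P\<in>{P \<in> height_ball Q. coeff P (2 * m) = 0}. ?N P)"
      unfolding G0_def by (intro sum_mono2 root_count_nonneg) (auto simp: finite_height_ball)
    also have "\<dots> \<le> (\<Sum>P\<in>{P \<in> height_ball Q. coeff P (2 * m) = 0}. real (2 * m + 1))"
      by (intro sum_mono root_count_le(2)[OF _ \<beta>(1,3), of _ Q]) auto
    also have "\<dots> = real (2 * m + 1) * real (card {P \<in> height_ball Q. coeff P (2 * m) = 0})" by simp
    also have "\<dots> \<le> real (2 * m + 1) * ((3 * real coeff_bound) ^ m * Q ^ m)"
      using card_vanishing_leading_coeff_le[OF Q] by (intro mult_left_mono) auto
    also have "\<dots> = K * Q ^ m" by (simp add: K_def)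
    also have "\<dots> \<le> K * error_term m Q" using error_term_ge[OF Q] by (intro mult_left_mono) (auto simp: K_def)
    finally have G0': "G0 \<le> K * error_term m Q" .
    have main: "\<bar>G - 2 * main_term m lam \<beta>1 \<beta>2 Q\<bar> \<le> C1 * error_term m Q"
      unfolding G_def main_term_eq using C1(2)[of Q \<beta>1 \<beta>2] Q \<beta> by simp
    have "error_term m Q \<ge> 0" using error_term_ge[OF Q] Q by (meson order_trans zero_le_power zero_le_one)
    then have "0 \<le> C1 * error_term m Q" using C1(1) by simp
    then have "\<bar>A - main_term m lam \<beta>1 \<beta>2 Q\<bar> \<le> C1 * error_term m Q + C2 * error_term m Q + K * error_term m Q"
      by (intro abs_diff_le_of_double[OF main G] Gb G0 G0')
    then show ?thesis unfolding A_def by (simp only: distrib_right)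
  qed
  moreover have "C1 + C2 + K \<ge> 0" using C1(1) C2(1) by (simp add: K_def)
  ultimately show ?thesis by blast
qed

end

theorem theorem2p1:
  fixes m :: nat and lam :: "nat \<Rightarrow> real"
  assumes "m \<ge> 1"
    and "\<And>k. k \<le> 2 * m \<Longrightarrow> lam k > 0"
    and "\<And>k. k \<le> 2 * m \<Longrightarrow> lam k = lam (2 * m - k)"
  shows "(\<exists>C. \<forall>\<^sub>F Q in at_top. \<forall>\<beta>\<^sub>1 \<beta>\<^sub>2. - pi \<le> \<beta>\<^sub>1 \<and> \<beta>\<^sub>1 < \<beta>\<^sub>2 \<and> \<beta>\<^sub>2 \<le> pi \<longrightarrow>
            \<bar>real (angle_count m lam \<beta>\<^sub>1 \<beta>\<^sub>2 Q) - main_term m lam \<beta>\<^sub>1 \<beta>\<^sub>2 Q\<bar> \<le> C * (Q ^ m * ln Q)) \<and>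
         (m \<ge> 3 \<longrightarrow> (\<exists>C. \<forall>\<^sub>F Q in at_top. \<forall>\<beta>\<^sub>1 \<beta>\<^sub>2. - pi \<le> \<beta>\<^sub>1 \<and> \<beta>\<^sub>1 < \<beta>\<^sub>2 \<and> \<beta>\<^sub>2 \<le> pi \<longrightarrow>
            \<bar>real (angle_count m lam \<beta>\<^sub>1 \<beta>\<^sub>2 Q) - main_term m lam \<beta>\<^sub>1 \<beta>\<^sub>2 Q\<bar> \<le> C * Q ^ m))"
proof -
  obtain C where C: "C \<ge> 0" "\<And>Q \<beta>1 \<beta>2. Q \<ge> 1 \<and> - pi \<le> \<beta>1 \<and> \<beta>1 \<le> \<beta>2 \<and> \<beta>2 \<le> pi \<Longrightarrow>
     \<bar>real (angle_count m lam \<beta>1 \<beta>2 Q) - main_term m lam \<beta>1 \<beta>2 Q\<bar> \<le> C * error_term m Q"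
    using angle_count_asymptotics[of m lam, OF assms] by blast
  \<comment> \<open>From Q \<ge> e on, 1 + ln Q \<le> 2 ln Q; hence the constant 2 C.\<close>
  have log: "\<bar>real (angle_count m lam \<beta>1 \<beta>2 Q) - main_term m lam \<beta>1 \<beta>2 Q\<bar> \<le> 2 * C * (Q ^ m * ln Q)"
    if Q: "Q \<ge> exp 1" and \<beta>: "- pi \<le> \<beta>1 \<and> \<beta>1 < \<beta>2 \<and> \<beta>2 \<le> pi" for Q \<beta>1 \<beta>2
  proof -
    have Q1: "Q \<ge> 1" using Q exp_ge_add_one_self[of 1] by linarith
    have "ln Q \<ge> 1" using Q Q1 by (simp add: ln_ge_iff)
    then have "error_term m Q \<le> Q ^ m * (2 * ln Q)"
      unfolding error_term_def using Q1 by (intro mult_left_mono) auto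
    then have "C * error_term m Q \<le> C * (Q ^ m * (2 * ln Q))" using C(1) by (rule mult_left_mono)
    then show ?thesis using C(2)[of Q \<beta>1 \<beta>2] Q1 \<beta> by simp
  qed
  have nolog: "\<bar>real (angle_count m lam \<beta>1 \<beta>2 Q) - main_term m lam \<beta>1 \<beta>2 Q\<bar> \<le> C * Q ^ m"
    if "m \<ge> 3" "Q \<ge> 1" "- pi \<le> \<beta>1 \<and> \<beta>1 < \<beta>2 \<and> \<beta>2 \<le> pi" for Q \<beta>1 \<beta>2
    using C(2)[of Q \<beta>1 \<beta>2] that by (simp add: error_term_def)
  show ?thesis
  proof (intro conjI impI)
    show "\<exists>C. \<forall>\<^sub>F Q in at_top. \<forall>\<beta>1 \<beta>2. - pi \<le> \<beta>1 \<and> \<beta>1 < \<beta>2 \<and> \<beta>2 \<le> pi \<longrightarrow>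
        \<bar>real (angle_count m lam \<beta>1 \<beta>2 Q) - main_term m lam \<beta>1 \<beta>2 Q\<bar> \<le> C * (Q ^ m * ln Q)"
      using log by (intro exI[of _ "2 * C"] eventually_mono[OF eventually_ge_at_top[of "exp 1"]] allI impI)
    assume "m \<ge> 3"
    then show "\<exists>C. \<forall>\<^sub>F Q in at_top. \<forall>\<beta>1 \<beta>2. - pi \<le> \<beta>1 \<and> \<beta>1 < \<beta>2 \<and> \<beta>2 \<le> pi \<longrightarrow>
        \<bar>real (angle_count m lam \<beta>1 \<beta>2 Q) - main_term m lam \<beta>1 \<beta>2 Q\<bar> \<le> C * Q ^ m"
      using nolog by (intro exI[of _ C] eventually_mono[OF eventually_ge_at_top[of 1]] allI impI)
  qed
qed

end
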